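(* Let $\bar U=(\bar\rho_1,\dots,\bar\rho_n,\bar v,\bar\theta)$ be a classical solution of the multicomponent system without mass diffusion and heat conduction $$\partial_t\bar\rho_i+\mathrm{div}(\bar\rho_i\bar v)=0\ (i=1,\dots,n),\qquad \partial_t(\bar\rho\bar v)+\mathrm{div}(\bar\rho\bar v\otimes\bar v+\bar p\,\mathbb I)=0,$$ $$\partial_t\big(\bar\rho\bar e+\tfrac12\bar\rho|\bar v|^2\big)+\mathrm{div}\big((\bar\rho\bar e+\tfrac12\bar\rho|\bar v|^2)\bar v+\bar p\bar v\big)=0,$$ defined on a maximal interval of existence $\mathbb T^3\times[0,T^* )$, and let $U^{\epsilon,\kappa}=(\rho_1,\dots,\rho_n,v,\theta)$ be a family of classical solutions, defined on $\mathbb T^3\times[0,T]$ with $T<T^*$, of the system $$\partial_t\rho_i+\mathrm{div}(\rho_iv)=-\mathrm{div}(\rho_iu_i)\ (i=1,\dots,n),\qquad \partial_t(\rho v)+\mathrm{div}(\rho v\otimes v+p\,\mathbb I)=0,$$ $$\partial_t\big(\rho e+\tfrac12\rho|v|^2\big)+\mathrm{div}\big((\rho e+\tfrac12\rho|v|^2)v+pv\big)=\mathrm{div}\Big(\kappa\nabla\theta-\sum_i(\rho_ie_i+p_i)u_i\Big),$$ where $u_1,\dots,u_n$ are determined by $$-\sum_{j\neq i}b_{ij}\theta\rho_i\rho_j(u_i-u_j)=\epsilon\Big(-\frac{\rho_i}{\rho}\nabla p+\rho_i\theta\nabla\frac{\mu_i}{\theta}-\theta(\rho_ie_i+p_i)\nabla\frac1\theta\Big),\qquad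 \sum_i\rho_iu_i=0 ,$$ emanating from smooth data $\bar U_0$ and $U_0^{\epsilon,\kappa}$ respectively. Suppose that, for some $\delta,M>0$ (uniformly in $\epsilon,\kappa$), the states $\omega=(\rho_1,\dots,\rho_n,\theta)$ and $\bar\omega=(\bar\rho_1,\dots,\bar\rho_n,\bar\theta)$ of these solutions take values in $\mathcal U$ and satisfy $$0<\rho_j,\bar\rho_j\le M,\qquad \delta\le\rho,\bar\rho\le M,\qquad \delta\le\theta,\bar\theta\le M ;$$ that $\psi\in C^3(\overline{\mathcal U})$; that the internal energy $\rho e=\rho\tilde e(\rho_1,\dots,\rho_n,\rho\eta)$, expressed as a function of the densities and of $\rho\eta$, satisfies $$\frac{\partial(\rho\tilde e)}{\partial(\rho\eta)}>0,\qquad \frac{\partial^2(\rho\tilde e)}{\partial(\rho\eta)^2}>0,\qquad \nabla^2_{(\rho_1,\dots,\rho_n,\rho\eta)}(\rho\tilde e)>0\ \text{(positive definite)};$$ that $$\sum_j\Big|\frac{h_j-\rho_j\mu_j}{\sqrt{\rho_j}}\Big|^2\le\alpha(\rho e+1)\qquad\text{for some }\alpha>0,\qquad h_j:=\rho_je_j+p_j;$$ and that $0\le\kappa(\rho_1,\dots,\rho_n,\theta)\le M$. Then there exist constants $c,C_1,C_2>0$ independent of $\epsilon$ and $\kappa$ such that for $t\in(0,T)$ $$\int_{\mathbb T^3}I(U^{\epsilon,\kappa}|\bar U)(x,t)\,dx\le c\int_{\mathbb T^3}I(U_0^{\epsilon,\kappa}|\bar U_0)\,dx+\|\kappa\|_\infty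 C_1+\epsilon C_2 .$$ In particular, if $\int_{\mathbb T^3}I(U_0^{\epsilon,\kappa}|\bar U_0)\,dx\to0$ as $\epsilon,\kappa\to0$, then $$\sup_{t\in(0,T)}\int_{\mathbb T^3}I(U^{\epsilon,\kappa}|\bar U)\,dx\to0\quad\text{as }\epsilon,\kappa\to0 .$$
   Context: $\mathbb T^3=(\mathbb R/2\pi\mathbb Z)^3$. The fluid has $n$ components with mass densities $\rho_i$, common velocity $v\in\mathbb R^3$, common temperature $\theta>0$, and total mass $\rho=\sum_i\rho_i$. $\mathcal U\subset(\mathbb R^+)^{n+1}$ is a set with compact closure $\overline{\mathcal U}$. Thermodynamics: the Helmholtz free energy $\rho\psi=\rho\psi(\rho_1,\dots,\rho_n,\theta)$ is given, and the entropy $\rho\eta$, internal energy $\rho e$, chemical potentials $\mu_i$ and total pressure $p$ are determined by $$(\rho\psi)_\theta=-\rho\eta,\quad \rho\psi=\rho e-\rho\eta\theta,\quad (\rho\psi)_{\rho_i}=\mu_i,\quad \rho\psi+p=\sum_i\rho_i\mu_i .$$ The partial internal energies $e_i$ and partial pressures $p_i$ are given constitutive functions of $(\rho_1,\dots,\rho_n,\theta)$ with $\sum_i\rho_ie_i=\rho e$ and $\sum_ip_i=p$. The heat conductivity $\kappa=\kappa(\rho_1,\dots,\rho_n,\theta)\ge0$ is a given function, $\|\kappa\|_\infty$ is its supremum norm, and $\kappa\to0$ means $\|\kappa\|_\infty\to0$. The coefficients $b_{ij}=b_{ij}(\rho_i,\rho_j,\theta)$ are symmetric ($b_{ij}=b_{ji}$)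 and strictly positive, with $\mu:=\min_{i\ne j}b_{ij}>0$ (minimum over the range of states considered). The parameter $\epsilon>0$ measures the mass diffusivity. A bar over a thermodynamic function means that it is evaluated at the barred state $\bar\omega=(\bar\rho_1,\dots,\bar\rho_n,\bar\theta)$; unbarred ones are evaluated at $\omega=(\rho_1,\dots,\rho_n,\theta)$. With $U=(\rho_1,\dots,\rho_n,v,\theta)$ and $\bar U=(\bar\rho_1,\dots,\bar\rho_n,\bar v,\bar\theta)$, the relative quantity is $$I(U|\bar U)=\tfrac12\rho|v-\bar v|^2+J(\omega|\bar\omega),\qquad J(\omega|\bar\omega)=\rho e-\bar\rho\bar e-\sum_i\bar\mu_i(\rho_i-\bar\rho_i)-\bar\theta(\rho\eta-\bar\rho\bar\eta).$$ *)

theory Defs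
  imports "HOL-Analysis.Analysis"
begin

text \<open>
  A thermodynamic state is \<open>\<omega> = ((\<rho>\<^sub>1, \<dots>, \<rho>\<^sub>n), \<theta>)\<close>, the components being indexed by a finite type;
  a full unknown is \<open>U = ((\<rho>\<^sub>1, \<dots>, \<rho>\<^sub>n), v, \<theta>)\<close>, and a flow is a map from time and space to unknowns.
  The torus \<open>(\<real>/2\<pi>\<int>)\<^sup>3\<close> is represented by functions on \<open>\<real>\<^sup>3\<close> that are \<open>2\<pi>\<close>-periodic in each
  coordinate, integrated over one period cell.
\<close>

type_synonym 'n state = "(real^'n) \<times> real"
type_synonym 'n unknown = "(real^'n) \<times> (real^3) \<times> real"
type_synonym 'n flow = "real \<Rightarrow> real^3 \<Rightarrow> 'n unknown"

definition dens :: "'n::finite unknown \<Rightarrow> real^'n" where "dens w = fst w"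
definition vel :: "'n::finite unknown \<Rightarrow> real^3" where "vel w = fst (snd w)"
definition temp :: "'n::finite unknown \<Rightarrow> real" where "temp w = snd (snd w)"
definition state_of :: "'n::finite unknown \<Rightarrow> 'n state" where "state_of w = (dens w, temp w)"

definition total_mass :: "real^'n::finite \<Rightarrow> real" where "total_mass r = (\<Sum>i\<in>UNIV. r $ i)"

definition phase_space :: "'n::finite state set" where
  "phase_space = {(r, \<theta>). (\<forall>i. 0 < r $ i) \<and> 0 < \<theta>}"

subsection \<open>Regularity\<close>

text \<open>Meaningful for open \<open>S\<close>: \<open>f\<close> and all its iterated directional derivatives up to order \<open>k\<close>
  are continuous on \<open>S\<close>.\<close>

primrec Ck_on :: "nat \<Rightarrow> 'a::euclidean_space set \<Rightarrow> ('a \<Rightarrow> 'b::real_normed_vector) \<Rightarrow> bool" where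
  "Ck_on 0 S f \<longleftrightarrow> continuous_on S f"
| "Ck_on (Suc k) S f \<longleftrightarrow> (\<forall>x\<in>S. f differentiable (at x)) \<and>
     (\<forall>h. Ck_on k S (\<lambda>x. frechet_derivative f (at x) h))"

definition smooth :: "('a::euclidean_space \<Rightarrow> 'b::real_normed_vector) \<Rightarrow> bool" where
  "smooth f \<longleftrightarrow> (\<forall>k. Ck_on k UNIV f)"

text \<open>The class \<open>C\<^sup>k\<close> on a set that need not be open: \<open>C\<^sup>k\<close> on some open neighbourhood of it.\<close>

definition Ck_near :: "nat \<Rightarrow> 'a::euclidean_space set \<Rightarrow> ('a \<Rightarrow> 'b::real_normed_vector) \<Rightarrow> bool" where
  "Ck_near k K f \<longleftrightarrow> (\<exists>V. open V \<and> K \<subseteq> V \<and> Ck_on k V f)"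

definition torus_periodic :: "(real^3 \<Rightarrow> 'b) \<Rightarrow> bool" where
  "torus_periodic f \<longleftrightarrow> (\<forall>x i. f (x + axis i (2 * pi)) = f x)"

definition torus_integral :: "(real^3 \<Rightarrow> real) \<Rightarrow> real" where
  "torus_integral f = integral (cbox 0 (\<chi> i. 2 * pi)) f"

subsection \<open>Differential operators\<close>

text \<open>\<open>I\<close> is the time interval on which \<open>f\<close> lives; the derivative is one-sided at its end points.\<close>

definition dt :: "real set \<Rightarrow> (real \<Rightarrow> real^3 \<Rightarrow> 'b::real_normed_vector) \<Rightarrow> real \<Rightarrow> real^3 \<Rightarrow> 'b" where
  "dt I f t x = vector_derivative (\<lambda>s. f s x) (at t within I)"

definition grad :: "(real^3 \<Rightarrow> real) \<Rightarrow> real^3 \<Rightarrow> real^3" where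
  "grad f x = (\<chi> j. frechet_derivative f (at x) (axis j 1))"

definition diver :: "(real^3 \<Rightarrow> real^3) \<Rightarrow> real^3 \<Rightarrow> real" where
  "diver F x = (\<Sum>j\<in>UNIV. frechet_derivative F (at x) (axis j 1) $ j)"

definition tensor_diver :: "(real^3 \<Rightarrow> real^3^3) \<Rightarrow> real^3 \<Rightarrow> real^3" where
  "tensor_diver A x = (\<chi> i. \<Sum>j\<in>UNIV. frechet_derivative A (at x) (axis j 1) $ i $ j)"

definition tensor_prod :: "real^3 \<Rightarrow> real^3 \<Rightarrow> real^3^3" where
  "tensor_prod a c = (\<chi> i j. a $ i * c $ j)"

text \<open>Continuously differentiable in space, with \<open>f\<close> and its space derivatives continuous in
  \<open>(t, x)\<close>; respectively continuously differentiable in time and space.\<close>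

definition C1_space :: "real set \<Rightarrow> (real \<Rightarrow> real^3 \<Rightarrow> 'b::real_normed_vector) \<Rightarrow> bool" where
  "C1_space I f \<longleftrightarrow>
     (\<forall>t\<in>I. \<forall>x. f t differentiable (at x)) \<and>
     continuous_on (I \<times> UNIV) (\<lambda>(t, x). f t x) \<and>
     (\<forall>h. continuous_on (I \<times> UNIV) (\<lambda>(t, x). frechet_derivative (f t) (at x) h))"

definition C1_space_time :: "real set \<Rightarrow> (real \<Rightarrow> real^3 \<Rightarrow> 'b::real_normed_vector) \<Rightarrow> bool" where
  "C1_space_time I f \<longleftrightarrow> C1_space I f \<and>
     (\<forall>t\<in>I. \<forall>x. (\<lambda>s. f s x) differentiable (at t within I)) \<and>
     continuous_on (I \<times> UNIV) (\<lambda>(t, x). dt I f t x)"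

subsection \<open>Thermodynamics\<close>

definition rho_psi :: "('n::finite state \<Rightarrow> real) \<Rightarrow> 'n state \<Rightarrow> real" where
  "rho_psi \<psi> \<omega> = total_mass (fst \<omega>) * \<psi> \<omega>"

definition rho_eta :: "('n::finite state \<Rightarrow> real) \<Rightarrow> 'n state \<Rightarrow> real" where
  "rho_eta \<psi> \<omega> = - frechet_derivative (rho_psi \<psi>) (at \<omega>) (0, 1)"

definition chem_pot :: "('n::finite state \<Rightarrow> real) \<Rightarrow> 'n state \<Rightarrow> real^'n" where
  "chem_pot \<psi> \<omega> = (\<chi> i. frechet_derivative (rho_psi \<psi>) (at \<omega>) (axis i 1, 0))"

definition rho_e :: "('n::finite state \<Rightarrow> real) \<Rightarrow> 'n state \<Rightarrow> real" where
  "rho_e \<psi> \<omega> = rho_psi \<psi> \<omega> + rho_eta \<psi> \<omega> * snd \<omega>"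

definition pressure :: "('n::finite state \<Rightarrow> real) \<Rightarrow> 'n state \<Rightarrow> real" where
  "pressure \<psi> \<omega> = (\<Sum>i\<in>UNIV. fst \<omega> $ i * chem_pot \<psi> \<omega> $ i) - rho_psi \<psi> \<omega>"

definition entropy_coords :: "('n::finite state \<Rightarrow> real) \<Rightarrow> 'n state \<Rightarrow> (real^'n) \<times> real" where
  "entropy_coords \<psi> \<omega> = (fst \<omega>, rho_eta \<psi> \<omega>)"

text \<open>The internal energy as a function of the densities and of \<open>\<rho>\<eta>\<close>; meaningful on the image
  of the phase space when \<open>entropy_coords \<psi>\<close> is injective there.\<close>

definition rho_e_tilde :: "('n::finite state \<Rightarrow> real) \<Rightarrow> (real^'n) \<times> real \<Rightarrow> real" where
  "rho_e_tilde \<psi> z = rho_e \<psi> (inv_into phase_space (entropy_coords \<psi>) z)"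

text \<open>The phase space is mapped injectively, so \<open>\<theta>\<close> can be replaced by \<open>\<rho>\<eta>\<close> as an independent
  variable.  \<open>G\<close> and \<open>H\<close> are the gradient and the Hessian of the internal energy in the variables
  \<open>(\<rho>\<^sub>1, \<dots>, \<rho>\<^sub>n, \<rho>\<eta>)\<close>.\<close>

definition convex_internal_energy :: "('n::finite state \<Rightarrow> real) \<Rightarrow> bool" where
  "convex_internal_energy \<psi> \<longleftrightarrow>
     inj_on (entropy_coords \<psi>) phase_space \<and>
     (\<exists>G H. \<forall>z\<in>entropy_coords \<psi> ` phase_space.
        (GDERIV (rho_e_tilde \<psi>) z :> G z) \<and> (G has_derivative H z) (at z) \<and>
        0 < snd (G z) \<and> 0 < snd (H z (0, 1)) \<and> (\<forall>h. h \<noteq> 0 \<longrightarrow> 0 < h \<bullet> H z h))"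

text \<open>\<open>h\<^sub>i = \<rho>\<^sub>i e\<^sub>i + p\<^sub>i\<close>\<close>

definition enthalpy ::
    "('n::finite state \<Rightarrow> real^'n) \<Rightarrow> ('n state \<Rightarrow> real^'n) \<Rightarrow> 'n state \<Rightarrow> 'n \<Rightarrow> real" where
  "enthalpy e p \<omega> i = fst \<omega> $ i * e \<omega> $ i + p \<omega> $ i"

definition bounded_state :: "real \<Rightarrow> real \<Rightarrow> 'n::finite state \<Rightarrow> bool" where
  "bounded_state \<delta> M \<omega> \<longleftrightarrow> (\<forall>j. 0 < fst \<omega> $ j \<and> fst \<omega> $ j \<le> M) \<and>
     \<delta> \<le> total_mass (fst \<omega>) \<and> total_mass (fst \<omega>) \<le> M \<and> \<delta> \<le> snd \<omega> \<and> snd \<omega> \<le> M"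

definition sup_norm_on :: "'a set \<Rightarrow> ('a \<Rightarrow> real) \<Rightarrow> real" where
  "sup_norm_on S \<kappa> = (SUP \<omega>\<in>S. \<bar>\<kappa> \<omega>\<bar>)"

text \<open>The limit \<open>\<epsilon>, \<kappa> \<rightarrow> 0\<close> within the parameter set \<open>A\<close>, where \<open>\<kappa> \<rightarrow> 0\<close> in supremum norm over the
  states in \<open>S\<close>.\<close>

definition vanishing :: "'a set \<Rightarrow> (real \<times> ('a \<Rightarrow> real)) set \<Rightarrow> (real \<times> ('a \<Rightarrow> real)) filter" where
  "vanishing S A =
     inf (filtercomap (\<lambda>(\<epsilon>, \<kappa>). (\<epsilon>, sup_norm_on S \<kappa>)) (nhds (0, 0))) (principal A)"

subsection \<open>The two systems\<close>

definition momentum :: "'n::finite unknown \<Rightarrow> real^3" where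
  "momentum w = total_mass (dens w) *\<^sub>R vel w"

definition energy :: "('n::finite state \<Rightarrow> real) \<Rightarrow> 'n unknown \<Rightarrow> real" where
  "energy \<psi> w = rho_e \<psi> (state_of w) + total_mass (dens w) * (norm (vel w))\<^sup>2 / 2"

definition momentum_flux :: "('n::finite state \<Rightarrow> real) \<Rightarrow> 'n unknown \<Rightarrow> real^3^3" where
  "momentum_flux \<psi> w =
     total_mass (dens w) *\<^sub>R tensor_prod (vel w) (vel w) + pressure \<psi> (state_of w) *\<^sub>R mat 1"

definition energy_flux :: "('n::finite state \<Rightarrow> real) \<Rightarrow> 'n unknown \<Rightarrow> real^3" where
  "energy_flux \<psi> w = energy \<psi> w *\<^sub>R vel w + pressure \<psi> (state_of w) *\<^sub>R vel w"

definition euler_solution :: "('n::finite state \<Rightarrow> real) \<Rightarrow> real set \<Rightarrow> 'n flow \<Rightarrow> bool" where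
  "euler_solution \<psi> I W \<longleftrightarrow>
     C1_space_time I W \<and>
     (\<forall>t\<in>I. torus_periodic (W t)) \<and>
     (\<forall>t\<in>I. \<forall>x. state_of (W t x) \<in> phase_space) \<and>
     (\<forall>t\<in>I. \<forall>x.
        (\<forall>i. dt I (\<lambda>t x. dens (W t x) $ i) t x
             + diver (\<lambda>x. dens (W t x) $ i *\<^sub>R vel (W t x)) x = 0) \<and>
        dt I (\<lambda>t x. momentum (W t x)) t x
          + tensor_diver (\<lambda>x. momentum_flux \<psi> (W t x)) x = 0 \<and>
        dt I (\<lambda>t x. energy \<psi> (W t x)) t x
          + diver (\<lambda>x. energy_flux \<psi> (W t x)) x = 0)"

definition times_below :: "ereal \<Rightarrow> real set" where
  "times_below Tstar = {t. 0 \<le> t \<and> ereal t < Tstar}"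

definition maximal_euler_solution ::
    "('n::finite state \<Rightarrow> real) \<Rightarrow> ereal \<Rightarrow> 'n flow \<Rightarrow> bool" where
  "maximal_euler_solution \<psi> Tstar W \<longleftrightarrow>
     0 < Tstar \<and> euler_solution \<psi> (times_below Tstar) W \<and>
     \<not> (\<exists>T' W'. Tstar < T' \<and> euler_solution \<psi> (times_below T') W' \<and>
            (\<forall>t\<in>times_below Tstar. W' t = W t))"

text \<open>The linear system determining the diffusion velocities \<open>u\<^sub>1, \<dots>, u\<^sub>n\<close> of the flow \<open>w\<close> at \<open>x\<close>
  (at a fixed time).\<close>

definition diffusion_velocities ::
    "('n::finite state \<Rightarrow> real) \<Rightarrow> ('n state \<Rightarrow> real^'n) \<Rightarrow> ('n state \<Rightarrow> real^'n) \<Rightarrow>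
     ('n \<Rightarrow> 'n \<Rightarrow> real \<Rightarrow> real \<Rightarrow> real \<Rightarrow> real) \<Rightarrow> real \<Rightarrow>
     (real^3 \<Rightarrow> 'n unknown) \<Rightarrow> real^3 \<Rightarrow> ('n \<Rightarrow> real^3) \<Rightarrow> bool" where
  "diffusion_velocities \<psi> e p b \<epsilon> w x u \<longleftrightarrow>
     (let r = dens (w x); \<theta> = temp (w x) in
       (\<forall>i. - (\<Sum>j\<in>UNIV - {i}. (b i j (r $ i) (r $ j) \<theta> * \<theta> * r $ i * r $ j) *\<^sub>R (u i - u j))
          = \<epsilon> *\<^sub>R
             (- (r $ i / total_mass r) *\<^sub>R grad (\<lambda>y. pressure \<psi> (state_of (w y))) x
              + (r $ i * \<theta>) *\<^sub>R grad (\<lambda>y. chem_pot \<psi> (state_of (w y)) $ i / temp (w y)) x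
              - (\<theta> * enthalpy e p (state_of (w x)) i) *\<^sub>R grad (\<lambda>y. 1 / temp (w y)) x)) \<and>
       (\<Sum>i\<in>UNIV. r $ i *\<^sub>R u i) = 0)"

text \<open>Classical: the unknowns are \<open>C\<^sup>1\<close> in time and space and the diffusive fluxes, which already
  contain first space derivatives, are \<open>C\<^sup>1\<close> in space.\<close>

definition diffusive_solution ::
    "('n::finite state \<Rightarrow> real) \<Rightarrow> ('n state \<Rightarrow> real^'n) \<Rightarrow> ('n state \<Rightarrow> real^'n) \<Rightarrow>
     ('n \<Rightarrow> 'n \<Rightarrow> real \<Rightarrow> real \<Rightarrow> real \<Rightarrow> real) \<Rightarrow> real \<Rightarrow> ('n state \<Rightarrow> real) \<Rightarrow>
     real set \<Rightarrow> 'n flow \<Rightarrow> bool" where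
  "diffusive_solution \<psi> e p b \<epsilon> \<kappa> I W \<longleftrightarrow>
     C1_space_time I W \<and>
     (\<forall>t\<in>I. torus_periodic (W t)) \<and>
     (\<forall>t\<in>I. \<forall>x. state_of (W t x) \<in> phase_space) \<and>
     (\<exists>u :: 'n \<Rightarrow> real \<Rightarrow> real^3 \<Rightarrow> real^3.
        let mass_flux = (\<lambda>i t x. dens (W t x) $ i *\<^sub>R u i t x);
            heat_flux = (\<lambda>t x. \<kappa> (state_of (W t x)) *\<^sub>R grad (\<lambda>y. temp (W t y)) x
              - (\<Sum>i\<in>UNIV. enthalpy e p (state_of (W t x)) i *\<^sub>R u i t x))
        in
          (\<forall>i. C1_space I (mass_flux i)) \<and> C1_space I heat_flux \<and>
          (\<forall>i. \<forall>t\<in>I. torus_periodic (u i t)) \<and>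
          (\<forall>t\<in>I. \<forall>x.
            diffusion_velocities \<psi> e p b \<epsilon> (W t) x (\<lambda>i. u i t x) \<and>
            (\<forall>i. dt I (\<lambda>t x. dens (W t x) $ i) t x
                 + diver (\<lambda>x. dens (W t x) $ i *\<^sub>R vel (W t x)) x
                 = - diver (mass_flux i t) x) \<and>
            dt I (\<lambda>t x. momentum (W t x)) t x
              + tensor_diver (\<lambda>x. momentum_flux \<psi> (W t x)) x = 0 \<and>
            dt I (\<lambda>t x. energy \<psi> (W t x)) t x
              + diver (\<lambda>x. energy_flux \<psi> (W t x)) x = diver (heat_flux t) x))"

subsection \<open>The relative quantity\<close>

definition rel_J :: "('n::finite state \<Rightarrow> real) \<Rightarrow> 'n state \<Rightarrow> 'n state \<Rightarrow> real" where
  "rel_J \<psi> \<omega> \<omega>' = rho_e \<psi> \<omega> - rho_e \<psi> \<omega>'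
     - (\<Sum>i\<in>UNIV. chem_pot \<psi> \<omega>' $ i * (fst \<omega> $ i - fst \<omega>' $ i))
     - snd \<omega>' * (rho_eta \<psi> \<omega> - rho_eta \<psi> \<omega>')"

definition rel_I :: "('n::finite state \<Rightarrow> real) \<Rightarrow> 'n unknown \<Rightarrow> 'n unknown \<Rightarrow> real" where
  "rel_I \<psi> w w' = total_mass (dens w) * (norm (vel w - vel w'))\<^sup>2 / 2
     + rel_J \<psi> (state_of w) (state_of w')"

end

theory Submission
  imports Defs
begin

text \<open>The proof is the relative energy method.  Write \<open>F = \<rho>\<psi>\<close> for the free energy, \<open>\<eta>\<close> for the entropy density
\<open>\<rho>\<eta>\<close>, and let primes denote the limit flow.  The relative energy
\<open>I = E - m \<bullet> v' + \<rho>|v'|\<^sup>2/2 - \<Sum> \<mu>'\<^sub>i \<rho>\<^sub>i - \<theta>' \<eta> + p'\<close> (with \<open>E\<close> the total energy and \<open>m\<close> the momentum) is an affine function of the conserved quantities and of the entropy of the diffusive flow, with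
coefficients that depend on the limit flow.  Three facts make it work.

\<^item> \<^emph>\<open>\<open>I\<close> controls the square of the distance.\<close>  Convexity of the internal energy in the densities and the entropy
  implies that \<open>F\<close> is convex in the densities and concave in the temperature (\<open>stability\<close>), and \<open>J\<close> splits into
  a convexity gap of the former and a concavity gap of the latter kind (\<open>rel_J_split\<close>).  The limit flow has
  its states in a compact part of the phase space, which is enough for a uniform lower bound although the
  diffusive flows may come close to the states with a vanishing density (\<open>rel_J_coercive\<close>).

\<^item> \<^emph>\<open>Transport produces only terms of second order.\<close>  Along particle paths, \<open>I\<close> changes by a divergence, by
  products of two differences, and by three terms that are of first order one by one.  The first-order parts of
  these three cancel, by the Maxwell relations, i.e. the symmetry of the second derivative of \<open>F\<close>
  (\<open>relative_energy_identity\<close>, \<open>first_order_cancellation\<close>).  What is left are Taylor remainders of the pressure and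
  the entropy, for which \<open>\<psi>\<close> has to be of class \<open>C\<^sup>3\<close>.

\<^item> \<^emph>\<open>Diffusion produces \<open>O(\<kappa> + \<epsilon>)\<close> at most.\<close>  The heat flux contributes \<open>- \<kappa>\<theta>'|\<nabla>\<theta>|\<^sup>2/\<theta>\<^sup>2\<close> and a term linear in \<open>\<kappa>\<nabla>\<theta>\<close>, the
  diffusion velocities contribute \<open>- (\<theta>'/2\<epsilon>) \<Sum> b\<^sub>i\<^sub>j \<rho>\<^sub>i \<rho>\<^sub>j |u\<^sub>i - u\<^sub>j|\<^sup>2\<close> and terms linear in the \<open>\<surd>\<rho>\<^sub>i u\<^sub>i\<close>.  Since
  \<open>\<Sum> \<rho>\<^sub>i u\<^sub>i = 0\<close>, the quadratic form dominates \<open>\<epsilon>\<^sup>-\<^sup>1 \<Sum> \<rho>\<^sub>i |u\<^sub>i|\<^sup>2\<close> (\<open>drag_dissipation\<close>); completing squares removes the linear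
  terms, and the growth condition on the enthalpies bounds what the squares cost
  (\<open>diffusive_production_bound\<close>).

Integration over the torus removes the divergence (\<open>torus_integral_diver\<close>), so that
\<open>d/dt \<integral>I \<le> C \<integral>I + O(\<parallel>\<kappa>\<parallel> + \<epsilon>)\<close>, and Gronwall's inequality concludes.  The limit statement follows by squeezing the
supremum between zero and this bound.\<close>

section \<open>Calculus with \<open>C\<^sup>k\<close> functions\<close>

abbreviation der :: "('a::real_normed_vector \<Rightarrow> 'b::real_normed_vector) \<Rightarrow> 'a \<Rightarrow> 'a \<Rightarrow> 'b" where
  "der f x \<equiv> frechet_derivative f (at x)"

lemma Ck_on_1_iff:
  "Ck_on 1 S f \<longleftrightarrow> (\<forall>x\<in>S. f differentiable (at x)) \<and>
     (\<forall>h. continuous_on S (\<lambda>x. der f x h))"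
  by simp

lemma Ck_on_has_derivative:
  assumes "Ck_on (Suc k) S f" "x \<in> S"
  shows "(f has_derivative der f x) (at x)"
  using assms by (simp add: frechet_derivative_works)

lemma Ck_on_continuous:
  assumes "Ck_on k S f" shows "continuous_on S f"
proof (cases k)
  case (Suc j)
  then show ?thesis
    using assms by (auto intro!: continuous_at_imp_continuous_on differentiable_imp_continuous_within)
qed (use assms in simp)

lemma Ck_on_SucD: "Ck_on (Suc k) S f \<Longrightarrow> Ck_on k S f"
proof (induction k arbitrary: f)
  case 0
  then show ?case using Ck_on_continuous[OF 0] by simp
next
  case (Suc k)
  then show ?case by (metis Ck_on.simps(2))
qed

lemma Ck_on_antimono: "Ck_on k S f \<Longrightarrow> j \<le> k \<Longrightarrow> Ck_on j S f"
  by (induction k) (auto simp: le_Suc_eq dest: Ck_on_SucD simp del: Ck_on.simps)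

lemma Ck_on_cong:
  assumes "open S" "\<And>x. x \<in> S \<Longrightarrow> f x = g x" "Ck_on k S f"
  shows "Ck_on k S g"
  using assms(2,3)
proof (induction k arbitrary: f g)
  case 0 then show ?case by (simp cong: continuous_on_cong_simp)
next
  case (Suc k)
  have d: "(g has_derivative der f x) (at x)" if "x \<in> S" for x
    using has_derivative_transform_within_open[OF Ck_on_has_derivative[OF Suc.prems(2) that] assms(1) that] 
      Suc.prems(1) by blast
  have eq: "der g x = der f x" if "x \<in> S" for x
    by (rule frechet_derivative_at[symmetric, OF d[OF that]])
  have "Ck_on k S (\<lambda>x. der f x h)" for h
    using Suc.prems(2) by simp
  then have "Ck_on k S (\<lambda>x. der g x h)" for h
    by (rule Suc.IH[rotated]) (simp only: eq)
  then show ?case using d by (auto simp: differentiable_def)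
qed

text \<open>The derivative only has to be identified on \<open>S\<close>: by openness it is locally determined there, so the
iterated derivatives of the two candidates agree as well.\<close>

lemma Ck_on_SucI:
  assumes "open S" "\<And>x. x \<in> S \<Longrightarrow> (f has_derivative f' x) (at x)"
    "\<And>h. Ck_on k S (\<lambda>x. f' x h)"
  shows "Ck_on (Suc k) S f"
proof -
  have "der f x = f' x" if "x \<in> S" for x
    using frechet_derivative_at[OF assms(2)[OF that]] by simp
  then have "Ck_on k S (\<lambda>x. der f x h)" for h
    using Ck_on_cong[OF assms(1) _ assms(3)[of h]] by simp
  then show ?thesis using assms(2) by (auto simp: differentiable_def)
qed

lemma Ck_on_const: "Ck_on k S (\<lambda>x. c)"
  by (induction k arbitrary: c) auto

lemma Ck_on_bounded_linear:
  assumes "open S" "bounded_linear L" shows "Ck_on k S L"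
proof (cases k)
  case 0
  then show ?thesis using assms by (simp add: linear_continuous_on)
next
  case (Suc j)
  show ?thesis unfolding Suc
    by (rule Ck_on_SucI[where f'="\<lambda>x. L"])
      (use assms Ck_on_const in \<open>auto simp: bounded_linear_imp_has_derivative\<close>)
qed

lemma Ck_on_add:
  assumes "open S" "Ck_on k S f" "Ck_on k S g" shows "Ck_on k S (\<lambda>x. f x + g x)"
  using assms(2,3)
proof (induction k arbitrary: f g)
  case 0 then show ?case by (auto intro: continuous_intros)
next
  case (Suc k)
  show ?case
  proof (rule Ck_on_SucI[OF assms(1)])
    show "((\<lambda>x. f x + g x) has_derivative
        (\<lambda>h. der f x h + der g x h)) (at x)" if "x \<in> S" for x
      using Suc.prems that by (intro derivative_intros Ck_on_has_derivative)
  qed (use Suc in auto)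
qed

lemma Ck_on_scaleR:
  assumes "open S" "Ck_on k S f" "Ck_on k S g" shows "Ck_on k S (\<lambda>x. f x *\<^sub>R g x)"
  using assms(2,3)
proof (induction k arbitrary: f g)
  case 0 then show ?case by (auto intro: continuous_intros)
next
  case (Suc k)
  show ?case
  proof (rule Ck_on_SucI[OF assms(1)])
    show "((\<lambda>x. f x *\<^sub>R g x) has_derivative
        (\<lambda>h. f x *\<^sub>R der g x h + der f x h *\<^sub>R g x)) (at x)"
      if "x \<in> S" for x
      using Suc.prems that by (intro derivative_intros Ck_on_has_derivative)
    show "Ck_on k S (\<lambda>x. f x *\<^sub>R der g x h + der f x h *\<^sub>R g x)" for h
      using Suc.prems Ck_on_SucD[OF Suc.prems(1)] Ck_on_SucD[OF Suc.prems(2)]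
      by (intro Ck_on_add[OF assms(1)] Suc.IH) auto
  qed
qed

lemma Ck_on_mult:
  fixes f g :: "'a::euclidean_space \<Rightarrow> real"
  assumes "open S" "Ck_on k S f" "Ck_on k S g" shows "Ck_on k S (\<lambda>x. f x * g x)"
  using Ck_on_scaleR[OF assms] by simp

lemma Ck_on_linear_image:
  assumes "open S" "Ck_on k S f" "bounded_linear L" shows "Ck_on k S (\<lambda>x. L (f x))"
  using assms(2)
proof (induction k arbitrary: f)
  case 0 then show ?case using assms(3)
    by (simp add: bounded_linear.continuous_on)
next
  case (Suc k)
  show ?case
  proof (rule Ck_on_SucI[OF assms(1)])
    show "((\<lambda>x. L (f x)) has_derivative (\<lambda>h. L (der f x h))) (at x)" if "x \<in> S" for x
      using Suc.prems that by (intro bounded_linear.has_derivative[OF assms(3)] Ck_on_has_derivative)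
  qed (use Suc in auto)
qed

lemma Ck_on_uminus: "open S \<Longrightarrow> Ck_on k S f \<Longrightarrow> Ck_on k S (\<lambda>x. - f x)"
  by (erule (1) Ck_on_linear_image) (simp add: bounded_linear_minus bounded_linear_ident)

lemma Ck_on_diff:
  assumes "open S" "Ck_on k S f" "Ck_on k S g" shows "Ck_on k S (\<lambda>x. f x - g x)"
  using Ck_on_add[OF assms(1,2) Ck_on_uminus[OF assms(1,3)]] by simp

lemma Ck_on_sum:
  assumes "open S" "\<And>i. i \<in> A \<Longrightarrow> Ck_on k S (f i)" shows "Ck_on k S (\<lambda>x. \<Sum>i\<in>A. f i x)"
  using assms(2) by (induction A rule: infinite_finite_induct) (auto intro: Ck_on_add Ck_on_const assms(1))

lemma frechet_derivative_basis_sum: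
  fixes f :: "'a::euclidean_space \<Rightarrow> 'b::real_normed_vector"
  assumes "f differentiable (at x)"
  shows "der f x h = (\<Sum>b\<in>Basis. (h \<bullet> b) *\<^sub>R der f x b)"
proof -
  interpret linear "der f x" by (rule linear_frechet_derivative[OF assms])
  have "der f x h = der f x (\<Sum>b\<in>Basis. (h \<bullet> b) *\<^sub>R b)"
    by (simp add: euclidean_representation)
  then show ?thesis by (simp add: sum scale)
qed

text \<open>Continuity for each fixed direction gives joint continuity, because the derivative is a finite
combination of its values on the basis vectors.\<close>

lemma continuous_on_frechet_derivative_apply:
  fixes f :: "'a::euclidean_space \<Rightarrow> 'b::real_normed_vector"
  assumes "Ck_on 1 S f" "continuous_on R y" "y ` R \<subseteq> S" "continuous_on R h"
  shows "continuous_on R (\<lambda>z. der f (y z) (h z))"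
proof -
  have "continuous_on R (\<lambda>z. \<Sum>b\<in>Basis. (h z \<bullet> b) *\<^sub>R der f (y z) b)"
    using assms by (intro continuous_intros continuous_on_compose2[OF _ assms(2)]) auto
  moreover have "(\<Sum>b\<in>Basis. (h z \<bullet> b) *\<^sub>R der f (y z) b)
      = der f (y z) (h z)" if "z \<in> R" for z
    using assms(1,3) that by (intro frechet_derivative_basis_sum[symmetric]) auto
  ultimately show ?thesis by (simp cong: continuous_on_cong_simp)
qed

lemma Ck_on_1_compose:
  fixes f :: "'a::euclidean_space \<Rightarrow> 'b::euclidean_space"
    and g :: "'b \<Rightarrow> 'c::real_normed_vector"
  assumes "open R" "Ck_on 1 R f" "Ck_on 1 S g" "f ` R \<subseteq> S"
  shows "Ck_on 1 R (\<lambda>x. g (f x))"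
  unfolding One_nat_def
proof (rule Ck_on_SucI[OF assms(1)])
  show "((\<lambda>x. g (f x)) has_derivative
      (\<lambda>h. der g (f x) (der f x h))) (at x)" if "x \<in> R" for x
    using assms that Ck_on_has_derivative[of 0 R f x] Ck_on_has_derivative[of 0 S g "f x"]
    by (intro has_derivative_compose[of f _ x UNIV g]) auto
  show "Ck_on 0 R (\<lambda>x. der g (f x) (der f x h))" for h
    using continuous_on_frechet_derivative_apply[OF assms(3) Ck_on_continuous[OF assms(2)] assms(4)] assms(2)
    by simp
qed

lemma Ck_on_1_inverse:
  fixes f :: "'a::euclidean_space \<Rightarrow> real"
  assumes "open S" "Ck_on 1 S f" "\<And>x. x \<in> S \<Longrightarrow> f x \<noteq> 0"
  shows "Ck_on 1 S (\<lambda>x. inverse (f x))"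
proof -
  have "Ck_on 1 (- {0::real}) inverse"
    unfolding One_nat_def
    by (rule Ck_on_SucI[where f'="\<lambda>x h. - (inverse x * h * inverse x)"])
      (auto intro!: derivative_eq_intros continuous_intros)
  then show ?thesis
    by (rule Ck_on_1_compose[OF assms(1,2)]) (use assms(3) in auto)
qed

lemma Ck_on_1_divide:
  fixes f g :: "'a::euclidean_space \<Rightarrow> real"
  assumes "open S" "Ck_on 1 S f" "Ck_on 1 S g" "\<And>x. x \<in> S \<Longrightarrow> g x \<noteq> 0"
  shows "Ck_on 1 S (\<lambda>x. f x / g x)"
  using Ck_on_mult[OF assms(1,2) Ck_on_1_inverse[OF assms(1,3,4)]] by (simp add: divide_inverse)

text \<open>The mean value theorem, applied to the difference in the direction \<open>k\<close> along \<open>h\<close> and then to the resulting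
difference of first derivatives along \<open>k\<close>, turns the second difference into \<open>s\<^sup>2\<close> times a second
derivative at an intermediate point.\<close>

lemma second_difference_quotient:
  fixes F :: "'a::euclidean_space \<Rightarrow> real"
  assumes "open S" "x \<in> S" "Ck_on 2 S F" "0 < \<epsilon>"
  shows "\<forall>\<^sub>F s in at_right 0. \<bar>(F (x + s *\<^sub>R h + s *\<^sub>R k) - F (x + s *\<^sub>R h) - F (x + s *\<^sub>R k) + F x) / s^2
     - der (\<lambda>y. der F y h) x k\<bar> < \<epsilon>"
proof -
  define G where "G y = der F y h" for y
  define H where "H y = der G y k" for y
  have F: "(F has_derivative der F y) (at y)" if "y \<in> S" for y
    using assms(3) that by (intro Ck_on_has_derivative[of 1]) (simp_all add: numeral_2_eq_2)
  have "Ck_on (Suc 1) S F" using assms(3) by (simp only: numeral_2_eq_2 One_nat_def)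
  then have C: "Ck_on 1 S G" unfolding G_def[abs_def] by (simp only: Ck_on.simps(2))
  have G: "(G has_derivative der G y) (at y)" if "y \<in> S" for y
    using C that by (intro Ck_on_has_derivative[of 0]) simp_all
  have "continuous_on S H" using C by (simp add: H_def)
  then have "isCont H x" using assms(1,2) by (simp add: continuous_on_eq_continuous_at)
  then obtain d where d: "d > 0" "\<And>y. dist y x < d \<Longrightarrow> dist (H y) (H x) < \<epsilon>"
    using assms(4) unfolding continuous_at_eps_delta by blast
  obtain r where r: "r > 0" "ball x r \<subseteq> S" using assms(1,2) open_contains_ball by blast
  define m where "m = min d r / (norm h + norm k + 1)"
  have "m > 0" using d r by (auto simp: m_def intro!: divide_pos_pos add_nonneg_pos)
  have close: "dist (x + a *\<^sub>R h + c *\<^sub>R k) x < min d r" if "0 \<le> a" "a \<le> s" "0 \<le> c" "c \<le> s" "s < m" for a c s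
  proof -
    have "dist (x + a *\<^sub>R h + c *\<^sub>R k) x \<le> a * norm h + c * norm k"
      using that norm_triangle_ineq[of "a *\<^sub>R h" "c *\<^sub>R k"] by (simp add: dist_norm)
    also have "\<dots> \<le> s * norm h + s * norm k" using that by (intro add_mono mult_right_mono) auto
    also have "\<dots> \<le> s * (norm h + norm k + 1)" using that by (simp add: algebra_simps)
    also have "\<dots> < m * (norm h + norm k + 1)" using that
      by (intro mult_strict_right_mono) (auto intro: add_nonneg_pos)
    also have "\<dots> = min d r" unfolding m_def
      by (simp add: add_nonneg_eq_0_iff less_imp_neq[symmetric] add_nonneg_pos)
    finally show ?thesis .
  qed
  have step: "\<bar>(F (x + s *\<^sub>R h + s *\<^sub>R k) - F (x + s *\<^sub>R h) - F (x + s *\<^sub>R k) + F x) / s^2 - H x\<bar> < \<epsilon>"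
    if s: "0 < s" "s < m" for s
  proof -
    define f where "f a = F (x + a *\<^sub>R h + s *\<^sub>R k) - F (x + a *\<^sub>R h)" for a
    have inS: "x + a *\<^sub>R h + c *\<^sub>R k \<in> S" if "0 \<le> a" "a \<le> s" "0 \<le> c" "c \<le> s" for a c
      using close[OF that s(2)] r(2) by (auto simp: dist_commute subset_iff)
    have "(f has_real_derivative (G (x + a *\<^sub>R h + s *\<^sub>R k) - G (x + a *\<^sub>R h))) (at a)"
      if "0 \<le> a" "a \<le> s" for a
    proof -
      have 1: "x + a *\<^sub>R h + s *\<^sub>R k \<in> S" "x + a *\<^sub>R h \<in> S"
        using inS[of a s] inS[of a 0] that s by auto
      have 2: "linear (der F (x + a *\<^sub>R h + s *\<^sub>R k))" "linear (der F (x + a *\<^sub>R h))"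
        using F[OF 1(1)] F[OF 1(2)] has_derivative_linear by auto
      have "((\<lambda>a. F (x + a *\<^sub>R h + s *\<^sub>R k)) has_derivative
          (\<lambda>t. der F (x + a *\<^sub>R h + s *\<^sub>R k) (t *\<^sub>R h))) (at a)"
        by (rule has_derivative_compose[of "\<lambda>a. x + a *\<^sub>R h + s *\<^sub>R k", OF _ F[OF 1(1)]])
          (auto intro!: derivative_eq_intros)
      moreover have "((\<lambda>a. F (x + a *\<^sub>R h)) has_derivative
          (\<lambda>t. der F (x + a *\<^sub>R h) (t *\<^sub>R h))) (at a)"
        by (rule has_derivative_compose[of "\<lambda>a. x + a *\<^sub>R h", OF _ F[OF 1(2)]])
          (auto intro!: derivative_eq_intros)
      ultimately show ?thesis unfolding f_def has_field_derivative_def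
        using 2 by (auto intro!: derivative_eq_intros simp: G_def linear_scale algebra_simps)
    qed
    then obtain a where a: "0 < a" "a < s" "f s - f 0 = s * (G (x + a *\<^sub>R h + s *\<^sub>R k) - G (x + a *\<^sub>R h))"
      using MVT2[of 0 s f "\<lambda>a. G (x + a *\<^sub>R h + s *\<^sub>R k) - G (x + a *\<^sub>R h)"] s by auto
    have "((\<lambda>c. G (x + a *\<^sub>R h + c *\<^sub>R k)) has_real_derivative H (x + a *\<^sub>R h + c *\<^sub>R k)) (at c)"
      if "0 \<le> c" "c \<le> s" for c
    proof -
      have 1: "x + a *\<^sub>R h + c *\<^sub>R k \<in> S" using inS[of a c] that a by auto
      have "((\<lambda>c. G (x + a *\<^sub>R h + c *\<^sub>R k)) has_derivative
          (\<lambda>t. der G (x + a *\<^sub>R h + c *\<^sub>R k) (t *\<^sub>R k))) (at c)"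
        by (rule has_derivative_compose[of "\<lambda>c. x + a *\<^sub>R h + c *\<^sub>R k", OF _ G[OF 1]])
          (auto intro!: derivative_eq_intros)
      then show ?thesis unfolding has_field_derivative_def H_def
        using has_derivative_linear[OF G[OF 1]] by (simp add: linear_scale mult.commute[of _ "frechet_derivative G _ _"])
    qed
    then obtain c where c: "0 < c" "c < s" "G (x + a *\<^sub>R h + s *\<^sub>R k) - G (x + a *\<^sub>R h) = s * H (x + a *\<^sub>R h + c *\<^sub>R k)"
      using MVT2[of 0 s "\<lambda>c. G (x + a *\<^sub>R h + c *\<^sub>R k)" "\<lambda>c. H (x + a *\<^sub>R h + c *\<^sub>R k)"] s by auto
    have "F (x + s *\<^sub>R h + s *\<^sub>R k) - F (x + s *\<^sub>R h) - F (x + s *\<^sub>R k) + F x = s^2 * H (x + a *\<^sub>R h + c *\<^sub>R k)"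
      using a(3) c(3) by (simp add: f_def power2_eq_square)
    moreover have "dist (H (x + a *\<^sub>R h + c *\<^sub>R k)) (H x) < \<epsilon>"
      using d(2) close[of a s c] a c s by simp
    ultimately show ?thesis using s by (simp add: dist_real_def)
  qed
  show ?thesis
    unfolding eventually_at_right_field using step \<open>m > 0\<close>
    by (auto simp: H_def[abs_def] G_def[abs_def])
qed

text \<open>Both second difference quotients are the same expression, symmetric in the two directions.\<close>

lemma symmetric_second_derivative:
  fixes F :: "'a::euclidean_space \<Rightarrow> real"
  assumes "open S" "x \<in> S" "Ck_on 2 S F"
  shows "der (\<lambda>y. der F y h) x k
       = der (\<lambda>y. der F y k) x h" (is "?a = ?b")
proof (rule ccontr)
  define a b where "a = ?a" and "b = ?b"
  define q where "q s = (F (x + s *\<^sub>R h + s *\<^sub>R k) - F (x + s *\<^sub>R h) - F (x + s *\<^sub>R k) + F x) / s^2" for s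
  assume "?a \<noteq> ?b"
  then have "\<bar>a - b\<bar> / 2 > 0" by (simp add: a_def b_def)
  note quotient = second_difference_quotient[OF assms this]
  have "\<forall>\<^sub>F s in at_right 0. \<bar>q s - a\<bar> < \<bar>a - b\<bar> / 2"
    using quotient[of h k] by (simp add: q_def a_def)
  moreover have "\<forall>\<^sub>F s in at_right 0. \<bar>q s - b\<bar> < \<bar>a - b\<bar> / 2"
    using quotient[of k h] by (simp add: q_def b_def algebra_simps)
  ultimately have "\<forall>\<^sub>F s::real in at_right 0. False"
  proof eventually_elim
    case (elim s)
    have "\<bar>q s - a\<bar> + \<bar>q s - b\<bar> < \<bar>a - b\<bar>"
      using add_strict_mono[OF elim] by (simp only: field_sum_of_halves)
    moreover have "\<bar>a - b\<bar> \<le> \<bar>q s - b\<bar> + \<bar>q s - a\<bar>"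
      using abs_triangle_ineq4[of "q s - b" "q s - a"] by simp
    ultimately show False by simp
  qed
  then show False by simp
qed

section \<open>Gibbs and Maxwell relations\<close>

lemma bounded_linear_total_mass: "bounded_linear (total_mass :: real^'n::finite \<Rightarrow> real)"
  unfolding total_mass_def
  by (intro bounded_linear_sum bounded_linear_vec_nth)

lemmas total_mass_linear = bounded_linear.linear[OF bounded_linear_total_mass]

lemma open_phase_space: "open (phase_space :: 'n::finite state set)"
proof -
  have "phase_space = (\<Inter>i. {\<omega> :: 'n state. 0 < fst \<omega> $ i}) \<inter> {\<omega>. 0 < snd \<omega>}"
    by (auto simp: phase_space_def)
  moreover have "open \<dots>"
    by (intro open_Int open_INT ballI open_Collect_less continuous_intros finite)
  ultimately show ?thesis by simp
qed

lemma mem_phase_space: "\<omega> \<in> phase_space \<longleftrightarrow> (\<forall>i. 0 < fst \<omega> $ i) \<and> 0 < snd \<omega>"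
  by (simp add: phase_space_def case_prod_beta')

lemma rho_psi_Ck:
  assumes "open S" "Ck_on k S \<psi>" shows "Ck_on k S (rho_psi \<psi>)"
  unfolding rho_psi_def[abs_def]
  by (intro Ck_on_mult assms Ck_on_bounded_linear
      bounded_linear_compose[OF bounded_linear_total_mass bounded_linear_fst])

text \<open>The relations below are local.  They are used on two open sets: on the whole phase space, where \<open>\<psi>\<close> is
twice differentiable, and on a neighbourhood of the closure of the admissible states, where it is three times
differentiable but which may exceed the phase space.\<close>

locale thermodynamics =
  fixes \<psi> :: "'n::finite state \<Rightarrow> real" and S :: "'n state set"
  assumes open_S: "open S" and psi_C2: "Ck_on 2 S \<psi>"
begin

abbreviation d\<eta> :: "'n state \<Rightarrow> 'n state \<Rightarrow> real" where
  "d\<eta> \<omega> \<equiv> der (rho_eta \<psi>) \<omega>"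
abbreviation d\<mu> :: "'n \<Rightarrow> 'n state \<Rightarrow> 'n state \<Rightarrow> real" where
  "d\<mu> i \<omega> \<equiv> der (\<lambda>\<omega>. chem_pot \<psi> \<omega> $ i) \<omega>"

lemma rho_psi_C2: "Ck_on 2 S (rho_psi \<psi>)"
  by (rule rho_psi_Ck[OF open_S psi_C2])

lemma rho_psi_C1: "Ck_on (Suc 0) S (rho_psi \<psi>)"
  by (rule Ck_on_antimono[OF rho_psi_C2]) simp

lemma directional_C:
  assumes "Ck_on (Suc k) S (rho_psi \<psi>)"
  shows "Ck_on k S (\<lambda>\<omega>. der (rho_psi \<psi>) \<omega> h)"
  using assms unfolding Ck_on.simps by blast

lemma rho_eta_Ck: "Ck_on (Suc k) S (rho_psi \<psi>) \<Longrightarrow> Ck_on k S (rho_eta \<psi>)"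
  unfolding rho_eta_def[abs_def] by (intro Ck_on_uminus open_S directional_C)

lemma chem_pot_Ck: "Ck_on (Suc k) S (rho_psi \<psi>) \<Longrightarrow> Ck_on k S (\<lambda>\<omega>. chem_pot \<psi> \<omega> $ i)"
  unfolding chem_pot_def[abs_def] vec_lambda_beta by (rule directional_C)

lemma rho_e_Ck: "Ck_on (Suc k) S (rho_psi \<psi>) \<Longrightarrow> Ck_on k S (rho_e \<psi>)"
  unfolding rho_e_def[abs_def]
  by (rule Ck_on_add[OF open_S Ck_on_SucD Ck_on_mult[OF open_S rho_eta_Ck
      Ck_on_bounded_linear[OF open_S bounded_linear_snd]]])

lemma density_Ck: "Ck_on k S (\<lambda>\<omega>. fst \<omega> $ i)"
  by (intro Ck_on_bounded_linear open_S
      bounded_linear_compose[OF bounded_linear_vec_nth bounded_linear_fst])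

lemma pressure_Ck: "Ck_on (Suc k) S (rho_psi \<psi>) \<Longrightarrow> Ck_on k S (pressure \<psi>)"
  unfolding pressure_def[abs_def]
  by (rule Ck_on_diff[OF open_S Ck_on_sum[OF open_S
      Ck_on_mult[OF open_S density_Ck chem_pot_Ck]] Ck_on_SucD])

lemmas C2' = rho_psi_C2[unfolded numeral_2_eq_2]
lemmas rho_eta_C1 = rho_eta_Ck[OF C2', folded One_nat_def]
  and chem_pot_C1 = chem_pot_Ck[OF C2', folded One_nat_def]
  and rho_e_C1 = rho_e_Ck[OF C2', folded One_nat_def]
  and pressure_C1 = pressure_Ck[OF C2', folded One_nat_def]

lemma rho_psi_derivative:
  assumes "\<omega> \<in> S"
  shows "(rho_psi \<psi> has_derivative
    (\<lambda>h. (\<Sum>i\<in>UNIV. chem_pot \<psi> \<omega> $ i * fst h $ i) - rho_eta \<psi> \<omega> * snd h)) (at \<omega>)"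
proof -
  let ?D = "der (rho_psi \<psi>) \<omega>"
  have d: "(rho_psi \<psi> has_derivative ?D) (at \<omega>)"
    by (rule Ck_on_has_derivative[OF rho_psi_C1 assms])
  interpret D: linear ?D by (rule has_derivative_linear[OF d])
  have "?D h = (\<Sum>i\<in>UNIV. chem_pot \<psi> \<omega> $ i * fst h $ i) - rho_eta \<psi> \<omega> * snd h" for h
  proof -
    have "fst h = (\<Sum>i\<in>UNIV. fst h $ i *\<^sub>R axis i 1)"
      by (simp add: vec_eq_iff axis_def if_distrib sum.delta cong: if_cong)
    then have "h = (\<Sum>i\<in>UNIV. fst h $ i *\<^sub>R (axis i 1, 0)) + snd h *\<^sub>R (0, 1)"
      by (simp add: prod_eq_iff fst_sum snd_sum)
    then have "?D h = ?D ((\<Sum>i\<in>UNIV. fst h $ i *\<^sub>R (axis i 1, 0)) + snd h *\<^sub>R (0, 1))"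
      by (rule arg_cong)
    then show ?thesis
      by (simp add: D.add D.sum D.scale chem_pot_def rho_eta_def mult.commute del: scaleR_Pair)
  qed
  then have "?D = (\<lambda>h. (\<Sum>i\<in>UNIV. chem_pot \<psi> \<omega> $ i * fst h $ i) - rho_eta \<psi> \<omega> * snd h)" by blast
  then show ?thesis using d by simp
qed

lemma rho_eta_derivative: "\<omega> \<in> S \<Longrightarrow> (rho_eta \<psi> has_derivative d\<eta> \<omega>) (at \<omega>)"
  by (rule Ck_on_has_derivative[OF rho_eta_Ck[OF C2']])

lemma chem_pot_derivative: "\<omega> \<in> S \<Longrightarrow> ((\<lambda>\<omega>. chem_pot \<psi> \<omega> $ i) has_derivative d\<mu> i \<omega>) (at \<omega>)"
  by (rule Ck_on_has_derivative[OF chem_pot_Ck[OF C2']])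

lemmas linear_d\<eta> = has_derivative_linear[OF rho_eta_derivative]
  and linear_d\<mu> = has_derivative_linear[OF chem_pot_derivative]

text \<open>The Gibbs relation \<open>d(\<rho>e) = \<Sum> \<mu>\<^sub>i d\<rho>\<^sub>i + \<theta> d(\<rho>\<eta>)\<close>: the entropy terms of \<open>dF\<close> and of \<open>d(\<theta>\<rho>\<eta>)\<close> cancel.\<close>

lemma rho_e_derivative:
  assumes "\<omega> \<in> S"
  shows "(rho_e \<psi> has_derivative
    (\<lambda>h. (\<Sum>i\<in>UNIV. chem_pot \<psi> \<omega> $ i * fst h $ i) + snd \<omega> * d\<eta> \<omega> h)) (at \<omega>)"
  unfolding rho_e_def[abs_def]
  by (rule derivative_eq_intros rho_psi_derivative rho_eta_derivative assms refl)+
    (auto simp: algebra_simps)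

text \<open>The Gibbs-Duhem relation \<open>dp = \<Sum> \<rho>\<^sub>i d\<mu>\<^sub>i + \<rho>\<eta> d\<theta>\<close>.\<close>

lemma pressure_derivative:
  assumes "\<omega> \<in> S"
  shows "(pressure \<psi> has_derivative
    (\<lambda>h. (\<Sum>i\<in>UNIV. fst \<omega> $ i * d\<mu> i \<omega> h) + rho_eta \<psi> \<omega> * snd h)) (at \<omega>)"
  unfolding pressure_def[abs_def]
  by (rule derivative_eq_intros rho_psi_derivative chem_pot_derivative assms refl
      bounded_linear.has_derivative[OF bounded_linear_vec_nth])+
    (auto simp: algebra_simps sum.distrib)

text \<open>Both sides are the second derivative of the free energy, whose gradient is \<open>(\<mu>, - \<rho>\<eta>)\<close>, in the
directions \<open>h\<close> and \<open>k\<close>.\<close>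

lemma maxwell_relation:
  assumes "\<omega> \<in> S"
  shows "(\<Sum>i\<in>UNIV. fst h $ i * d\<mu> i \<omega> k) - snd h * d\<eta> \<omega> k
       = (\<Sum>i\<in>UNIV. fst k $ i * d\<mu> i \<omega> h) - snd k * d\<eta> \<omega> h"
proof -
  have "der (\<lambda>y. der (rho_psi \<psi>) y h) \<omega> k
      = (\<Sum>i\<in>UNIV. fst h $ i * d\<mu> i \<omega> k) - snd h * d\<eta> \<omega> k" for h k
  proof -
    have "((\<lambda>y. (\<Sum>i\<in>UNIV. chem_pot \<psi> y $ i * fst h $ i) - rho_eta \<psi> y * snd h) has_derivative
        (\<lambda>k. (\<Sum>i\<in>UNIV. fst h $ i * d\<mu> i \<omega> k) - snd h * d\<eta> \<omega> k)) (at \<omega>)"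
      by (rule derivative_eq_intros rho_eta_derivative chem_pot_derivative assms refl)+
        (simp add: mult.commute)
    then have "((\<lambda>y. der (rho_psi \<psi>) y h) has_derivative
        (\<lambda>k. (\<Sum>i\<in>UNIV. fst h $ i * d\<mu> i \<omega> k) - snd h * d\<eta> \<omega> k)) (at \<omega>)"
      by (rule has_derivative_transform_within_open[OF _ open_S assms])
        (simp only: frechet_derivative_at[OF rho_psi_derivative, symmetric])
    then show ?thesis by (simp only: frechet_derivative_at[symmetric])
  qed
  then show ?thesis
    using symmetric_second_derivative[OF open_S assms rho_psi_C2, of h k] by simp
qed

end

section \<open>Coercivity of the relative quantity\<close>

locale stable_thermodynamics = thermodynamics \<psi> phase_space for \<psi> :: "'n::finite state \<Rightarrow> real" +
  assumes convex_energy: "convex_internal_energy \<psi>"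
begin

lemma entropy_coords_derivative:
  assumes "\<omega> \<in> phase_space"
  shows "(entropy_coords \<psi> has_derivative (\<lambda>h. (fst h, d\<eta> \<omega> h))) (at \<omega>)"
  unfolding entropy_coords_def[abs_def]
  by (intro derivative_intros rho_eta_derivative assms)

text \<open>The gradient of the internal energy in the variables \<open>(\<rho>, \<rho>\<eta>)\<close> is \<open>(\<mu>, \<theta>)\<close>.  Differentiating this along the
change of variables expresses the second derivatives of the free energy through the Hessian: the
\<open>\<theta>\<close>-derivative of \<open>\<rho>\<eta>\<close> is the inverse of a positive entry of the Hessian, and in a direction \<open>(r, 0)\<close>, in which \<open>\<theta>\<close> is
constant, the quadratic form of the Hessian becomes the one in the second statement.\<close>

lemma stability:
  assumes "\<omega> \<in> phase_space"
  shows "0 < d\<eta> \<omega> (0, 1)"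
    and "r \<noteq> 0 \<Longrightarrow> 0 < (\<Sum>i\<in>UNIV. r $ i * d\<mu> i \<omega> (r, 0))"
proof -
  define Z where "Z = entropy_coords \<psi>"
  have inj: "inj_on Z phase_space" using convex_energy by (simp add: convex_internal_energy_def Z_def)
  obtain G H where GH: "\<And>z. z \<in> Z ` phase_space \<Longrightarrow>
      (GDERIV (rho_e_tilde \<psi>) z :> G z) \<and> (G has_derivative H z) (at z) \<and>
        0 < snd (G z) \<and> 0 < snd (H z (0, 1)) \<and> (\<forall>h. h \<noteq> 0 \<longrightarrow> 0 < h \<bullet> H z h)"
    using convex_energy unfolding convex_internal_energy_def Z_def by blast
  have Zd: "(Z has_derivative (\<lambda>h. (fst h, d\<eta> y h))) (at y)" if "y \<in> phase_space" for y
    unfolding Z_def by (rule entropy_coords_derivative[OF that])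
  have Gd: "(G has_derivative H (Z y)) (at (Z y))" if "y \<in> phase_space" for y
    using GH that by blast
  have chain: "(\<Sum>i\<in>UNIV. chem_pot \<psi> y $ i * fst h $ i) + snd y * d\<eta> y h
      = fst h \<bullet> fst (G (Z y)) + d\<eta> y h * snd (G (Z y))" if y: "y \<in> phase_space" for y h
  proof -
    have "(rho_e_tilde \<psi> has_derivative (\<lambda>k. k \<bullet> G (Z y))) (at (Z y))"
      using GH[of "Z y"] y by (simp add: gderiv_def)
    from has_derivative_compose[OF Zd[OF y] this]
    have "((\<lambda>x. rho_e_tilde \<psi> (Z x)) has_derivative (\<lambda>h. (fst h, d\<eta> y h) \<bullet> G (Z y))) (at y)" .
    then have "(rho_e \<psi> has_derivative (\<lambda>h. (fst h, d\<eta> y h) \<bullet> G (Z y))) (at y)"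
    proof (rule has_derivative_transform_within_open[OF _ open_phase_space y])
      show "rho_e_tilde \<psi> (Z x) = rho_e \<psi> x" if "x \<in> phase_space" for x
        using inj that by (simp add: rho_e_tilde_def Z_def)
    qed
    from has_derivative_unique[OF rho_e_derivative[OF y] this] show ?thesis
      by (auto simp: inner_prod_def dest!: fun_cong[where x=h])
  qed
  \<comment> \<open>The chain rule gives this only where the \<open>\<theta>\<close>-derivative of \<open>\<rho>\<eta>\<close> does not vanish.  If it failed at a point,
    by continuity it would fail for all slightly larger temperatures; there \<open>\<rho>\<eta>\<close> would be constant, against the
    injectivity of the change of variables.\<close>
  have temperature: "snd (G (Z y)) = snd y" if y: "y \<in> phase_space" for y
  proof (rule ccontr)
    assume ne: "snd (G (Z y)) \<noteq> snd y"
    define g where "g t = snd (G (Z (fst y, t))) - t" for t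
    have P: "(fst y, t) \<in> phase_space" if "t > 0" for t using y that by (simp add: mem_phase_space)
    have "isCont (\<lambda>x. G (Z x)) (fst y, t)" if "t > 0" for t
      by (rule has_derivative_continuous[OF has_derivative_compose[OF Zd[OF P[OF that]] Gd[OF P[OF that]]]])
    then have "isCont (\<lambda>t. G (Z (fst y, t))) t" if "t > 0" for t
      by (rule isCont_o2[where f="\<lambda>t. (fst y, t)" and g="\<lambda>x. G (Z x)", rotated])
        (use that in auto)
    then have "continuous_on {0<..} g"
      unfolding g_def by (intro continuous_intros continuous_at_imp_continuous_on ballI) auto
    then have "isCont g (snd y)" using y
      by (simp add: continuous_on_eq_continuous_at mem_phase_space)
    moreover have "g (snd y) \<noteq> 0" using ne by (simp add: g_def)
    ultimately obtain e where e: "e > 0" "\<And>t. \<bar>snd y - t\<bar> < e \<Longrightarrow> g t \<noteq> 0"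
      using continuous_at_avoid[of "snd y" g 0] by (auto simp: dist_real_def)
    define d where "d = e / 2"
    have "((\<lambda>t. rho_eta \<psi> (fst y, t)) has_real_derivative 0) (at t within {snd y..snd y + d})"
      if t: "t \<in> {snd y..snd y + d}" for t
    proof -
      have tp: "t > 0" using t y by (auto simp: mem_phase_space)
      have "(snd (G (Z (fst y, t))) - t) * d\<eta> (fst y, t) (0, 1) = 0"
        using chain[OF P[OF tp], of "(0, 1)"] by (auto simp: algebra_simps)
      moreover have "\<bar>snd y - t\<bar> < e" using t e(1) by (auto simp: d_def)
      ultimately have z: "d\<eta> (fst y, t) (0, 1) = 0" using e(2)[of t] by (auto simp: g_def)
      have "((\<lambda>t. rho_eta \<psi> (fst y, t)) has_derivative (\<lambda>s. d\<eta> (fst y, t) (0, s))) (at t)"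
        by (rule has_derivative_compose[where f="\<lambda>t. (fst y, t)", OF _ rho_eta_derivative[OF P[OF tp]]])
          (auto intro!: derivative_eq_intros)
      moreover have "d\<eta> (fst y, t) (0, s) = 0" for s
        using linear_scale[OF linear_d\<eta>[OF P[OF tp]], of s "(0, 1)"] z by simp
      ultimately show ?thesis
        by (simp add: has_field_derivative_def has_derivative_at_withinI lambda_zero)
    qed
    then obtain c where c: "rho_eta \<psi> (fst y, t) = c" if "t \<in> {snd y..snd y + d}" for t
      using has_field_derivative_zero_constant[of "{snd y..snd y + d}" "\<lambda>t. rho_eta \<psi> (fst y, t)"] by auto
    have "Z (fst y, snd y) = Z (fst y, snd y + d)"
      using c[of "snd y"] c[of "snd y + d"] e(1) by (simp add: Z_def entropy_coords_def d_def)
    then have "snd y = snd y + d"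
      using inj_onD[OF inj] P[of "snd y"] P[of "snd y + d"] y e(1)
      by (fastforce simp: mem_phase_space d_def)
    then show False using e(1) by (simp add: d_def)
  qed
  have potential: "fst (G (Z y)) = chem_pot \<psi> y" if y: "y \<in> phase_space" for y
  proof -
    have "r \<bullet> fst (G (Z y)) = r \<bullet> chem_pot \<psi> y" for r
      using chain[OF y, of "(r, 0)"] temperature[OF y] by (simp add: inner_vec_def mult.commute)
    then show ?thesis by (metis vector_eq_ldot)
  qed
  have "((\<lambda>y. G (Z y)) has_derivative (\<lambda>h. H (Z \<omega>) (fst h, d\<eta> \<omega> h))) (at \<omega>)"
    by (rule has_derivative_compose[OF Zd[OF assms] Gd[OF assms]])
  then have GZ: "((\<lambda>y. (chem_pot \<psi> y, snd y)) has_derivative (\<lambda>h. H (Z \<omega>) (fst h, d\<eta> \<omega> h))) (at \<omega>)"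
    by (rule has_derivative_transform_within_open[OF _ open_phase_space assms])
      (simp add: prod_eq_iff temperature potential)
  \<comment> \<open>The derivative of \<open>G \<circ> Z = (\<mu>, \<theta>)\<close>, by components.\<close>
  have H2: "snd (H (Z \<omega>) (fst h, d\<eta> \<omega> h)) = snd h" for h
    using has_derivative_unique[OF has_derivative_snd[OF GZ] ] has_derivative_snd[OF has_derivative_ident]
    by (auto dest!: fun_cong[where x=h])
  have H1: "fst (H (Z \<omega>) (fst h, d\<eta> \<omega> h)) $ i = d\<mu> i \<omega> h" for h i
  proof -
    have "((\<lambda>y. fst (chem_pot \<psi> y, snd y) $ i) has_derivative (\<lambda>h. fst (H (Z \<omega>) (fst h, d\<eta> \<omega> h)) $ i)) (at \<omega>)"
      by (intro bounded_linear.has_derivative[OF bounded_linear_vec_nth] has_derivative_fst GZ)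
    then show ?thesis
      using has_derivative_unique[OF _ chem_pot_derivative[OF assms, of i]]
      by (auto dest!: fun_cong[where x=h])
  qed
  note H = GH[of "Z \<omega>"]
  have HL: "linear (H (Z \<omega>))" using has_derivative_linear[OF Gd[OF assms]] .
  have "d\<eta> \<omega> (0, 1) * snd (H (Z \<omega>) (0, 1)) = 1"
    using H2[of "(0, 1)"] linear_scale[OF HL, of "d\<eta> \<omega> (0, 1)" "(0, 1)"] by simp
  moreover have "snd (H (Z \<omega>) (0, 1)) > 0" using H assms by blast
  ultimately show "0 < d\<eta> \<omega> (0, 1)"
    by (metis zero_less_mult_pos2 zero_less_one)
  assume r: "r \<noteq> 0"
  then have "(r, d\<eta> \<omega> (r, 0)) \<noteq> 0" by (simp add: prod_eq_iff)
  then have "0 < (r, d\<eta> \<omega> (r, 0)) \<bullet> H (Z \<omega>) (r, d\<eta> \<omega> (r, 0))" using H assms by blast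
  also have "\<dots> = (\<Sum>i\<in>UNIV. r $ i * d\<mu> i \<omega> (r, 0))"
    using H1[of "(r, 0)"] H2[of "(r, 0)"] by (simp add: inner_prod_def inner_vec_def)
  finally show "0 < (\<Sum>i\<in>UNIV. r $ i * d\<mu> i \<omega> (r, 0))" .
qed

text \<open>Changing first the densities at the temperature \<open>\<theta>'\<close> and then the temperature separates the two kinds of
convexity; both differences run along segments inside the phase space, whereas a segment in the variables \<open>(\<rho>, \<rho>\<eta>)\<close>
may leave its domain.\<close>

lemma rel_J_split:
  "rel_J \<psi> (r, \<theta>) (r', \<theta>') =
     (rho_psi \<psi> (r, \<theta>') - rho_psi \<psi> (r', \<theta>') - (\<Sum>i\<in>UNIV. chem_pot \<psi> (r', \<theta>') $ i * (r $ i - r' $ i)))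
   + (- rho_psi \<psi> (r, \<theta>') - - rho_psi \<psi> (r, \<theta>) - rho_eta \<psi> (r, \<theta>) * (\<theta>' - \<theta>))"
  by (simp add: rel_J_def rho_e_def algebra_simps)

text \<open>Uniform convexity is needed only on the half of the segment next to its initial point: there the
  derivative gains the amount \<open>c / 2\<close>, and it does not lose it afterwards.\<close>

lemma half_convex_gap:
  fixes f :: "real \<Rightarrow> real"
  assumes f: "\<And>s. 0 \<le> s \<Longrightarrow> s \<le> 1 \<Longrightarrow> (f has_real_derivative f' s) (at s)"
    and f': "\<And>s. 0 \<le> s \<Longrightarrow> s \<le> 1 \<Longrightarrow> (f' has_real_derivative f'' s) (at s)"
    and nonneg: "\<And>s. 0 \<le> s \<Longrightarrow> s \<le> 1 \<Longrightarrow> 0 \<le> f'' s"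
    and c: "\<And>s. 0 \<le> s \<Longrightarrow> s \<le> 1/2 \<Longrightarrow> c \<le> f'' s"
  shows "c / 4 \<le> f 1 - f 0 - f' 0"
proof -
  have mono: "f' a \<le> f' d" if "0 \<le> a" "a \<le> d" "d \<le> 1" for a d
  proof (rule DERIV_nonneg_imp_nondecreasing[OF that(2)])
    fix x assume "a \<le> x" "x \<le> d"
    then show "\<exists>y. (f' has_real_derivative y) (at x) \<and> 0 \<le> y"
      using f'[of x] nonneg[of x] that by auto
  qed
  obtain z1 where z1: "0 < z1" "z1 < 1/2" "f (1/2) - f 0 = (1/2) * f' z1"
    using MVT2[of 0 "1/2" f f'] f by auto
  obtain z2 where z2: "1/2 < z2" "z2 < 1" "f 1 - f (1/2) = (1/2) * f' z2"
    using MVT2[of "1/2" 1 f f'] f by auto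
  obtain z3 where z3: "0 < z3" "z3 < 1/2" "f' (1/2) - f' 0 = (1/2) * f'' z3"
    using MVT2[of 0 "1/2" f' f''] f' by auto
  have "f' 0 \<le> f' z1" "f' (1/2) \<le> f' z2" using mono[of 0 z1] mono[of "1/2" z2] z1 z2 by auto
  moreover have "c \<le> f'' z3" using c z3 by simp
  ultimately show ?thesis using z1(3) z2(3) z3(3) by linarith
qed

lemma density_gap:
  assumes "(r', \<theta>) \<in> phase_space" "(r, \<theta>) \<in> phase_space"
    and "\<And>s. 0 \<le> s \<Longrightarrow> s \<le> 1/2 \<Longrightarrow>
      c \<le> (\<Sum>i\<in>UNIV. (r - r') $ i * d\<mu> i (r' + s *\<^sub>R (r - r'), \<theta>) (r - r', 0))"
  shows "c / 4 \<le> rho_psi \<psi> (r, \<theta>) - rho_psi \<psi> (r', \<theta>)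
     - (\<Sum>i\<in>UNIV. chem_pot \<psi> (r', \<theta>) $ i * (r $ i - r' $ i))"
proof -
  define h where "h = r - r'"
  define y where "y s = (r' + s *\<^sub>R h, \<theta>)" for s :: real
  have y: "y s \<in> phase_space" if "0 \<le> s" "s \<le> 1" for s
  proof -
    have "0 < (1 - s) * r' $ i + s * r $ i" for i
    proof (cases "s = 0")
      case False
      then show ?thesis using that assms(1,2)
        by (intro add_nonneg_pos) (auto simp: mem_phase_space less_imp_le)
    qed (use assms(1) in \<open>simp add: mem_phase_space\<close>)
    moreover have "(1 - s) * r' $ i + s * r $ i = (r' + s *\<^sub>R h) $ i" for i
      by (simp add: h_def algebra_simps)
    ultimately show ?thesis using assms(1) by (simp add: y_def mem_phase_space)
  qed
  have yd: "(y has_derivative (\<lambda>t. t *\<^sub>R (h, 0))) (at s)" for s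
    unfolding y_def by (auto intro!: derivative_eq_intros)
  have "c / 4 \<le> rho_psi \<psi> (y 1) - rho_psi \<psi> (y 0) - (\<Sum>i\<in>UNIV. chem_pot \<psi> (y 0) $ i * h $ i)"
  proof (rule half_convex_gap[of "\<lambda>s. rho_psi \<psi> (y s)" "\<lambda>s. \<Sum>i\<in>UNIV. chem_pot \<psi> (y s) $ i * h $ i"
        "\<lambda>s. \<Sum>i\<in>UNIV. h $ i * d\<mu> i (y s) (h, 0)"])
    fix s :: real assume s: "0 \<le> s" "s \<le> 1"
    show "((\<lambda>s. rho_psi \<psi> (y s)) has_real_derivative (\<Sum>i\<in>UNIV. chem_pot \<psi> (y s) $ i * h $ i)) (at s)"
      unfolding has_field_derivative_def
      by (rule has_derivative_eq_rhs[OF has_derivative_compose[OF yd rho_psi_derivative[OF y[OF s]]]])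
        (auto simp: fun_eq_iff sum_distrib_left sum_distrib_right algebra_simps)
    show "((\<lambda>s. \<Sum>i\<in>UNIV. chem_pot \<psi> (y s) $ i * h $ i) has_real_derivative
        (\<Sum>i\<in>UNIV. h $ i * d\<mu> i (y s) (h, 0))) (at s)"
      unfolding has_field_derivative_def
    proof (rule has_derivative_eq_rhs)
      show "((\<lambda>s. \<Sum>i\<in>UNIV. chem_pot \<psi> (y s) $ i * h $ i) has_derivative
          (\<lambda>t. \<Sum>i\<in>UNIV. d\<mu> i (y s) (t *\<^sub>R (h, 0)) * h $ i)) (at s)"
        by (intro has_derivative_sum has_derivative_mult_left
            has_derivative_compose[OF yd chem_pot_derivative[OF y[OF s]]])
      show "(\<lambda>t. \<Sum>i\<in>UNIV. d\<mu> i (y s) (t *\<^sub>R (h, 0)) * h $ i) = (*) (\<Sum>i\<in>UNIV. h $ i * d\<mu> i (y s) (h, 0))"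
        using linear_scale[OF linear_d\<mu>[OF y[OF s]], of _ _ "(h, 0)"]
        by (simp add: fun_eq_iff sum_distrib_left algebra_simps)
    qed
    show "0 \<le> (\<Sum>i\<in>UNIV. h $ i * d\<mu> i (y s) (h, 0))"
      using stability(2)[OF y[OF s], of h] by (cases "h = 0") auto
  next
    fix s :: real assume "0 \<le> s" "s \<le> 1/2"
    then show "c \<le> (\<Sum>i\<in>UNIV. h $ i * d\<mu> i (y s) (h, 0))" using assms(3) by (simp add: h_def y_def)
  qed
  then show ?thesis by (simp add: y_def h_def)
qed

lemma temperature_gap:
  assumes "(r, \<theta>) \<in> phase_space" "(r, \<theta>') \<in> phase_space"
    and "\<And>s. 0 \<le> s \<Longrightarrow> s \<le> 1/2 \<Longrightarrow> c \<le> d\<eta> (r, \<theta> + s * (\<theta>' - \<theta>)) (0, 1)"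
  shows "c * (\<theta>' - \<theta>)\<^sup>2 / 4 \<le> - rho_psi \<psi> (r, \<theta>') - - rho_psi \<psi> (r, \<theta>) - rho_eta \<psi> (r, \<theta>) * (\<theta>' - \<theta>)"
proof -
  define h where "h = \<theta>' - \<theta>"
  define y where "y s = (r, \<theta> + s * h)" for s :: real
  have y: "y s \<in> phase_space" if "0 \<le> s" "s \<le> 1" for s
  proof -
    have "0 < (1 - s) * \<theta> + s * \<theta>'"
    proof (cases "s = 0")
      case False
      then show ?thesis using that assms(1,2)
        by (intro add_nonneg_pos) (auto simp: mem_phase_space less_imp_le)
    qed (use assms(1) in \<open>simp add: mem_phase_space\<close>)
    then show ?thesis using assms(1) by (simp add: y_def mem_phase_space h_def algebra_simps)
  qed
  have yd: "(y has_derivative (\<lambda>t. (t * h) *\<^sub>R (0, 1))) (at s)" for s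
    unfolding y_def by (auto intro!: derivative_eq_intros)
  have "c * h\<^sup>2 / 4 \<le> - rho_psi \<psi> (y 1) - - rho_psi \<psi> (y 0) - rho_eta \<psi> (y 0) * h"
  proof (rule half_convex_gap[of "\<lambda>s. - rho_psi \<psi> (y s)" "\<lambda>s. rho_eta \<psi> (y s) * h"
        "\<lambda>s. d\<eta> (y s) (0, 1) * h\<^sup>2"])
    fix s :: real assume s: "0 \<le> s" "s \<le> 1"
    show "((\<lambda>s. - rho_psi \<psi> (y s)) has_real_derivative rho_eta \<psi> (y s) * h) (at s)"
      unfolding has_field_derivative_def
      by (rule has_derivative_eq_rhs[OF has_derivative_minus[OF
              has_derivative_compose[OF yd rho_psi_derivative[OF y[OF s]]]]])
        (auto simp: fun_eq_iff algebra_simps)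
    show "((\<lambda>s. rho_eta \<psi> (y s) * h) has_real_derivative d\<eta> (y s) (0, 1) * h\<^sup>2) (at s)"
      unfolding has_field_derivative_def
    proof (rule has_derivative_eq_rhs)
      show "((\<lambda>s. rho_eta \<psi> (y s) * h) has_derivative (\<lambda>t. d\<eta> (y s) ((t * h) *\<^sub>R (0, 1)) * h)) (at s)"
        by (intro has_derivative_mult_left has_derivative_compose[OF yd rho_eta_derivative[OF y[OF s]]])
      show "(\<lambda>t. d\<eta> (y s) ((t * h) *\<^sub>R (0, 1)) * h) = (*) (d\<eta> (y s) (0, 1) * h\<^sup>2)"
        unfolding linear_scale[OF linear_d\<eta>[OF y[OF s]]]
        by (simp add: fun_eq_iff power2_eq_square)
    qed
    show "0 \<le> d\<eta> (y s) (0, 1) * h\<^sup>2" using stability(1)[OF y[OF s]] by simp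
  next
    fix s :: real assume "0 \<le> s" "s \<le> 1/2"
    then show "c * h\<^sup>2 \<le> d\<eta> (y s) (0, 1) * h\<^sup>2"
      using assms(3) by (intro mult_right_mono) (simp_all add: h_def y_def)
  qed
  then show ?thesis by (simp add: y_def h_def)
qed

text \<open>On the half of the segment from \<open>\<omega>'\<close> to \<open>\<omega>\<close> that is next to \<open>\<omega>'\<close> the densities stay above half of their values at
\<open>\<omega>'\<close>; so the density gap is uniformly quadratic, however small the densities of \<open>\<omega>\<close> are.  The temperature gap is
uniformly quadratic only if the densities of \<open>\<omega>\<close> are not too small.  If they are, then the density difference is
bounded below, and the density gap alone dominates the bounded temperature difference.\<close>

theorem rel_J_coercive:
  fixes K :: "'n state set"
  assumes "compact K" "K \<subseteq> phase_space" "0 < \<delta>"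
  shows "\<exists>c>0. \<forall>\<omega>'\<in>K. \<forall>\<omega>. bounded_state \<delta> M \<omega> \<longrightarrow>
    c * (norm (\<omega> - \<omega>'))\<^sup>2 \<le> rel_J \<psi> \<omega> \<omega>'"
proof (cases "K = {} \<or> (\<forall>\<omega>. \<not> bounded_state \<delta> M (\<omega> :: 'n state))")
  case True
  then show ?thesis by (intro exI[of _ 1]) auto
next
  case False
  then obtain \<omega>0 :: "'n state" where \<omega>0: "bounded_state \<delta> M \<omega>0" and "K \<noteq> {}" by blast
  have min_exists: "\<exists>m>0. \<forall>\<omega>\<in>K. m \<le> f \<omega>" if "continuous_on K f" "\<And>\<omega>. \<omega> \<in> K \<Longrightarrow> 0 < f \<omega>" for f :: "'n state \<Rightarrow> real"
    using continuous_attains_inf[OF assms(1) \<open>K \<noteq> {}\<close> that(1)] that(2) by blast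
  have "\<forall>j. \<exists>m>0. \<forall>\<omega>\<in>K. m \<le> fst \<omega> $ j"
    using assms(2) by (intro allI min_exists continuous_intros) (auto simp: mem_phase_space)
  then obtain mj where mj: "\<And>j. mj j > 0" "\<And>j \<omega>. \<omega> \<in> K \<Longrightarrow> mj j \<le> fst \<omega> $ j" by metis
  have "\<exists>m>0. \<forall>\<omega>\<in>K. m \<le> snd \<omega>"
    using assms(2) by (intro min_exists continuous_intros) (auto simp: mem_phase_space)
  then obtain m0 where m0: "m0 > 0" "\<And>\<omega>. \<omega> \<in> K \<Longrightarrow> m0 \<le> snd \<omega>" by blast
  define m where "m = min (min m0 \<delta>) (Min (range mj))"
  have m: "m > 0" "m \<le> m0" "m \<le> \<delta>" "m \<le> mj j" for j
    using mj(1) m0(1) assms(3) by (auto simp: m_def min_le_iff_disj)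
  obtain R0 where R0: "\<And>\<omega>. \<omega> \<in> K \<Longrightarrow> norm \<omega> \<le> R0"
    using compact_imp_bounded[OF assms(1)] unfolding bounded_iff by blast
  define R where "R = max R0 M"
  \<comment> \<open>A compact box in the phase space that contains \<open>K\<close> and the relevant halves of the segments.\<close>
  define B :: "'n state set" where "B = cbox (\<chi> j. m / 2, m) (\<chi> j. R, R)"
  have memB: "\<omega> \<in> B \<longleftrightarrow> (\<forall>j. m / 2 \<le> fst \<omega> $ j \<and> fst \<omega> $ j \<le> R) \<and> m \<le> snd \<omega> \<and> snd \<omega> \<le> R" for \<omega>
    by (cases \<omega>) (simp add: B_def cbox_Pair_eq mem_box_cart)
  have "compact B" by (simp add: B_def compact_cbox)
  have B: "\<omega> \<in> phase_space" if "\<omega> \<in> B" for \<omega>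
    using that m(1) unfolding memB mem_phase_space by (meson half_gt_zero less_le_trans)
  have K: "m \<le> fst \<omega> $ j" "fst \<omega> $ j \<le> R" "m \<le> snd \<omega>" "snd \<omega> \<le> R" if "\<omega> \<in> K" for \<omega> j
  proof -
    show "m \<le> fst \<omega> $ j" "m \<le> snd \<omega>" using mj(2) m m0(2) that by (meson order_trans)+
    have "norm (fst \<omega>) \<le> R" "norm (snd \<omega>) \<le> R"
      using R0[OF that] norm_fst_le[of "fst \<omega>" "snd \<omega>"] norm_snd_le[of "snd \<omega>" "fst \<omega>"]
      by (auto simp: R_def)
    then show "fst \<omega> $ j \<le> R" "snd \<omega> \<le> R"
      using component_le_norm_cart[of "fst \<omega>" j] by auto
  qed
  have S: "0 < fst \<omega> $ j" "fst \<omega> $ j \<le> R" "m \<le> snd \<omega>" "snd \<omega> \<le> R" if "bounded_state \<delta> M \<omega>" for \<omega> j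
    using that m(3) unfolding bounded_state_def R_def by (auto intro: order_trans simp: le_max_iff_disj)
  have ball_PS: "\<omega> \<in> phase_space" if "bounded_state \<delta> M \<omega>" for \<omega> :: "'n state"
    using that assms(3) unfolding bounded_state_def mem_phase_space by auto
  have "B \<noteq> {}"
  proof -
    obtain \<omega>1 where "\<omega>1 \<in> K" using \<open>K \<noteq> {}\<close> by blast
    have "m / 2 \<le> fst \<omega>1 $ j" for j using K(1)[OF \<open>\<omega>1 \<in> K\<close>, of j] m(1) by linarith
    then have "\<omega>1 \<in> B" using K[OF \<open>\<omega>1 \<in> K\<close>] unfolding memB by auto
    then show ?thesis by blast
  qed
  have "continuous_on B (\<lambda>\<omega>. d\<eta> \<omega> (0, 1))"
    by (rule continuous_on_frechet_derivative_apply[OF rho_eta_C1]) (use B in auto)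
  then obtain l1 where l1: "l1 > 0" "\<And>\<omega>. \<omega> \<in> B \<Longrightarrow> l1 \<le> d\<eta> \<omega> (0, 1)"
    using continuous_attains_inf[OF \<open>compact B\<close> \<open>B \<noteq> {}\<close>] stability(1)[OF B] by metis
  have "\<exists>l2>0. \<forall>\<omega>\<in>B. \<forall>r. l2 * (norm r)\<^sup>2 \<le> (\<Sum>i\<in>UNIV. r $ i * d\<mu> i \<omega> (r, 0))"
  proof -
    let ?X = "B \<times> sphere 0 1 :: ('n state \<times> (real^'n)) set"
    have cont: "continuous_on ?X (\<lambda>z. \<Sum>i\<in>UNIV. snd z $ i * d\<mu> i (fst z) (snd z, 0))"
      by (intro continuous_intros continuous_on_frechet_derivative_apply[OF chem_pot_C1]) (use B in auto)
    have "compact ?X" using \<open>compact B\<close> by (intro compact_Times) auto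
    have "axis undefined 1 \<in> sphere (0::real^'n) 1" by (simp add: norm_axis_1)
    then have "?X \<noteq> {}" using \<open>B \<noteq> {}\<close> by blast
    then obtain z0 where z0: "z0 \<in> ?X" "\<And>z. z \<in> ?X \<Longrightarrow>
        (\<Sum>i\<in>UNIV. snd z0 $ i * d\<mu> i (fst z0) (snd z0, 0)) \<le> (\<Sum>i\<in>UNIV. snd z $ i * d\<mu> i (fst z) (snd z, 0))"
      using continuous_attains_inf[OF \<open>compact ?X\<close> _ cont] by blast
    define l2 where "l2 = (\<Sum>i\<in>UNIV. snd z0 $ i * d\<mu> i (fst z0) (snd z0, 0))"
    have "snd z0 \<noteq> 0" using z0(1) by auto
    then have "l2 > 0" unfolding l2_def using z0(1) by (intro stability(2) B) auto
    moreover have "l2 * (norm r)\<^sup>2 \<le> (\<Sum>i\<in>UNIV. r $ i * d\<mu> i \<omega> (r, 0))" if \<omega>: "\<omega> \<in> B" for \<omega> r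
    proof (cases "r = 0")
      case False
      define u where "u = r /\<^sub>R norm r"
      have r: "r = norm r *\<^sub>R u" using False by (simp add: u_def)
      have "u \<in> sphere 0 1" using False by (simp add: u_def)
      then have "l2 \<le> (\<Sum>i\<in>UNIV. u $ i * d\<mu> i \<omega> (u, 0))" using z0(2)[of "(\<omega>, u)"] \<omega> by (simp add: l2_def)
      then have "l2 * (norm r)\<^sup>2 \<le> (\<Sum>i\<in>UNIV. u $ i * d\<mu> i \<omega> (u, 0)) * (norm r)\<^sup>2"
        by (rule mult_right_mono) simp
      also have "\<dots> = (\<Sum>i\<in>UNIV. (norm r *\<^sub>R u) $ i * d\<mu> i \<omega> (norm r *\<^sub>R (u, 0)))"
        unfolding linear_scale[OF linear_d\<mu>[OF B[OF \<omega>]]]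
        by (simp add: sum_distrib_left power2_eq_square algebra_simps)
      also have "\<dots> = (\<Sum>i\<in>UNIV. r $ i * d\<mu> i \<omega> (r, 0))"
        using r by simp
      finally show ?thesis .
    qed simp
    ultimately show ?thesis by blast
  qed
  then obtain l2 where l2: "l2 > 0"
    "\<And>\<omega> r. \<omega> \<in> B \<Longrightarrow> l2 * (norm r)\<^sup>2 \<le> (\<Sum>i\<in>UNIV. r $ i * d\<mu> i \<omega> (r, 0))" by blast
  have "R > 0" using S(3,4)[OF \<omega>0] m(1) by linarith
  \<comment> \<open>One half of the density gap is kept for the densities; the other half, at least \<open>l2 (m/2)\<^sup>2/8\<close> when a density is
    below \<open>m/2\<close>, has to dominate \<open>c R\<^sup>2\<close>.\<close>
  define c where "c = min (l2 / 8) (min (l2 * m\<^sup>2 / (32 * R\<^sup>2)) (l1 / 4))"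
  have "c > 0" using l1 l2 m(1) \<open>R > 0\<close> by (simp add: c_def)
  moreover have "c * (norm (\<omega> - \<omega>'))\<^sup>2 \<le> rel_J \<psi> \<omega> \<omega>'" if \<omega>': "\<omega>' \<in> K" and \<omega>: "bounded_state \<delta> M \<omega>" for \<omega> \<omega>'
  proof -
    obtain r \<theta> r' \<theta>' where eq: "\<omega> = (r, \<theta>)" "\<omega>' = (r', \<theta>')" by (metis surj_pair)
    note K' = K[OF \<omega>', unfolded eq fst_conv snd_conv] and S' = S[OF \<omega>, unfolded eq fst_conv snd_conv]
    have P: "(r, \<theta>) \<in> phase_space" "(r', \<theta>') \<in> phase_space" "(r, \<theta>') \<in> phase_space" "(r', \<theta>') \<in> phase_space"
      using ball_PS[OF \<omega>] \<omega>' assms(2) eq by (auto simp: mem_phase_space)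
    have part1: "l2 * (norm (r - r'))\<^sup>2 / 4 \<le> rho_psi \<psi> (r, \<theta>') - rho_psi \<psi> (r', \<theta>')
        - (\<Sum>i\<in>UNIV. chem_pot \<psi> (r', \<theta>') $ i * (r $ i - r' $ i))"
    proof (rule density_gap[OF P(2,3)])
      fix s :: real assume s: "0 \<le> s" "s \<le> 1/2"
      have "(r' + s *\<^sub>R (r - r'), \<theta>') \<in> B"
        unfolding memB fst_conv snd_conv
      proof (intro conjI allI)
        fix j
        have eq: "(r' + s *\<^sub>R (r - r')) $ j = (1 - s) * r' $ j + s * r $ j" by (simp add: algebra_simps)
        have "(1/2) * m \<le> (1 - s) * r' $ j" using s m(1) K'(1)[of j] by (intro mult_mono) auto
        moreover have "0 \<le> s * r $ j" using s S'(1)[of j] by simp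
        ultimately show "m / 2 \<le> (r' + s *\<^sub>R (r - r')) $ j" unfolding eq by simp
        have "(1 - s) * r' $ j + s * r $ j \<le> (1 - s) * R + s * R"
          using s K'(2)[of j] S'(2)[of j] by (intro add_mono mult_left_mono) auto
        then show "(r' + s *\<^sub>R (r - r')) $ j \<le> R" unfolding eq by (simp add: algebra_simps)
      qed (use K' in auto)
      then show "l2 * (norm (r - r'))\<^sup>2 \<le> (\<Sum>i\<in>UNIV. (r - r') $ i * d\<mu> i (r' + s *\<^sub>R (r - r'), \<theta>') (r - r', 0))"
        by (rule l2(2))
    qed
    have segment: "m \<le> \<theta> + s * (\<theta>' - \<theta>)" "\<theta> + s * (\<theta>' - \<theta>) \<le> R" if "0 \<le> s" "s \<le> 1/2" for s
    proof -
      have "(1 - s) * m + s * m \<le> (1 - s) * \<theta> + s * \<theta>'" "(1 - s) * \<theta> + s * \<theta>' \<le> (1 - s) * R + s * R"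
        using that K'(3,4) S'(3,4) by (auto intro!: add_mono mult_left_mono)
      then show "m \<le> \<theta> + s * (\<theta>' - \<theta>)" "\<theta> + s * (\<theta>' - \<theta>) \<le> R" by (auto simp: algebra_simps)
    qed
    have norm_eq: "(norm (\<omega> - \<omega>'))\<^sup>2 = (norm (r - r'))\<^sup>2 + (\<theta>' - \<theta>)\<^sup>2"
      by (simp add: eq norm_Pair power2_commute)
    have split: "l2 * (norm (r - r'))\<^sup>2 / 4 + d * (\<theta>' - \<theta>)\<^sup>2 / 4 \<le> rel_J \<psi> \<omega> \<omega>'"
      if "\<And>s. 0 \<le> s \<Longrightarrow> s \<le> 1/2 \<Longrightarrow> d \<le> d\<eta> (r, \<theta> + s * (\<theta>' - \<theta>)) (0, 1)" for d
      unfolding eq rel_J_split by (intro add_mono part1 temperature_gap P that)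
    show ?thesis
    proof (cases "\<forall>j. m / 2 \<le> r $ j")
      case True
      have "l2 * (norm (r - r'))\<^sup>2 / 4 + l1 * (\<theta>' - \<theta>)\<^sup>2 / 4 \<le> rel_J \<psi> \<omega> \<omega>'"
      proof (rule split)
        fix s :: real assume "0 \<le> s" "s \<le> 1/2"
        then have "(r, \<theta> + s * (\<theta>' - \<theta>)) \<in> B" using True S'(2) segment[of s] by (simp add: memB)
        then show "l1 \<le> d\<eta> (r, \<theta> + s * (\<theta>' - \<theta>)) (0, 1)" by (rule l1(2))
      qed
      moreover have "c * (norm (r - r'))\<^sup>2 \<le> l2 / 4 * (norm (r - r'))\<^sup>2"
        using l2(1) by (intro mult_right_mono) (auto simp: c_def)
      moreover have "c * (\<theta>' - \<theta>)\<^sup>2 \<le> l1 / 4 * (\<theta>' - \<theta>)\<^sup>2"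
        by (intro mult_right_mono) (auto simp: c_def)
      ultimately show ?thesis unfolding norm_eq by (simp add: algebra_simps)
    next
      case False
      then obtain j where j: "r $ j < m / 2" by (meson not_less)
      have "m / 2 \<le> \<bar>(r - r') $ j\<bar>" using j K'(1)[of j] unfolding vector_minus_component by linarith
      also have "\<dots> \<le> norm (r - r')" by (rule component_le_norm_cart)
      finally have far: "(m / 2)\<^sup>2 \<le> (norm (r - r'))\<^sup>2" using m(1) by (intro power_mono) auto
      have "\<bar>\<theta>' - \<theta>\<bar> \<le> R" using K'(3,4) S'(3,4) m(1) by linarith
      then have near: "(\<theta>' - \<theta>)\<^sup>2 \<le> R\<^sup>2" by (simp add: abs_le_square_iff[symmetric])
      have "l2 * (norm (r - r'))\<^sup>2 / 4 + 0 * (\<theta>' - \<theta>)\<^sup>2 / 4 \<le> rel_J \<psi> \<omega> \<omega>'"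
      proof (rule split)
        fix s :: real assume "0 \<le> s" "s \<le> 1/2"
        then have "(r, \<theta> + s * (\<theta>' - \<theta>)) \<in> phase_space"
          using S'(1) m(1) segment[of s] by (simp add: mem_phase_space)
        then show "0 \<le> d\<eta> (r, \<theta> + s * (\<theta>' - \<theta>)) (0, 1)" using stability(1) by (simp add: less_imp_le)
      qed
      moreover have "c * (norm (r - r'))\<^sup>2 \<le> l2 / 8 * (norm (r - r'))\<^sup>2"
        by (intro mult_right_mono) (auto simp: c_def)
      moreover have "c * (\<theta>' - \<theta>)\<^sup>2 \<le> l2 / 8 * (norm (r - r'))\<^sup>2"
      proof -
        have "c * (\<theta>' - \<theta>)\<^sup>2 \<le> (l2 * m\<^sup>2 / (32 * R\<^sup>2)) * R\<^sup>2"
          using near l2(1) by (intro mult_mono) (auto simp: c_def)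
        also have "\<dots> = l2 / 8 * (m / 2)\<^sup>2" using \<open>R > 0\<close> by (simp add: power2_eq_square)
        also have "\<dots> \<le> l2 / 8 * (norm (r - r'))\<^sup>2" using far l2(1) by (intro mult_left_mono) auto
        finally show ?thesis .
      qed
      ultimately show ?thesis unfolding norm_eq by (simp add: algebra_simps)
    qed
  qed
  ultimately show ?thesis by blast
qed

end

section \<open>Integration over the torus\<close>

abbreviation cell :: "(real^3) set" where "cell \<equiv> cbox 0 (\<chi> i. 2 * pi)"

text \<open>Translation in one coordinate direction cuts a slab off one side of the cell and adds its translate by a full
period on the opposite side.\<close>

lemma cell_shift_integral:
  fixes f :: "real^3 \<Rightarrow> real"
  assumes "continuous_on UNIV f" "torus_periodic f" "0 \<le> s" "s \<le> 2 * pi"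
  shows "integral cell (\<lambda>x. f (x + s *\<^sub>R axis j 1)) = integral cell f"
proof -
  let ?e = "axis j 1 :: real^3"
  define b where "b t = (\<chi> i. if i = j then t else 2 * pi)" for t :: real
  define a where "a t = (\<chi> i. if i = j then t else 0)" for t :: real
  have int: "f integrable_on cbox u v" for u v :: "real^3"
    by (rule integrable_continuous) (rule continuous_on_subset[OF assms(1)], simp)
  have e: "?e \<in> Basis" by simp
  have split: "integral (cbox (a u) (b w)) f = integral (cbox (a u) (b t)) f + integral (cbox (a t) (b w)) f"
    if "u \<le> t" "t \<le> w" for u t w
  proof -
    have 1: "cbox (a u) (b w) \<inter> {x. x \<bullet> ?e \<le> t} = cbox (a u) (b t)"
      "cbox (a u) (b w) \<inter> {x. t \<le> x \<bullet> ?e} = cbox (a t) (b w)"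
      using that by (auto simp: mem_box_cart a_def b_def inner_axis split: if_splits) (force+)
    have "(f has_integral integral (cbox (a u) (b t)) f + integral (cbox (a t) (b w)) f) (cbox (a u) (b w))"
      by (rule has_integral_split[OF _ _ e, of f _ _ _ t]) (simp_all add: 1 int integrable_integral)
    then show ?thesis by (rule integral_unique)
  qed
  have shift: "integral (cbox (a u) (b w)) (\<lambda>x. f (x + t *\<^sub>R ?e)) = integral (cbox (a (u + t)) (b (w + t))) f" for u w t
  proof -
    have "a u + t *\<^sub>R ?e = a (u + t)" "b w + t *\<^sub>R ?e = b (w + t)"
      by (auto simp: vec_eq_iff a_def b_def axis_def)
    then show ?thesis
      using integral_shift_cbox_plus[of "a u" "b w" f "t *\<^sub>R ?e"] by (simp add: o_def add.commute)
  qed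
  have per: "f (x + (2 * pi) *\<^sub>R ?e) = f x" for x
  proof -
    have "(2 * pi) *\<^sub>R ?e = axis j (2 * pi)" by (simp add: vec_eq_iff axis_def)
    then show ?thesis using assms(2) by (simp add: torus_periodic_def)
  qed
  have cell: "a 0 = 0" "b (2 * pi) = (\<chi> i. 2 * pi)" by (auto simp: vec_eq_iff a_def b_def)
  have "integral cell (\<lambda>x. f (x + s *\<^sub>R ?e)) = integral (cbox (a s) (b (2 * pi + s))) f"
    using shift[of 0 "2 * pi" s] by (simp add: cell)
  also have "\<dots> = integral (cbox (a s) (b (2 * pi))) f + integral (cbox (a (2 * pi)) (b (2 * pi + s))) f"
    using assms(3,4) by (intro split) auto
  also have "integral (cbox (a (2 * pi)) (b (2 * pi + s))) f = integral (cbox (a 0) (b s)) f"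
    using shift[of 0 s "2 * pi"] by (simp add: per add.commute)
  also have "integral (cbox (a s) (b (2 * pi))) f + integral (cbox (a 0) (b s)) f = integral (cbox (a 0) (b (2 * pi))) f"
    using split[of 0 s "2 * pi"] assms(3,4) by simp
  finally show ?thesis by (simp add: cell)
qed

text \<open>The integral of a periodic function over the cell does not change when the function is translated;
  the translation derivative is the integral of the partial derivative.\<close>

lemma integral_partial_derivative_zero:
  fixes f :: "real^3 \<Rightarrow> real"
  assumes "Ck_on 1 UNIV f" "torus_periodic f"
  shows "integral cell (\<lambda>x. der f x (axis j 1)) = 0"
proof -
  let ?e = "axis j 1 :: real^3"
  have d: "(f has_derivative der f x) (at x)" for x
    using assms(1) by (intro Ck_on_has_derivative[of 0 UNIV]) simp_all
  have cf: "continuous_on UNIV f" by (rule Ck_on_continuous[OF assms(1)])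
  have "((\<lambda>s. integral cell (\<lambda>x. f (x + s *\<^sub>R ?e))) has_vector_derivative
      integral cell (\<lambda>x. der f (x + 0 *\<^sub>R ?e) ?e)) (at 0 within {0..1})"
  proof (rule leibniz_rule_vector_derivative)
    fix s :: real and x :: "real^3"
    have "((\<lambda>s. f (x + s *\<^sub>R ?e)) has_derivative (\<lambda>t. der f (x + s *\<^sub>R ?e) (t *\<^sub>R ?e))) (at s)"
      by (rule has_derivative_compose[of "\<lambda>s. x + s *\<^sub>R ?e", OF _ d]) (auto intro!: derivative_eq_intros)
    then have "((\<lambda>s. f (x + s *\<^sub>R ?e)) has_vector_derivative der f (x + s *\<^sub>R ?e) ?e) (at s)"
      using linear_scale[OF has_derivative_linear[OF d]] by (simp add: has_vector_derivative_def)
    then show "((\<lambda>s. f (x + s *\<^sub>R ?e)) has_vector_derivative der f (x + s *\<^sub>R ?e) ?e) (at s within {0..1})"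
      by (rule has_vector_derivative_at_within)
  next
    show "(\<lambda>x. f (x + s *\<^sub>R ?e)) integrable_on cell" for s
      by (intro integrable_continuous continuous_on_compose2[OF cf] continuous_intros) auto
    show "continuous_on ({0..1} \<times> cell) (\<lambda>(s, x). der f (x + s *\<^sub>R ?e) ?e)"
      unfolding case_prod_beta'
      by (intro continuous_on_frechet_derivative_apply[OF assms(1)] continuous_intros) auto
  qed auto
  moreover have "((\<lambda>s. integral cell (\<lambda>x. f (x + s *\<^sub>R ?e))) has_vector_derivative 0) (at 0 within {0..1})"
  proof (rule has_vector_derivative_transform[of 0 "{0..1}" _ "\<lambda>s. integral cell f"])
    fix s :: real assume "s \<in> {0..1}"
    then show "integral cell (\<lambda>x. f (x + s *\<^sub>R ?e)) = integral cell f"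
      using pi_ge_two by (intro cell_shift_integral cf assms) auto
  qed auto
  ultimately show ?thesis
    using vector_derivative_unique_within[of 0 "{0..1::real}"] at_within_Icc_at_right[of 0 "1::real"]
    by (simp add: trivial_limit_at_right_real)
qed

lemma diver_components:
  assumes "F differentiable (at x)"
  shows "diver F x = (\<Sum>j\<in>UNIV. der (\<lambda>x. F x $ j) x (axis j 1))"
proof -
  have "((\<lambda>x. F x $ j) has_derivative (\<lambda>h. der F x h $ j)) (at x)" for j
    using assms by (intro bounded_linear.has_derivative[OF bounded_linear_vec_nth])
      (simp add: frechet_derivative_works)
  then have "der (\<lambda>x. F x $ j) x = (\<lambda>h. der F x h $ j)" for j
    by (rule frechet_derivative_at[symmetric])
  then show ?thesis by (simp add: diver_def)
qed

theorem torus_integral_diver: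
  assumes "Ck_on 1 UNIV F" "torus_periodic F"
  shows "torus_integral (diver F) = 0"
proof -
  have C: "Ck_on 1 UNIV (\<lambda>x. F x $ j)" for j
    by (rule Ck_on_linear_image[OF open_UNIV assms(1) bounded_linear_vec_nth])
  have "diver F = (\<lambda>x. \<Sum>j\<in>UNIV. der (\<lambda>x. F x $ j) x (axis j 1))"
    using assms(1) by (intro ext diver_components) simp
  moreover have "integral cell (\<lambda>x. \<Sum>j\<in>UNIV. der (\<lambda>x. F x $ j) x (axis j 1))
      = (\<Sum>j\<in>UNIV. integral cell (\<lambda>x. der (\<lambda>x. F x $ j) x (axis j 1)))"
    using C by (intro integral_sum integrable_continuous)
      (auto intro: continuous_on_subset)
  moreover have "integral cell (\<lambda>x. der (\<lambda>x. F x $ j) x (axis j 1)) = 0" for j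
    using assms(2) by (intro integral_partial_derivative_zero C) (simp add: torus_periodic_def)
  ultimately show ?thesis by (simp add: torus_integral_def)
qed

section \<open>Differential operators\<close>

lemma diver_scaleR:
  assumes f: "(f has_derivative f') (at x)" and V: "V differentiable (at x)"
  shows "diver (\<lambda>x. f x *\<^sub>R V x) x = f x * diver V x + f' (V x)"
proof -
  have V': "(V has_derivative der V x) (at x)"
    using V by (simp add: frechet_derivative_works)
  interpret linear f' by (rule has_derivative_linear[OF f])
  have "f' (V x) = f' (\<Sum>j\<in>UNIV. V x $ j *\<^sub>R axis j 1)"
    by (rule arg_cong[where f=f']) (simp add: vec_eq_iff axis_def if_distrib sum.delta cong: if_cong)
  also have "\<dots> = (\<Sum>j\<in>UNIV. V x $ j * f' (axis j 1))" by (simp add: sum scale)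
  finally have *: "f' (V x) = (\<Sum>j\<in>UNIV. V x $ j * f' (axis j 1))" .
  have "((\<lambda>x. f x *\<^sub>R V x) has_derivative
      (\<lambda>h. f x *\<^sub>R der V x h + f' h *\<^sub>R V x)) (at x)"
    by (intro derivative_intros f V')
  then show ?thesis unfolding diver_def
    by (simp add: frechet_derivative_at[symmetric] sum.distrib sum_distrib_left * mult.commute)
qed

lemma diver_add:
  assumes "F differentiable (at x)" "G differentiable (at x)"
  shows "diver (\<lambda>x. F x + G x) x = diver F x + diver G x"
proof -
  have "((\<lambda>x. F x + G x) has_derivative
      (\<lambda>h. der F x h + der G x h)) (at x)"
    using assms by (intro derivative_intros) (simp_all add: frechet_derivative_works)
  then show ?thesis unfolding diver_def by (simp add: frechet_derivative_at[symmetric] sum.distrib)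
qed

lemma diver_diff:
  assumes "F differentiable (at x)" "G differentiable (at x)"
  shows "diver (\<lambda>x. F x - G x) x = diver F x - diver G x"
proof -
  have "((\<lambda>x. F x - G x) has_derivative
      (\<lambda>h. der F x h - der G x h)) (at x)"
    using assms by (intro derivative_intros) (simp_all add: frechet_derivative_works)
  then show ?thesis unfolding diver_def by (simp add: frechet_derivative_at[symmetric] sum_subtractf)
qed

lemma diver_sum:
  assumes "\<And>i. i \<in> A \<Longrightarrow> F i differentiable (at x)"
  shows "diver (\<lambda>x. \<Sum>i\<in>A. F i x) x = (\<Sum>i\<in>A. diver (F i) x)"
proof -
  have "((\<lambda>x. \<Sum>i\<in>A. F i x) has_derivative (\<lambda>h. \<Sum>i\<in>A. der (F i) x h)) (at x)"
    using assms by (intro derivative_intros) (simp_all add: frechet_derivative_works)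
  then show ?thesis unfolding diver_def
    by (simp add: frechet_derivative_at[symmetric] sum.swap[of _ A])
qed

lemma grad_eq:
  assumes "(f has_derivative f') (at x)"
  shows "grad f x \<bullet> h = f' h"
proof -
  interpret linear f' by (rule has_derivative_linear[OF assms])
  have "f' h = f' (\<Sum>j\<in>UNIV. h $ j *\<^sub>R axis j 1)"
    by (rule arg_cong[where f=f']) (simp add: vec_eq_iff axis_def if_distrib sum.delta cong: if_cong)
  also have "\<dots> = (\<Sum>j\<in>UNIV. h $ j * f' (axis j 1))" by (simp add: sum scale)
  finally show ?thesis
    by (simp add: grad_def frechet_derivative_at[OF assms, symmetric] inner_vec_def mult.commute)
qed

lemma bounded_bilinear_tensor_prod: "bounded_bilinear tensor_prod"
  unfolding bilinear_conv_bounded_bilinear[symmetric] bilinear_def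
  by (auto intro!: linearI simp: tensor_prod_def vec_eq_iff algebra_simps)

text \<open>The product rule for the symmetric bilinear flux: the divergence of \<open>r v\<close> falls on one factor \<open>v\<close>, the derivative
along \<open>v\<close> on the other.\<close>

lemma tensor_diver_momentum_flux:
  assumes r: "(r has_derivative r') (at x)" and v: "(v has_derivative v') (at x)"
    and p: "(p has_derivative p') (at x)"
  shows "tensor_diver (\<lambda>x. r x *\<^sub>R tensor_prod (v x) (v x) + p x *\<^sub>R mat 1) x
    = diver (\<lambda>x. r x *\<^sub>R v x) x *\<^sub>R v x + r x *\<^sub>R v' (v x) + grad p x"
proof -
  let ?A' = "\<lambda>h. r x *\<^sub>R (tensor_prod (v x) (v' h) + tensor_prod (v' h) (v x))
      + r' h *\<^sub>R tensor_prod (v x) (v x) + p' h *\<^sub>R (mat 1 :: real^3^3)"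
  have "((\<lambda>x. r x *\<^sub>R tensor_prod (v x) (v x) + p x *\<^sub>R mat 1) has_derivative ?A') (at x)"
    by (intro derivative_intros r p bounded_bilinear.FDERIV[OF bounded_bilinear_tensor_prod] v)
  then have A: "der (\<lambda>x. r x *\<^sub>R tensor_prod (v x) (v x) + p x *\<^sub>R mat 1) x = ?A'"
    by (rule frechet_derivative_at[symmetric])
  have V: "der v x = v'" by (rule frechet_derivative_at[OF v, symmetric])
  have G: "(\<Sum>j\<in>UNIV. p' (axis j 1) * (mat 1 :: real^3^3) $ i $ j) = p' (axis i 1)" for i
    by (simp add: mat_def if_distrib sum.delta cong: if_cong)
  interpret v': linear v' by (rule has_derivative_linear[OF v])
  interpret r': linear r' by (rule has_derivative_linear[OF r])
  have sum_axis: "u = (\<Sum>j\<in>UNIV. u $ j *\<^sub>R axis j 1)" for u :: "real^3"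
    by (simp add: vec_eq_iff axis_def if_distrib sum.delta cong: if_cong)
  have vv: "v' u $ i = (\<Sum>j\<in>UNIV. u $ j * v' (axis j 1) $ i)" for u i
    by (subst sum_axis[of u]) (simp add: v'.sum v'.scale sum_component)
  have rr: "r' u = (\<Sum>j\<in>UNIV. u $ j * r' (axis j 1))" for u
    by (subst sum_axis[of u]) (simp add: r'.sum r'.scale)
  have D: "diver (\<lambda>x. r x *\<^sub>R v x) x = r x * diver v x + r' (v x)"
    using v by (intro diver_scaleR r) (auto simp: differentiable_def)
  have "tensor_diver (\<lambda>x. r x *\<^sub>R tensor_prod (v x) (v x) + p x *\<^sub>R mat 1) x $ i
      = (diver (\<lambda>x. r x *\<^sub>R v x) x *\<^sub>R v x + r x *\<^sub>R v' (v x) + grad p x) $ i" for i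
  proof -
    have "tensor_diver (\<lambda>x. r x *\<^sub>R tensor_prod (v x) (v x) + p x *\<^sub>R mat 1) x $ i
        = (\<Sum>j\<in>UNIV. (r x * v x $ i) * v' (axis j 1) $ j + r x * (v x $ j * v' (axis j 1) $ i)
            + v x $ i * (v x $ j * r' (axis j 1)) + p' (axis j 1) * (mat 1 :: real^3^3) $ i $ j)"
      unfolding tensor_diver_def A vec_lambda_beta
      by (intro sum.cong refl) (simp add: tensor_prod_def algebra_simps)
    also have "\<dots> = (r x * v x $ i) * (\<Sum>j\<in>UNIV. v' (axis j 1) $ j) + r x * v' (v x) $ i
        + v x $ i * r' (v x) + p' (axis i 1)"
      by (simp only: sum.distrib sum_distrib_left[symmetric] vv[symmetric] rr[symmetric] G)
    also have "\<dots> = (diver (\<lambda>x. r x *\<^sub>R v x) x *\<^sub>R v x + r x *\<^sub>R v' (v x) + grad p x) $ i"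
      unfolding D by (simp add: diver_def V grad_def frechet_derivative_at[OF p, symmetric] algebra_simps)
    finally show ?thesis .
  qed
  then show ?thesis by (simp add: vec_eq_iff)
qed

section \<open>Balance laws along particle paths\<close>

lemma unknown_linear [simp]:
  "dens (a + c) = dens a + dens c" "vel (a + c) = vel a + vel c" "temp (a + c) = temp a + temp c"
  "state_of (a + c) = state_of a + state_of c"
  "fst (state_of a) = dens a" "snd (state_of a) = temp a"
  by (simp_all add: dens_def vel_def temp_def state_of_def)

lemma bounded_linear_dens: "bounded_linear dens"
  and bounded_linear_vel: "bounded_linear vel"
  and bounded_linear_temp: "bounded_linear temp"
  unfolding dens_def[abs_def] vel_def[abs_def] temp_def[abs_def]
  by (intro bounded_linear_fst bounded_linear_snd bounded_linear_compose[OF bounded_linear_fst]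
      bounded_linear_compose[OF bounded_linear_snd])+

lemma bounded_linear_state_of: "bounded_linear state_of"
  unfolding state_of_def[abs_def]
  by (intro bounded_linear_Pair bounded_linear_dens bounded_linear_temp)

lemma dt_eq:
  assumes "((\<lambda>s. f s x) has_vector_derivative y) (at t within I)" "at t within I \<noteq> bot"
  shows "dt I f t x = y"
  unfolding dt_def using assms by (simp add: vector_derivative_within)

lemma has_vector_derivative_compose:
  assumes "((\<lambda>s. f s) has_vector_derivative y) (at t within I)" "(g has_derivative g') (at (f t))"
  shows "((\<lambda>s. g (f s)) has_vector_derivative g' y) (at t within I)"
proof -
  have "((\<lambda>s. g (f s)) has_derivative (\<lambda>s. g' (s *\<^sub>R y))) (at t within I)"
    using assms by (intro has_derivative_compose[of f _ t I g]) (auto simp: has_vector_derivative_def)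
  then show ?thesis
    using linear_scale[OF has_derivative_linear[OF assms(2)]] by (simp add: has_vector_derivative_def)
qed

lemma momentum_derivative:
  "(momentum has_derivative (\<lambda>h. total_mass (dens h) *\<^sub>R vel w + total_mass (dens w) *\<^sub>R vel h)) (at w)"
  unfolding momentum_def[abs_def]
  by (rule derivative_eq_intros bounded_linear.has_derivative[OF bounded_linear_total_mass]
      bounded_linear.has_derivative[OF bounded_linear_dens] bounded_linear.has_derivative[OF bounded_linear_vel] refl)+
    (simp add: add.commute)

text \<open>States of a fluid lie in the phase space, so from here on the thermodynamic relations are used there.\<close>

locale fluid_thermodynamics = thermodynamics \<psi> phase_space for \<psi> :: "'n::finite state \<Rightarrow> real"
begin

text \<open>The first two terms are the Gibbs relation, the last two come from the kinetic energy.\<close>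

lemma energy_derivative:
  assumes "state_of w \<in> phase_space"
  shows "(energy \<psi> has_derivative (\<lambda>h. (\<Sum>i\<in>UNIV. chem_pot \<psi> (state_of w) $ i * dens h $ i)
      + temp w * d\<eta> (state_of w) (state_of h)
      + total_mass (dens h) * (norm (vel w))\<^sup>2 / 2 + total_mass (dens w) * (vel w \<bullet> vel h))) (at w)"
  unfolding energy_def[abs_def] dot_square_norm[symmetric]
  by (rule derivative_eq_intros bounded_linear.has_derivative[OF bounded_linear_total_mass]
      bounded_linear.has_derivative[OF bounded_linear_dens] bounded_linear.has_derivative[OF bounded_linear_vel]
      has_derivative_compose[OF bounded_linear.has_derivative[OF bounded_linear_state_of has_derivative_ident]
        rho_e_derivative[OF assms]] refl)+
    (auto simp: algebra_simps inner_commute)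

lemma pressure_state_derivative:
  assumes "state_of w \<in> phase_space"
  shows "((\<lambda>w. pressure \<psi> (state_of w)) has_derivative
    (\<lambda>h. (\<Sum>i\<in>UNIV. dens w $ i * d\<mu> i (state_of w) (state_of h)) + rho_eta \<psi> (state_of w) * temp h)) (at w)"
  using has_derivative_compose[OF bounded_linear.has_derivative[OF bounded_linear_state_of has_derivative_ident]
        pressure_derivative[OF assms]] by simp

text \<open>In terms of the derivative \<open>a + A v\<close> along particle paths the balance laws for momentum and
  energy lose their transport terms, and the Gibbs relation turns the energy balance into an
  entropy balance.\<close>

lemma primitive_form:
  fixes W :: "'n flow" and s :: "'n \<Rightarrow> real"
  assumes P: "state_of (W t x) \<in> phase_space" and nb: "at t within I \<noteq> bot"
    and a: "((\<lambda>s. W s x) has_vector_derivative a) (at t within I)"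
    and A: "(W t has_derivative A) (at x)"
    and mass: "\<And>i. dt I (\<lambda>t x. dens (W t x) $ i) t x
             + diver (\<lambda>x. dens (W t x) $ i *\<^sub>R vel (W t x)) x = s i"
    and s: "(\<Sum>i\<in>UNIV. s i) = 0"
    and mom: "dt I (\<lambda>t x. momentum (W t x)) t x
          + tensor_diver (\<lambda>x. momentum_flux \<psi> (W t x)) x = 0"
    and ener: "dt I (\<lambda>t x. energy \<psi> (W t x)) t x + diver (\<lambda>x. energy_flux \<psi> (W t x)) x = Q"
  defines "w \<equiv> W t x"
  defines "D \<equiv> a + A (vel w)" and "d \<equiv> diver (\<lambda>x. vel (W t x)) x" and "\<omega> \<equiv> state_of w"
  shows "dens D $ i = s i - dens w $ i * d"
    and "total_mass (dens D) = - total_mass (dens w) * d"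
    and "total_mass (dens w) *\<^sub>R vel D = - grad (\<lambda>x. pressure \<psi> (state_of (W t x))) x"
    and "temp w * d\<eta> \<omega> (state_of D)
      = Q - (\<Sum>i\<in>UNIV. chem_pot \<psi> \<omega> $ i * s i) - temp w * rho_eta \<psi> \<omega> * d"
proof -
  note space = has_derivative_compose[OF A]
  have lin: "(dens has_derivative dens) (at w)" "(vel has_derivative vel) (at w)"
    "((\<lambda>w. dens w $ i) has_derivative (\<lambda>h. dens h $ i)) (at w)"
    "((\<lambda>w. total_mass (dens w)) has_derivative (\<lambda>h. total_mass (dens h))) (at w)" for w :: "'n unknown" and i
    by (rule bounded_linear_imp_has_derivative bounded_linear_dens bounded_linear_vel
        bounded_linear_compose[OF bounded_linear_vec_nth] bounded_linear_compose[OF bounded_linear_total_mass])+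
  have V: "(\<lambda>x. vel (W t x)) differentiable (at x)"
    using space[OF lin(2)] by (auto simp: differentiable_def)
  have dmass: "dens D $ i = s i - dens w $ i * d" for i
  proof -
    have "dt I (\<lambda>t x. dens (W t x) $ i) t x = dens a $ i"
      by (rule dt_eq[where f="\<lambda>t x. dens (W t x) $ i", OF has_vector_derivative_compose[OF a lin(3)] nb])
    moreover have "diver (\<lambda>x. dens (W t x) $ i *\<^sub>R vel (W t x)) x = dens w $ i * d + dens (A (vel w)) $ i"
      unfolding w_def d_def by (rule diver_scaleR[OF space[OF lin(3)] V])
    ultimately show ?thesis using mass[of i] by (simp add: D_def)
  qed
  then show "dens D $ i = s i - dens w $ i * d" .
  \<comment> \<open>The sources cancel, so the total mass is conserved.\<close>
  have tmass: "total_mass (dens D) = - total_mass (dens w) * d"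
    unfolding total_mass_def dmass by (simp add: sum_subtractf s sum_distrib_right)
  then show "total_mass (dens D) = - total_mass (dens w) * d" .
  have gradp: "grad (\<lambda>x. pressure \<psi> (state_of (W t x))) x \<bullet> h
      = (\<Sum>i\<in>UNIV. dens w $ i * d\<mu> i \<omega> (state_of (A h))) + rho_eta \<psi> \<omega> * temp (A h)" for h
    unfolding \<omega>_def w_def by (rule grad_eq[OF space[OF pressure_state_derivative[OF P]]])
  have "diver (\<lambda>x. total_mass (dens (W t x)) *\<^sub>R vel (W t x)) x
      = total_mass (dens w) * d + total_mass (dens (A (vel w)))"
    unfolding w_def d_def by (rule diver_scaleR[OF space[OF lin(4)] V])
  moreover have "tensor_diver (\<lambda>x. momentum_flux \<psi> (W t x)) x
      = diver (\<lambda>x. total_mass (dens (W t x)) *\<^sub>R vel (W t x)) x *\<^sub>R vel w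
        + total_mass (dens w) *\<^sub>R vel (A (vel w)) + grad (\<lambda>x. pressure \<psi> (state_of (W t x))) x"
    unfolding momentum_flux_def w_def
    by (rule tensor_diver_momentum_flux[OF space[OF lin(4)] space[OF lin(2)]
          space[OF pressure_state_derivative[OF P]]])
  moreover have "dt I (\<lambda>t x. momentum (W t x)) t x
      = total_mass (dens a) *\<^sub>R vel w + total_mass (dens w) *\<^sub>R vel a"
    unfolding w_def by (rule dt_eq[where f="\<lambda>t x. momentum (W t x)",
          OF has_vector_derivative_compose[OF a momentum_derivative] nb])
  ultimately have "(total_mass (dens a) + total_mass (dens (A (vel w))) + total_mass (dens w) * d) *\<^sub>R vel w
      + total_mass (dens w) *\<^sub>R vel D + grad (\<lambda>x. pressure \<psi> (state_of (W t x))) x = 0"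
    using mom by (simp add: D_def algebra_simps)
  moreover have "total_mass (dens a) + total_mass (dens (A (vel w))) + total_mass (dens w) * d = 0"
    using tmass by (simp add: D_def linear_add[OF total_mass_linear])
  ultimately have vD: "total_mass (dens w) *\<^sub>R vel D = - grad (\<lambda>x. pressure \<psi> (state_of (W t x))) x"
    by (simp add: eq_neg_iff_add_eq_0)
  then show "total_mass (dens w) *\<^sub>R vel D = - grad (\<lambda>x. pressure \<psi> (state_of (W t x))) x" .
  define E' where "E' h = (\<Sum>i\<in>UNIV. chem_pot \<psi> \<omega> $ i * dens h $ i)
      + temp w * d\<eta> \<omega> (state_of h)
      + total_mass (dens h) * (norm (vel w))\<^sup>2 / 2 + total_mass (dens w) * (vel w \<bullet> vel h)" for h
  have Ed: "(energy \<psi> has_derivative E') (at (W t x))"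
    unfolding E'_def[abs_def] \<omega>_def w_def by (rule energy_derivative[OF P])
  interpret E': linear E' by (rule has_derivative_linear[OF Ed])
  have "dt I (\<lambda>t x. energy \<psi> (W t x)) t x = E' a"
    by (rule dt_eq[where f="\<lambda>t x. energy \<psi> (W t x)", OF has_vector_derivative_compose[OF a Ed] nb])
  moreover have "diver (\<lambda>x. energy_flux \<psi> (W t x)) x
     = (energy \<psi> w + pressure \<psi> \<omega>) * d + (E' (A (vel w)) + grad (\<lambda>x. pressure \<psi> (state_of (W t x))) x \<bullet> vel w)"
    unfolding energy_flux_def scaleR_add_left[symmetric] gradp
    unfolding w_def d_def \<omega>_def
    by (rule diver_scaleR[OF has_derivative_add[OF space[OF Ed] space[OF pressure_state_derivative[OF P]]] V])
  ultimately have "E' D + (energy \<psi> w + pressure \<psi> \<omega>) * d + grad (\<lambda>x. pressure \<psi> (state_of (W t x))) x \<bullet> vel w = Q"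
    using ener by (simp add: D_def E'.add)
  \<comment> \<open>The change of the velocity in \<open>E' D\<close> cancels against the work of the pressure gradient.\<close>
  moreover have "total_mass (dens w) * (vel w \<bullet> vel D) = - (grad (\<lambda>x. pressure \<psi> (state_of (W t x))) x \<bullet> vel w)"
    using arg_cong[OF vD, of "\<lambda>u. vel w \<bullet> u"] by (simp add: inner_commute)
  moreover have "(\<Sum>i\<in>UNIV. chem_pot \<psi> \<omega> $ i * dens D $ i)
      = (\<Sum>i\<in>UNIV. chem_pot \<psi> \<omega> $ i * s i) - (\<Sum>i\<in>UNIV. dens w $ i * chem_pot \<psi> \<omega> $ i) * d"
    unfolding dmass by (simp add: sum_subtractf sum_distrib_left algebra_simps)
  moreover have "energy \<psi> w + pressure \<psi> \<omega> = temp w * rho_eta \<psi> \<omega>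
      + (\<Sum>i\<in>UNIV. dens w $ i * chem_pot \<psi> \<omega> $ i) + total_mass (dens w) * (norm (vel w))\<^sup>2 / 2"
    by (simp add: energy_def pressure_def rho_e_def \<omega>_def)
  ultimately show "temp w * d\<eta> \<omega> (state_of D)
      = Q - (\<Sum>i\<in>UNIV. chem_pot \<psi> \<omega> $ i * s i) - temp w * rho_eta \<psi> \<omega> * d"
    unfolding E'_def tmass by (simp add: algebra_simps)
qed

section \<open>The relative energy identity\<close>

text \<open>Derivative of the relative energy at \<open>(w, w')\<close> in the direction \<open>(a, a')\<close>.  By the Gibbs relation at \<open>w'\<close> only
the derivatives of the coefficients \<open>\<mu>'\<close>, \<open>\<theta>'\<close> and \<open>v'\<close> contribute in the direction \<open>a'\<close>.\<close>

definition rel_I_deriv :: "'n unknown \<Rightarrow> 'n unknown \<Rightarrow> 'n unknown \<Rightarrow> 'n unknown \<Rightarrow> real" where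
  "rel_I_deriv w w' a a' = total_mass (dens a) * (norm (vel w - vel w'))\<^sup>2 / 2
     + total_mass (dens w) * ((vel w - vel w') \<bullet> (vel a - vel a'))
     + (\<Sum>i\<in>UNIV. (chem_pot \<psi> (state_of w) $ i - chem_pot \<psi> (state_of w') $ i) * dens a $ i)
     + (temp w - temp w') * d\<eta> (state_of w) (state_of a)
     - (\<Sum>i\<in>UNIV. d\<mu> i (state_of w') (state_of a') * (dens w $ i - dens w' $ i))
     - temp a' * (rho_eta \<psi> (state_of w) - rho_eta \<psi> (state_of w'))"

lemma rel_I_derivative:
  assumes "state_of w \<in> phase_space" "state_of w' \<in> phase_space"
  shows "((\<lambda>z. rel_I \<psi> (fst z) (snd z)) has_derivative (\<lambda>h. rel_I_deriv w w' (fst h) (snd h))) (at (w, w'))"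
proof -
  have f: "(fst has_derivative fst) (at (w, w'))" and s: "(snd has_derivative snd) (at (w, w'))"
    by (auto intro!: derivative_eq_intros)
  have st: "((\<lambda>z. state_of (fst z)) has_derivative (\<lambda>h. state_of (fst h))) (at (w, w'))"
    "((\<lambda>z. state_of (snd z)) has_derivative (\<lambda>h. state_of (snd h))) (at (w, w'))"
    by (intro bounded_linear.has_derivative[OF bounded_linear_state_of] f s)+
  have state1: "((\<lambda>z. g (state_of (fst z))) has_derivative (\<lambda>h. g' (state_of (fst h)))) (at (w, w'))"
    if "(g has_derivative g') (at (state_of w))" for g :: "'n state \<Rightarrow> real" and g'
    using has_derivative_compose[OF st(1), of g g'] that by simp
  have state2: "((\<lambda>z. g (state_of (snd z))) has_derivative (\<lambda>h. g' (state_of (snd h)))) (at (w, w'))"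
    if "(g has_derivative g') (at (state_of w'))" for g :: "'n state \<Rightarrow> real" and g'
    using has_derivative_compose[OF st(2), of g g'] that by simp
  note thermo = state1[OF rho_e_derivative[OF assms(1)]] state2[OF rho_e_derivative[OF assms(2)]]
    state1[OF rho_eta_derivative[OF assms(1)]] state2[OF rho_eta_derivative[OF assms(2)]]
    state2[OF chem_pot_derivative[OF assms(2)]]
  have comp:
    "((\<lambda>z. dens (fst z) $ i) has_derivative (\<lambda>h. dens (fst h) $ i)) (at (w, w'))"
    "((\<lambda>z. dens (snd z) $ i) has_derivative (\<lambda>h. dens (snd h) $ i)) (at (w, w'))"
    "((\<lambda>z. total_mass (dens (fst z))) has_derivative (\<lambda>h. total_mass (dens (fst h)))) (at (w, w'))"
    "((\<lambda>z. vel (fst z) - vel (snd z)) has_derivative (\<lambda>h. vel (fst h) - vel (snd h))) (at (w, w'))"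
    "((\<lambda>z. temp (snd z)) has_derivative (\<lambda>h. temp (snd h))) (at (w, w'))" for i
    by (intro has_derivative_diff bounded_linear.has_derivative[OF bounded_linear_vec_nth]
        bounded_linear.has_derivative[OF bounded_linear_total_mass]
        bounded_linear.has_derivative[OF bounded_linear_dens] bounded_linear.has_derivative[OF bounded_linear_vel]
        bounded_linear.has_derivative[OF bounded_linear_temp] f s)+
  have J: "((\<lambda>z. rel_J \<psi> (state_of (fst z)) (state_of (snd z))) has_derivative
     (\<lambda>h. (\<Sum>i\<in>UNIV. (chem_pot \<psi> (state_of w) $ i - chem_pot \<psi> (state_of w') $ i) * dens (fst h) $ i)
       + (temp w - temp w') * d\<eta> (state_of w) (state_of (fst h))
       - (\<Sum>i\<in>UNIV. d\<mu> i (state_of w') (state_of (snd h)) * (dens w $ i - dens w' $ i))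
       - temp (snd h) * (rho_eta \<psi> (state_of w) - rho_eta \<psi> (state_of w')))) (at (w, w'))"
    unfolding rel_J_def unknown_linear
    apply (rule has_derivative_eq_rhs)
     apply (rule thermo comp has_derivative_diff has_derivative_sum has_derivative_mult)+
    apply (rule ext)
    apply (simp only: sum.distrib sum_subtractf left_diff_distrib right_diff_distrib unknown_linear)
    apply simp
    done
  have "((\<lambda>z. total_mass (dens (fst z)) * ((vel (fst z) - vel (snd z)) \<bullet> (vel (fst z) - vel (snd z))) / 2)
      has_derivative (\<lambda>h. total_mass (dens (fst h)) * ((vel w - vel w') \<bullet> (vel w - vel w')) / 2
        + total_mass (dens w) * ((vel w - vel w') \<bullet> (vel (fst h) - vel (snd h))))) (at (w, w'))"
    by (rule has_derivative_eq_rhs[OF bounded_linear.has_derivative[OF bounded_linear_divide[of 2]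
          has_derivative_mult[OF comp(3) has_derivative_inner[OF comp(4) comp(4)]]]])
      (simp add: inner_commute[of "vel (fst _) - vel (snd _)" "vel w - vel w'"] distrib_left add_divide_distrib add.commute)
  from has_derivative_add[OF this J] show ?thesis
    unfolding rel_I_def rel_I_deriv_def dot_square_norm by (simp only: add.assoc add_diff_eq)
qed

text \<open>\<open>D\<close> and \<open>D'\<close> are the derivatives of the two flows along their own particle paths; \<open>D' + B\<close> is the derivative of the
limit flow along the paths of the other one.  With \<open>d\<close>, \<open>d'\<close> the divergences of the velocities and \<open>g\<close>, \<open>g'\<close> the
pressure gradients, the left-hand side is the derivative of \<open>I\<close> plus the divergence of its transport flux and of
\<open>(p - p')(v - v')\<close>.  On the right, the first four terms are products of two differences, the next
three are so jointly (\<open>first_order_cancellation\<close>), and the last two come from the sources \<open>Q\<close> and \<open>s\<close>.\<close>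

lemma relative_energy_identity:
  fixes s :: "'n \<Rightarrow> real"
  assumes pos: "0 < temp w" "0 < total_mass (dens w')"
    and mass: "\<And>i. dens D $ i = s i - dens w $ i * d" "total_mass (dens D) = - total_mass (dens w) * d"
    and mom: "total_mass (dens w) *\<^sub>R vel D = - g"
    and ent: "temp w * d\<eta> (state_of w) (state_of D)
      = Q - (\<Sum>i\<in>UNIV. chem_pot \<psi> (state_of w) $ i * s i) - temp w * rho_eta \<psi> (state_of w) * d"
    and mom': "total_mass (dens w') *\<^sub>R vel D' = - g'"
    and lin: "\<And>i. d\<mu> i (state_of w') (state_of (D' + B)) = d\<mu> i (state_of w') (state_of D') + d\<mu> i (state_of w') (state_of B)"
  shows "rel_I_deriv w w' D (D' + B) + rel_I \<psi> w w' * d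
      + (pressure \<psi> (state_of w) - pressure \<psi> (state_of w')) * (d - d') + (g - g') \<bullet> (vel w - vel w')
    = - total_mass (dens w) * ((vel w - vel w') \<bullet> vel B)
      + (total_mass (dens w) - total_mass (dens w')) / total_mass (dens w') * ((vel w - vel w') \<bullet> g')
      - (\<Sum>i\<in>UNIV. d\<mu> i (state_of w') (state_of B) * (dens w $ i - dens w' $ i))
      - temp B * (rho_eta \<psi> (state_of w) - rho_eta \<psi> (state_of w'))
      - (pressure \<psi> (state_of w) - pressure \<psi> (state_of w')) * d'
      - (\<Sum>i\<in>UNIV. d\<mu> i (state_of w') (state_of D') * (dens w $ i - dens w' $ i))
      - temp D' * (rho_eta \<psi> (state_of w) - rho_eta \<psi> (state_of w'))
      + Q * (1 - temp w' / temp w)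
      - (\<Sum>i\<in>UNIV. (chem_pot \<psi> (state_of w') $ i - temp w' * chem_pot \<psi> (state_of w) $ i / temp w) * s i)"
proof -
  define \<mu> \<mu>' \<theta> \<theta>' \<eta> \<eta>' u r r' R R' where
    "\<mu> = chem_pot \<psi> (state_of w)" and "\<mu>' = chem_pot \<psi> (state_of w')" and "\<theta> = temp w" and "\<theta>' = temp w'"
    and "\<eta> = rho_eta \<psi> (state_of w)" and "\<eta>' = rho_eta \<psi> (state_of w')" and "u = vel w - vel w'"
    and "r = dens w" and "r' = dens w'" and "R = total_mass (dens w)" and "R' = total_mass (dens w')"
  note defs = this
  have \<theta>: "\<theta> > 0" "R' > 0" using pos by (simp_all add: defs)
  have mass2: "total_mass (dens D) = - R * d" using mass(2) by (simp add: R_def)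
  have 1: "R * (u \<bullet> (vel D - vel (D' + B))) = - (u \<bullet> g) + R / R' * (u \<bullet> g') - R * (u \<bullet> vel B)"
  proof -
    have "R * (u \<bullet> vel D) = - (u \<bullet> g)" using arg_cong[OF mom, of "\<lambda>v. u \<bullet> v"] by (simp add: R_def)
    moreover have "R' * (u \<bullet> vel D') = - (u \<bullet> g')" using arg_cong[OF mom', of "\<lambda>v. u \<bullet> v"] by (simp add: R'_def)
    then have "u \<bullet> vel D' = - (u \<bullet> g') / R'" using \<theta>(2) by (simp add: field_simps)
    ultimately show ?thesis by (simp add: inner_diff_right inner_add_right algebra_simps)
  qed
  have 2: "(\<Sum>i\<in>UNIV. (\<mu> $ i - \<mu>' $ i) * dens D $ i) = (\<Sum>i\<in>UNIV. (\<mu> $ i - \<mu>' $ i) * s i)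
      - ((\<Sum>i\<in>UNIV. \<mu> $ i * r $ i) - (\<Sum>i\<in>UNIV. \<mu>' $ i * r $ i)) * d"
    unfolding mass(1) r_def[symmetric]
    by (simp add: sum_subtractf sum_distrib_left sum_distrib_right sum.distrib algebra_simps)
  have E: "d\<eta> (state_of w) (state_of D) = (Q - (\<Sum>i\<in>UNIV. \<mu> $ i * s i)) / \<theta> - \<eta> * d"
    using ent \<theta>(1) unfolding defs[symmetric] by (simp add: field_simps)
  have 3: "(\<theta> - \<theta>') * d\<eta> (state_of w) (state_of D)
      = (1 - \<theta>' / \<theta>) * (Q - (\<Sum>i\<in>UNIV. \<mu> $ i * s i)) - (\<theta> - \<theta>') * \<eta> * d"
    unfolding E using \<theta>(1) by (simp add: field_simps)
  have 4: "(\<Sum>i\<in>UNIV. d\<mu> i (state_of w') (state_of (D' + B)) * (r $ i - r' $ i))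
      = (\<Sum>i\<in>UNIV. d\<mu> i (state_of w') (state_of D') * (r $ i - r' $ i))
        + (\<Sum>i\<in>UNIV. d\<mu> i (state_of w') (state_of B) * (r $ i - r' $ i))"
    unfolding lin by (simp add: sum.distrib distrib_right)
  \<comment> \<open>Both internal energies are written as \<open>\<rho>e = \<theta>\<eta> + \<Sum> \<rho>\<^sub>i \<mu>\<^sub>i - p\<close>.\<close>
  have 5: "rel_I \<psi> w w' = R * (norm u)\<^sup>2 / 2 - (pressure \<psi> (state_of w) - pressure \<psi> (state_of w'))
      + (\<Sum>i\<in>UNIV. \<mu> $ i * r $ i) - (\<Sum>i\<in>UNIV. \<mu>' $ i * r $ i) + (\<theta> - \<theta>') * \<eta>"
    unfolding rel_I_def rel_J_def rho_e_def pressure_def unknown_linear R_def[symmetric]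
    unfolding defs[symmetric]
    by (simp add: sum_subtractf algebra_simps)
  have 6: "(\<Sum>i\<in>UNIV. (\<mu>' $ i - \<theta>' * \<mu> $ i / \<theta>) * s i)
      = (\<Sum>i\<in>UNIV. \<mu>' $ i * s i) - \<theta>' / \<theta> * (\<Sum>i\<in>UNIV. \<mu> $ i * s i)"
    by (simp add: sum_subtractf sum_distrib_left algebra_simps)
  have 7: "(\<Sum>i\<in>UNIV. (\<mu> $ i - \<mu>' $ i) * s i) = (\<Sum>i\<in>UNIV. \<mu> $ i * s i) - (\<Sum>i\<in>UNIV. \<mu>' $ i * s i)"
    by (simp add: sum_subtractf algebra_simps)
  have 8: "(R - R') / R' = R / R' - 1" using \<theta>(2) by (simp add: field_simps)
  have 9: "(g - g') \<bullet> u = u \<bullet> g - u \<bullet> g'" by (simp add: inner_diff_left inner_commute[of u])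
  have 10: "temp (D' + B) = temp D' + temp B" by simp
  show ?thesis
    unfolding rel_I_deriv_def R_def[symmetric] R'_def[symmetric]
    unfolding defs[symmetric] mass2 1 2 3 4 5 6 7 8 9 10
    by (simp add: algebra_simps)
qed

text \<open>The Maxwell relations exchange the difference \<open>h\<close> and the derivative \<open>k\<close> along particle paths.  Along these the
densities and the entropy change by \<open>- d\<close> times themselves, and then the Gibbs-Duhem relation identifies the result as
\<open>- d\<close> times the derivative of the pressure in the direction \<open>h\<close>, up to the entropy term.\<close>

lemma first_order_cancellation:
  assumes P: "\<omega> \<in> phase_space"
    and mass: "\<And>i. fst k $ i = - fst \<omega> $ i * d" and ent: "d\<eta> \<omega> k = - rho_eta \<psi> \<omega> * d"
  shows "(\<Sum>i\<in>UNIV. d\<mu> i \<omega> k * fst h $ i)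
    = - d * ((\<Sum>i\<in>UNIV. fst \<omega> $ i * d\<mu> i \<omega> h) + rho_eta \<psi> \<omega> * snd h) - snd k * d\<eta> \<omega> h"
proof -
  have "(\<Sum>i\<in>UNIV. d\<mu> i \<omega> k * fst h $ i) = (\<Sum>i\<in>UNIV. fst h $ i * d\<mu> i \<omega> k)"
    by (simp add: mult.commute)
  moreover have "(\<Sum>i\<in>UNIV. fst k $ i * d\<mu> i \<omega> h) = - d * (\<Sum>i\<in>UNIV. fst \<omega> $ i * d\<mu> i \<omega> h)"
    unfolding mass sum_distrib_left by (simp add: algebra_simps)
  ultimately show ?thesis
    using maxwell_relation[OF P, of h k] unfolding ent by (simp add: algebra_simps)
qed

end

section \<open>Taylor estimates near a compact set\<close>

lemma derivative_bound_on_compact: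
  fixes f :: "'a::euclidean_space \<Rightarrow> 'b::real_normed_vector"
  assumes "Ck_on 1 S f" "compact K" "K \<subseteq> S"
  shows "\<exists>C\<ge>0. \<forall>y\<in>K. \<forall>h. norm (der f y h) \<le> C * norm h"
proof -
  let ?N = "\<lambda>y. \<Sum>b\<in>Basis. norm (der f y b)"
  have "continuous_on K ?N"
    using assms by (intro continuous_intros) (auto intro: continuous_on_subset)
  then have "bounded (?N ` K)" using assms(2) by (intro compact_imp_bounded compact_continuous_image)
  then obtain C where C: "\<And>y. y \<in> K \<Longrightarrow> norm (?N y) \<le> C" unfolding bounded_iff by blast
  have "norm (der f y h) \<le> max C 0 * norm h" if y: "y \<in> K" for y h
  proof -
    have "norm (der f y h) = norm (\<Sum>b\<in>Basis. (h \<bullet> b) *\<^sub>R der f y b)"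
      using assms(1,3) y by (subst frechet_derivative_basis_sum) auto
    also have "\<dots> \<le> (\<Sum>b\<in>Basis. norm h * norm (der f y b))"
      by (intro sum_norm_le) (auto intro!: mult_right_mono Basis_le_norm)
    also have "\<dots> = norm h * ?N y" by (simp add: sum_distrib_left)
    also have "\<dots> \<le> norm h * max C 0" using C[OF y] by (intro mult_left_mono) auto
    finally show ?thesis by (simp add: mult.commute)
  qed
  then show ?thesis by (intro exI[of _ "max C 0"]) auto
qed

lemma second_derivative_bound_on_compact:
  fixes g :: "'a::euclidean_space \<Rightarrow> real"
  assumes "open S" "Ck_on 2 S g" "compact K" "K \<subseteq> S"
  shows "\<exists>C\<ge>0. \<forall>y\<in>K. \<forall>h k.
    \<bar>der (\<lambda>z. der g z h) y k\<bar> \<le> C * norm h * norm k"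
proof -
  have "Ck_on (Suc 1) S g" using assms(2) by (simp only: numeral_2_eq_2 One_nat_def)
  then have g: "Ck_on 1 S (\<lambda>z. der g z h)" "\<And>z. z \<in> S \<Longrightarrow> g differentiable (at z)" for h
    unfolding Ck_on.simps(2)[of 1] by blast+
  obtain C where C: "\<And>b. C b \<ge> 0" "\<And>b y k. y \<in> K \<Longrightarrow>
      norm (der (\<lambda>z. der g z b) y k) \<le> C b * norm k"
    using derivative_bound_on_compact[OF g(1) assms(3,4)] by metis
  have "\<bar>der (\<lambda>z. der g z h) y k\<bar> \<le> (\<Sum>b\<in>Basis. C b) * norm h * norm k"
    if y: "y \<in> K" for y h k
  proof -
    let ?D = "\<lambda>b. der (\<lambda>z. der g z b) y"
    have d: "((\<lambda>z. der g z b) has_derivative ?D b) (at y)" for b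
      using g(1)[of b] y assms(4) by (intro Ck_on_has_derivative[of 0 S]) (auto simp del: Ck_on.simps)
    have "((\<lambda>z. \<Sum>b\<in>Basis. (h \<bullet> b) * der g z b) has_derivative
        (\<lambda>k. \<Sum>b\<in>Basis. (h \<bullet> b) * ?D b k)) (at y)"
      by (intro has_derivative_sum has_derivative_mult_right d)
    then have "((\<lambda>z. der g z h) has_derivative (\<lambda>k. \<Sum>b\<in>Basis. (h \<bullet> b) * ?D b k)) (at y)"
    proof (rule has_derivative_transform_within_open[OF _ assms(1)])
      show "(\<Sum>b\<in>Basis. (h \<bullet> b) * der g z b) = der g z h" if "z \<in> S" for z
        using frechet_derivative_basis_sum[OF g(2)[OF that], of h] by simp
    qed (use y assms(4) in auto)
    then have "der (\<lambda>z. der g z h) y = (\<lambda>k. \<Sum>b\<in>Basis. (h \<bullet> b) * ?D b k)"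
      by (rule frechet_derivative_at[symmetric])
    then have "\<bar>der (\<lambda>z. der g z h) y k\<bar> = \<bar>\<Sum>b\<in>Basis. (h \<bullet> b) * ?D b k\<bar>"
      by simp
    also have "\<dots> \<le> (\<Sum>b\<in>Basis. norm h * (C b * norm k))"
      unfolding real_norm_def[symmetric] using C y
      by (intro sum_norm_le) (auto simp: abs_mult intro!: mult_mono Basis_le_norm)
    also have "\<dots> = (\<Sum>b\<in>Basis. C b) * norm h * norm k"
      by (simp add: sum_distrib_left sum_distrib_right algebra_simps)
    finally show ?thesis .
  qed
  then show ?thesis using C(1) by (intro exI[of _ "\<Sum>b\<in>Basis. C b"]) (auto intro: sum_nonneg)
qed

text \<open>The segment between the two points may leave \<open>S\<close>; then they are at a distance bounded below,
  and boundedness of \<open>g\<close> suffices.\<close>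

lemma quadratic_remainder:
  fixes g :: "'a::euclidean_space \<Rightarrow> real"
  assumes "open S" "Ck_on 2 S g" "compact K" "K \<subseteq> S" "bounded X" "bounded (g ` X)"
  shows "\<exists>C\<ge>0. \<forall>y\<in>K. \<forall>x\<in>X.
    \<bar>g x - g y - der g y (x - y)\<bar> \<le> C * (norm (x - y))\<^sup>2 \<and> \<bar>g x - g y\<bar> \<le> C * norm (x - y)"
proof -
  obtain r where r: "r > 0" "(\<Union>x\<in>K. cball x r) \<subseteq> S"
    using compact_subset_open_imp_cball_epsilon_subset[OF assms(3,1,4)] by blast
  define Kr where "Kr = (\<lambda>(x, y). x + y) ` (K \<times> cball 0 r)"
  have "compact Kr" unfolding Kr_def case_prod_beta'
    by (intro compact_continuous_image continuous_intros compact_Times assms(3) compact_cball)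
  have KrS: "Kr \<subseteq> S"
  proof
    fix z assume "z \<in> Kr"
    then obtain x y where "x \<in> K" "norm y \<le> r" "z = x + y" by (auto simp: Kr_def)
    then have "z \<in> cball x r" by (simp add: dist_norm)
    then show "z \<in> S" using r(2) \<open>x \<in> K\<close> by blast
  qed
  have C1g: "Ck_on 1 S g" by (rule Ck_on_antimono[OF assms(2)]) simp
  have "Ck_on (Suc 1) S g" using assms(2) by (simp only: numeral_2_eq_2 One_nat_def)
  then have C1d: "Ck_on 1 S (\<lambda>z. der g z h)" for h
    unfolding Ck_on.simps(2)[of 1] by blast
  have gd: "(g has_derivative der g z) (at z)" if "z \<in> S" for z
    using Ck_on_has_derivative[OF C1g[unfolded One_nat_def] that] .
  have gdd: "((\<lambda>z. der g z h) has_derivative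
      der (\<lambda>z. der g z h) z) (at z)" if "z \<in> S" for z h
    using Ck_on_has_derivative[OF C1d[unfolded One_nat_def] that] .
  obtain C1 where C1: "C1 \<ge> 0" "\<And>y h. y \<in> K \<Longrightarrow> norm (der g y h) \<le> C1 * norm h"
    using derivative_bound_on_compact[OF C1g assms(3,4)] by blast
  obtain C2 where C2: "C2 \<ge> 0" "\<And>y h k. y \<in> Kr \<Longrightarrow>
      \<bar>der (\<lambda>z. der g z h) y k\<bar> \<le> C2 * norm h * norm k"
    using second_derivative_bound_on_compact[OF assms(1,2) \<open>compact Kr\<close> KrS] by blast
  obtain B1 where B1: "\<And>x. x \<in> X \<Longrightarrow> \<bar>g x\<bar> \<le> B1" using assms(6) unfolding bounded_iff by auto
  have "bounded (g ` K)"
    using Ck_on_continuous[OF assms(2)] assms(3,4)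
    by (intro compact_imp_bounded compact_continuous_image) (auto intro: continuous_on_subset)
  then obtain B2 where B2: "\<And>x. x \<in> K \<Longrightarrow> \<bar>g x\<bar> \<le> B2" unfolding bounded_iff by auto
  obtain D1 D2 where D: "\<And>x. x \<in> X \<Longrightarrow> norm x \<le> D1" "\<And>x. x \<in> K \<Longrightarrow> norm x \<le> D2"
    using assms(5) compact_imp_bounded[OF assms(3)] unfolding bounded_iff by auto
  define C where "C = max C2 ((\<bar>B1\<bar> + \<bar>B2\<bar>) / r\<^sup>2 + C1 / r)"
  have "C \<ge> 0" using C2(1) by (simp add: C_def)
  have quad: "\<bar>g x - g y - der g y (x - y)\<bar> \<le> C * (norm (x - y))\<^sup>2"
    if y: "y \<in> K" and x: "x \<in> X" for x y
  proof (cases "norm (x - y) \<le> r")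
    case True
    define h where "h = x - y"
    define \<gamma> where "\<gamma> s = y + s *\<^sub>R h" for s :: real
    have \<gamma>: "\<gamma> s \<in> Kr" if "0 \<le> s" "s \<le> 1" for s
    proof -
      have "norm (s *\<^sub>R h) \<le> 1 * r" unfolding norm_scaleR using that True by (intro mult_mono) (auto simp: h_def)
      then show ?thesis using y by (auto simp: Kr_def \<gamma>_def)
    qed
    have \<gamma>d: "(\<gamma> has_derivative (\<lambda>t. t *\<^sub>R h)) (at s)" for s
      unfolding \<gamma>_def by (auto intro!: derivative_eq_intros)
    let ?f = "\<lambda>s. g (\<gamma> s)" and ?f' = "\<lambda>s. der g (\<gamma> s) h"
      and ?f'' = "\<lambda>s. der (\<lambda>z. der g z h) (\<gamma> s) h"
    have f: "(?f has_real_derivative ?f' s) (at s)" if "0 \<le> s" "s \<le> 1" for s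
    proof -
      have "\<gamma> s \<in> S" using \<gamma>[OF that] KrS by blast
      from has_derivative_compose[OF \<gamma>d gd[OF this]] show ?thesis
        unfolding has_field_derivative_def linear_scale[OF has_derivative_linear[OF gd[OF \<open>\<gamma> s \<in> S\<close>]]]
        by (simp add: mult.commute[of _ "?f' s"])
    qed
    have f': "(?f' has_real_derivative ?f'' s) (at s)" if "0 \<le> s" "s \<le> 1" for s
    proof -
      have "\<gamma> s \<in> S" using \<gamma>[OF that] KrS by blast
      from has_derivative_compose[OF \<gamma>d gdd[OF this, of h]] show ?thesis
        unfolding has_field_derivative_def linear_scale[OF has_derivative_linear[OF gdd[OF \<open>\<gamma> s \<in> S\<close>]]]
        by (simp add: mult.commute[of _ "?f'' s"])
    qed
    obtain z1 where z1: "0 < z1" "z1 < 1" "?f 1 - ?f 0 = (1 - 0) * ?f' z1"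
      using MVT2[of 0 1 ?f ?f'] f by auto
    obtain z2 where z2: "0 < z2" "z2 < z1" "?f' z1 - ?f' 0 = (z1 - 0) * ?f'' z2"
      using MVT2[of 0 z1 ?f' ?f''] f' z1(1,2) by auto
    have "\<bar>?f 1 - ?f 0 - ?f' 0\<bar> = z1 * \<bar>?f'' z2\<bar>"
      using z1 z2 by (simp add: abs_mult)
    also have "\<dots> \<le> 1 * \<bar>?f'' z2\<bar>" using z1 by (intro mult_right_mono) auto
    also have "\<dots> \<le> C2 * norm h * norm h" using C2(2)[OF \<gamma>[of z2], of h h] z1 z2 by simp
    also have "\<dots> = C2 * (norm h)\<^sup>2" by (simp add: power2_eq_square)
    also have "\<dots> \<le> C * (norm h)\<^sup>2" by (intro mult_right_mono) (auto simp: C_def)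
    finally show ?thesis by (simp add: \<gamma>_def h_def)
  next
    case False
    define n where "n = norm (x - y)"
    have n: "n > r" "n > 0" using False r(1) by (auto simp: n_def)
    have "\<bar>g x - g y - der g y (x - y)\<bar> \<le> \<bar>B1\<bar> + \<bar>B2\<bar> + C1 * n"
      using B1[OF x] B2[OF y] C1(2)[OF y, of "x - y"] by (simp add: n_def)
    also have "\<dots> \<le> (\<bar>B1\<bar> + \<bar>B2\<bar>) * (n\<^sup>2 / r\<^sup>2) + C1 * (n\<^sup>2 / r)"
    proof (intro add_mono)
      have "r\<^sup>2 \<le> n\<^sup>2" using n r(1) by (intro power_mono) auto
      then have "1 \<le> n\<^sup>2 / r\<^sup>2" using r(1) by simp
      then show "\<bar>B1\<bar> + \<bar>B2\<bar> \<le> (\<bar>B1\<bar> + \<bar>B2\<bar>) * (n\<^sup>2 / r\<^sup>2)"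
        by (metis abs_ge_zero add_nonneg_nonneg mult.right_neutral mult_left_mono)
      have "n * r \<le> n\<^sup>2" using n by (simp add: power2_eq_square)
      then have "n \<le> n\<^sup>2 / r" using r(1) by (simp add: field_simps)
      then show "C1 * n \<le> C1 * (n\<^sup>2 / r)" using C1(1) by (rule mult_left_mono)
    qed
    also have "\<dots> = ((\<bar>B1\<bar> + \<bar>B2\<bar>) / r\<^sup>2 + C1 / r) * n\<^sup>2" by (simp add: algebra_simps)
    also have "\<dots> \<le> C * n\<^sup>2" by (intro mult_right_mono) (auto simp: C_def)
    finally show ?thesis by (simp add: n_def)
  qed
  have lip: "\<bar>g x - g y\<bar> \<le> (C * (\<bar>D1\<bar> + \<bar>D2\<bar>) + C1) * norm (x - y)" if y: "y \<in> K" and x: "x \<in> X" for x y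
  proof -
    have n: "norm (x - y) \<le> \<bar>D1\<bar> + \<bar>D2\<bar>" using D(1)[OF x] D(2)[OF y] norm_triangle_ineq4[of x y] by linarith
    have "\<bar>g x - g y\<bar> \<le> C * (norm (x - y))\<^sup>2 + C1 * norm (x - y)"
      using quad[OF y x] C1(2)[OF y, of "x - y"] unfolding real_norm_def by linarith
    also have "C * (norm (x - y))\<^sup>2 \<le> C * ((\<bar>D1\<bar> + \<bar>D2\<bar>) * norm (x - y))"
      using n \<open>C \<ge> 0\<close> by (intro mult_left_mono) (auto simp: power2_eq_square intro: mult_right_mono)
    finally show ?thesis by (simp add: algebra_simps)
  qed
  define C' where "C' = max C (C * (\<bar>D1\<bar> + \<bar>D2\<bar>) + C1)"
  show ?thesis
  proof (intro exI[of _ C'] conjI ballI)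
    show "0 \<le> C'" using \<open>C \<ge> 0\<close> by (simp add: C'_def)
    fix y x assume yx: "y \<in> K" "x \<in> X"
    show "\<bar>g x - g y - der g y (x - y)\<bar> \<le> C' * (norm (x - y))\<^sup>2"
      by (rule order_trans[OF quad[OF yx]]) (intro mult_right_mono, auto simp: C'_def)
    show "\<bar>g x - g y\<bar> \<le> C' * norm (x - y)"
      by (rule order_trans[OF lip[OF yx]]) (intro mult_right_mono, auto simp: C'_def)
  qed
qed

section \<open>Dissipation by mass diffusion\<close>

text \<open>Symmetrising the double sum gives half the sum of \<open>b i j * r i * r j * |u i - u j|\<^sup>2\<close>; without the
  weights \<open>b i j\<close> that is the total mass times the sum of \<open>r i * |u i|\<^sup>2\<close>, because the net diffusive momentum
  is zero.\<close>

lemma drag_dissipation: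
  fixes u :: "'n::finite \<Rightarrow> 'v::real_inner" and r :: "'n \<Rightarrow> real"
  assumes r: "\<And>i. 0 < r i" and sym: "\<And>i j. i \<noteq> j \<Longrightarrow> b i j = b j i"
    and b: "\<And>i j. i \<noteq> j \<Longrightarrow> \<mu> \<le> b i j" and mom: "(\<Sum>i\<in>UNIV. r i *\<^sub>R u i) = 0"
  shows "\<mu> * (\<Sum>i\<in>UNIV. r i) * (\<Sum>i\<in>UNIV. r i * (norm (u i))\<^sup>2)
    \<le> (\<Sum>i\<in>UNIV. \<Sum>j\<in>UNIV - {i}. b i j * r i * r j * ((u i - u j) \<bullet> u i))"
proof -
  define c where "c i j = (if i = j then \<mu> else b i j) * r i * r j" for i j
  have c_sym: "c i j = c j i" for i j using sym by (simp add: c_def)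
  have c_le: "\<mu> * r i * r j \<le> c i j" for i j
    unfolding c_def using b r[of i] r[of j] by (intro mult_right_mono) (auto simp: less_imp_le)
  define X where "X = (\<Sum>i\<in>UNIV. \<Sum>j\<in>UNIV. c i j * ((u i - u j) \<bullet> u i))"
  have "(\<Sum>j\<in>UNIV - {i}. b i j * r i * r j * ((u i - u j) \<bullet> u i)) = (\<Sum>j\<in>UNIV. c i j * ((u i - u j) \<bullet> u i))" for i
    by (subst (2) sum.remove[of _ i]) (auto simp: c_def intro!: sum.cong)
  then have X: "(\<Sum>i\<in>UNIV. \<Sum>j\<in>UNIV - {i}. b i j * r i * r j * ((u i - u j) \<bullet> u i)) = X"
    by (simp add: X_def)
  have "X = (\<Sum>i\<in>UNIV. \<Sum>j\<in>UNIV. c i j * ((u j - u i) \<bullet> u j))"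
    unfolding X_def by (subst sum.swap) (simp add: c_sym)
  then have "2 * X = (\<Sum>i\<in>UNIV. \<Sum>j\<in>UNIV. c i j * ((u i - u j) \<bullet> u i)) + (\<Sum>i\<in>UNIV. \<Sum>j\<in>UNIV. c i j * ((u j - u i) \<bullet> u j))"
    unfolding X_def by simp
  also have "\<dots> = (\<Sum>i\<in>UNIV. \<Sum>j\<in>UNIV. c i j * (norm (u i - u j))\<^sup>2)"
    by (simp add: sum.distrib[symmetric] dot_square_norm[symmetric] inner_diff_left inner_diff_right inner_commute algebra_simps)
  also have "\<dots> \<ge> (\<Sum>i\<in>UNIV. \<Sum>j\<in>UNIV. \<mu> * r i * r j * (norm (u i - u j))\<^sup>2)"
    by (intro sum_mono mult_right_mono c_le) simp
  also have "(\<Sum>i\<in>UNIV. \<Sum>j\<in>UNIV. \<mu> * r i * r j * (norm (u i - u j))\<^sup>2)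
     = 2 * (\<mu> * (\<Sum>i\<in>UNIV. r i) * (\<Sum>i\<in>UNIV. r i * (norm (u i))\<^sup>2))"
  proof -
    have "(\<Sum>j\<in>UNIV. \<mu> * r i * r j * (norm (u i - u j))\<^sup>2)
      = \<mu> * r i * (norm (u i))\<^sup>2 * (\<Sum>j\<in>UNIV. r j) + \<mu> * r i * (\<Sum>j\<in>UNIV. r j * (norm (u j))\<^sup>2)" for i
    proof -
      have "(\<Sum>j\<in>UNIV. \<mu> * r i * r j * (norm (u i - u j))\<^sup>2)
        = (\<Sum>j\<in>UNIV. \<mu> * r i * (norm (u i))\<^sup>2 * r j + \<mu> * r i * (r j * (norm (u j))\<^sup>2)
            - 2 * \<mu> * r i * (u i \<bullet> (r j *\<^sub>R u j)))"
        by (intro sum.cong refl) (simp add: dot_square_norm[symmetric] inner_diff_left inner_diff_right inner_commute algebra_simps)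
      also have "\<dots> = \<mu> * r i * (norm (u i))\<^sup>2 * (\<Sum>j\<in>UNIV. r j) + \<mu> * r i * (\<Sum>j\<in>UNIV. r j * (norm (u j))\<^sup>2)
          - 2 * \<mu> * r i * (u i \<bullet> (\<Sum>j\<in>UNIV. r j *\<^sub>R u j))"
        by (simp only: sum_subtractf sum.distrib sum_distrib_left[symmetric] inner_sum_right[symmetric])
      finally show ?thesis by (simp add: mom)
    qed
    then have "(\<Sum>i\<in>UNIV. \<Sum>j\<in>UNIV. \<mu> * r i * r j * (norm (u i - u j))\<^sup>2)
      = (\<Sum>i\<in>UNIV. (\<mu> * (\<Sum>j\<in>UNIV. r j)) * (r i * (norm (u i))\<^sup>2)
          + (\<mu> * (\<Sum>j\<in>UNIV. r j * (norm (u j))\<^sup>2)) * r i)"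
      by (simp add: algebra_simps)
    also have "\<dots> = (\<mu> * (\<Sum>j\<in>UNIV. r j)) * (\<Sum>i\<in>UNIV. r i * (norm (u i))\<^sup>2)
          + (\<mu> * (\<Sum>j\<in>UNIV. r j * (norm (u j))\<^sup>2)) * (\<Sum>i\<in>UNIV. r i)"
      by (simp only: sum.distrib sum_distrib_left[symmetric])
    finally show ?thesis by (simp add: algebra_simps)
  qed
  finally show ?thesis unfolding X by simp
qed

text \<open>Testing the law for the diffusion velocities with these velocities themselves; the pressure gradient drops out
because the net diffusive momentum vanishes.\<close>

lemma diffusion_dissipation:
  fixes u m :: "'n::finite \<Rightarrow> real^3" and r h :: "'n \<Rightarrow> real"
  assumes r: "\<And>i. 0 < r i" and sym: "\<And>i j. i \<noteq> j \<Longrightarrow> b i j = b j i"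
    and b: "\<And>i j. i \<noteq> j \<Longrightarrow> \<mu> \<le> b i j" and mom: "(\<Sum>i\<in>UNIV. r i *\<^sub>R u i) = 0"
    and pos: "0 < \<epsilon>" "0 < \<theta>"
    and law: "\<And>i. - (\<Sum>j\<in>UNIV - {i}. (b i j * \<theta> * r i * r j) *\<^sub>R (u i - u j))
       = \<epsilon> *\<^sub>R (- (r i / R) *\<^sub>R g + (r i * \<theta>) *\<^sub>R m i - (\<theta> * h i) *\<^sub>R n)"
  shows "(\<Sum>i\<in>UNIV. (r i *\<^sub>R m i - h i *\<^sub>R n) \<bullet> u i)
    \<le> - (\<mu> * (\<Sum>i\<in>UNIV. r i) / \<epsilon>) * (\<Sum>i\<in>UNIV. r i * (norm (u i))\<^sup>2)"
proof -
  let ?X = "\<Sum>i\<in>UNIV. \<Sum>j\<in>UNIV - {i}. b i j * r i * r j * ((u i - u j) \<bullet> u i)"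
  let ?Y = "\<Sum>i\<in>UNIV. (r i *\<^sub>R m i - h i *\<^sub>R n) \<bullet> u i"
  have "- \<theta> * (\<Sum>j\<in>UNIV - {i}. b i j * r i * r j * ((u i - u j) \<bullet> u i))
      = - (\<epsilon> / R) * (g \<bullet> (r i *\<^sub>R u i)) + \<epsilon> * \<theta> * ((r i *\<^sub>R m i - h i *\<^sub>R n) \<bullet> u i)" for i
  proof -
    have "- \<theta> * (\<Sum>j\<in>UNIV - {i}. b i j * r i * r j * ((u i - u j) \<bullet> u i))
        = (- (\<Sum>j\<in>UNIV - {i}. (b i j * \<theta> * r i * r j) *\<^sub>R (u i - u j))) \<bullet> u i"
      by (simp add: inner_sum_left sum_distrib_left sum_negf mult_ac)
    also have "\<dots> = - (\<epsilon> / R) * (g \<bullet> (r i *\<^sub>R u i)) + \<epsilon> * \<theta> * ((r i *\<^sub>R m i - h i *\<^sub>R n) \<bullet> u i)"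
      unfolding law by (simp add: inner_diff_left inner_add_left algebra_simps)
    finally show ?thesis .
  qed
  then have "- \<theta> * ?X = (\<Sum>i\<in>UNIV. - (\<epsilon> / R) * (g \<bullet> (r i *\<^sub>R u i)) + \<epsilon> * \<theta> * ((r i *\<^sub>R m i - h i *\<^sub>R n) \<bullet> u i))"
    unfolding sum_distrib_left[of "- \<theta>"] by (intro sum.cong refl)
  also have "\<dots> = - (\<epsilon> / R) * (g \<bullet> (\<Sum>i\<in>UNIV. r i *\<^sub>R u i)) + \<epsilon> * \<theta> * ?Y"
    by (simp only: sum.distrib sum_distrib_left[symmetric] inner_sum_right[symmetric])
  finally have *: "- \<theta> * ?X = \<epsilon> * \<theta> * ?Y" by (simp add: mom)
  have "Y = - X / \<epsilon>" if "- \<theta> * X = \<epsilon> * \<theta> * Y" for X Y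
  proof -
    have "\<theta> * (\<epsilon> * Y + X) = 0" using that by (simp add: algebra_simps)
    then have "\<epsilon> * Y + X = 0" using pos(2) by simp
    then show ?thesis using pos(1) by (simp add: field_simps)
  qed
  from this[OF *] have "?Y = - ?X / \<epsilon>" .
  also have "\<dots> \<le> - (\<mu> * (\<Sum>i\<in>UNIV. r i) * (\<Sum>i\<in>UNIV. r i * (norm (u i))\<^sup>2)) / \<epsilon>"
    using drag_dissipation[OF r sym b mom] pos(1) by (intro divide_right_mono) auto
  finally show ?thesis by simp
qed

text \<open>Young's inequality with the weight \<open>r\<close>, in the form in which the square is completed below.\<close>

lemma young_inner:
  fixes y u :: "'v::real_inner"
  assumes "0 < a" "0 < r"
  shows "y \<bullet> u \<le> a * (r * (norm u)\<^sup>2) + (norm y)\<^sup>2 / r / (4 * a)"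
proof -
  have "y \<bullet> u \<le> norm y * norm u" by (rule norm_cauchy_schwarz)
  also have "\<dots> \<le> (2 * a * r * norm u - norm y)\<^sup>2 / (4 * a * r) + norm y * norm u"
    using assms by simp
  also have "\<dots> = a * (r * (norm u)\<^sup>2) + (norm y)\<^sup>2 / r / (4 * a)"
    using assms by (simp add: power2_eq_square field_simps)
  finally show ?thesis .
qed

text \<open>Here \<open>gt\<close>, \<open>gt'\<close>, \<open>n\<close>, \<open>m i\<close> and \<open>k i\<close> stand for the gradients of \<open>\<theta>\<close>, \<open>\<theta>'\<close>, \<open>1/\<theta>\<close>, \<open>\<mu>\<^sub>i/\<theta>\<close> and \<open>\<mu>'\<^sub>i\<close>.  The terms that are linear
in the temperature gradient are absorbed by the quadratic one at the cost of a multiple of \<open>\<kappa>\<close>, those that are linear in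
the diffusion velocities by the dissipation, whose coefficient is of order \<open>1/\<epsilon>\<close>, at the cost of a multiple of \<open>\<epsilon>\<close>.\<close>

lemma diffusive_production_bound:
  fixes u m k :: "'n::finite \<Rightarrow> real^3" and r h \<mu>i :: "'n \<Rightarrow> real" and gt gt' n :: "real^3"
  assumes r: "\<And>i. 0 < r i" and R: "\<delta> \<le> (\<Sum>i\<in>UNIV. r i)" "(\<Sum>i\<in>UNIV. r i) \<le> M"
    and dissipation: "(\<Sum>i\<in>UNIV. (r i *\<^sub>R m i - h i *\<^sub>R n) \<bullet> u i)
      \<le> - (\<mu> * (\<Sum>i\<in>UNIV. r i) / \<epsilon>) * (\<Sum>i\<in>UNIV. r i * (norm (u i))\<^sup>2)"
    and pos: "0 < \<epsilon>" "0 < \<mu>" "0 < \<delta>" "\<delta> \<le> \<theta>" "\<delta> \<le> \<theta>'" "0 \<le> \<kappa>"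
    and n: "n = - gt /\<^sub>R \<theta>\<^sup>2"
    and bounds: "norm gt' \<le> B" "\<And>i. norm (k i) \<le> B"
    and growth: "(\<Sum>i\<in>UNIV. (h i - r i * \<mu>i i)\<^sup>2 / r i) \<le> E"
  shows "(inverse \<theta> *\<^sub>R gt' + \<theta>' *\<^sub>R n) \<bullet> (\<kappa> *\<^sub>R gt - (\<Sum>i\<in>UNIV. h i *\<^sub>R u i))
      - (\<Sum>i\<in>UNIV. (k i - (\<mu>i i / \<theta>) *\<^sub>R gt' - \<theta>' *\<^sub>R m i) \<bullet> (r i *\<^sub>R u i))
    \<le> \<kappa> * (B\<^sup>2 / (4 * \<delta>)) + \<epsilon> * ((2 * B\<^sup>2 / \<delta>\<^sup>2 * E + 2 * B\<^sup>2 * M) / (4 * (\<delta>\<^sup>2 * \<mu>)))"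
proof -
  let ?K = "\<Sum>i\<in>UNIV. r i * (norm (u i))\<^sup>2"
  define y where "y i = ((r i * \<mu>i i - h i) / \<theta>) *\<^sub>R gt' - r i *\<^sub>R k i" for i
  \<comment> \<open>Lower bound for \<open>\<theta>' \<mu> \<rho> / \<epsilon>\<close>, the coefficient of the dissipation.\<close>
  define a where "a = \<delta>\<^sup>2 * \<mu> / \<epsilon>"
  have a: "a > 0" using pos by (simp add: a_def)
  have \<theta>: "\<theta> > 0" "\<theta>' > 0" using pos by auto
  have B: "B \<ge> 0" using bounds(1) norm_ge_zero order_trans by blast
  have split: "(inverse \<theta> *\<^sub>R gt' + \<theta>' *\<^sub>R n) \<bullet> (\<kappa> *\<^sub>R gt - (\<Sum>i\<in>UNIV. h i *\<^sub>R u i))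
      - (\<Sum>i\<in>UNIV. (k i - (\<mu>i i / \<theta>) *\<^sub>R gt' - \<theta>' *\<^sub>R m i) \<bullet> (r i *\<^sub>R u i))
    = \<kappa> * ((inverse \<theta> *\<^sub>R gt' + \<theta>' *\<^sub>R n) \<bullet> gt) + \<theta>' * (\<Sum>i\<in>UNIV. (r i *\<^sub>R m i - h i *\<^sub>R n) \<bullet> u i) + (\<Sum>i\<in>UNIV. y i \<bullet> u i)"
  proof -
    have "- ((inverse \<theta> *\<^sub>R gt' + \<theta>' *\<^sub>R n) \<bullet> (h i *\<^sub>R u i)) - (k i - (\<mu>i i / \<theta>) *\<^sub>R gt' - \<theta>' *\<^sub>R m i) \<bullet> (r i *\<^sub>R u i)
        = \<theta>' * ((r i *\<^sub>R m i - h i *\<^sub>R n) \<bullet> u i) + y i \<bullet> u i" for i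
      using \<theta>(1) by (simp add: y_def inner_diff_left inner_add_left field_simps)
    then have "(\<Sum>i\<in>UNIV. - ((inverse \<theta> *\<^sub>R gt' + \<theta>' *\<^sub>R n) \<bullet> (h i *\<^sub>R u i)) - (k i - (\<mu>i i / \<theta>) *\<^sub>R gt' - \<theta>' *\<^sub>R m i) \<bullet> (r i *\<^sub>R u i))
        = (\<Sum>i\<in>UNIV. \<theta>' * ((r i *\<^sub>R m i - h i *\<^sub>R n) \<bullet> u i) + y i \<bullet> u i)"
      by (intro sum.cong refl)
    then show ?thesis
      unfolding inner_diff_right[of _ "\<kappa> *\<^sub>R gt"] inner_sum_right sum_subtractf sum.distrib sum_negf sum_distrib_left
      by simp
  qed
  \<comment> \<open>The coefficient of \<open>\<kappa>\<close>: a linear term minus \<open>\<theta>' |gt|\<^sup>2/\<theta>\<^sup>2\<close>.\<close>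
  have heat: "(inverse \<theta> *\<^sub>R gt' + \<theta>' *\<^sub>R n) \<bullet> gt \<le> B\<^sup>2 / (4 * \<delta>)"
  proof -
    have "n \<bullet> gt = - (norm (inverse \<theta> *\<^sub>R gt))\<^sup>2"
      unfolding n by (simp add: dot_square_norm power_mult_distrib power_inverse divide_inverse mult.commute)
    then have "(inverse \<theta> *\<^sub>R gt' + \<theta>' *\<^sub>R n) \<bullet> gt = gt' \<bullet> (inverse \<theta> *\<^sub>R gt) - \<theta>' * (1 * (norm (inverse \<theta> *\<^sub>R gt))\<^sup>2)"
      unfolding inner_add_left inner_scaleR_left inner_scaleR_right by simp
    also have "\<dots> \<le> (norm gt')\<^sup>2 / 1 / (4 * \<theta>')"
      using young_inner[of \<theta>' 1 gt' "inverse \<theta> *\<^sub>R gt"] \<theta> by simp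
    also have "\<dots> \<le> B\<^sup>2 / (4 * \<delta>)"
      using bounds(1) pos \<theta> B unfolding div_by_1 by (intro frac_le power_mono) auto
    finally show ?thesis .
  qed
  have "\<theta>' * (\<Sum>i\<in>UNIV. (r i *\<^sub>R m i - h i *\<^sub>R n) \<bullet> u i) \<le> \<theta>' * (- (\<mu> * (\<Sum>i\<in>UNIV. r i) / \<epsilon>) * ?K)"
    using dissipation \<theta>(2) by (intro mult_left_mono) auto
  also have "\<dots> = - (\<theta>' * (\<mu> * (\<Sum>i\<in>UNIV. r i) / \<epsilon>)) * ?K" by simp
  also have "\<dots> \<le> - a * ?K"
  proof -
    have "\<delta> * (\<mu> * \<delta> / \<epsilon>) \<le> \<theta>' * (\<mu> * (\<Sum>i\<in>UNIV. r i) / \<epsilon>)"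
      using pos R by (intro mult_mono divide_right_mono mult_left_mono) auto
    then have "a \<le> \<theta>' * (\<mu> * (\<Sum>i\<in>UNIV. r i) / \<epsilon>)" by (simp add: a_def power2_eq_square mult_ac)
    moreover have "?K \<ge> 0" using r by (intro sum_nonneg) (simp add: less_imp_le)
    ultimately show ?thesis unfolding mult_minus_left neg_le_iff_le by (rule mult_right_mono)
  qed
  finally have diss: "\<theta>' * (\<Sum>i\<in>UNIV. (r i *\<^sub>R m i - h i *\<^sub>R n) \<bullet> u i) \<le> - a * ?K" .
  have "(\<Sum>i\<in>UNIV. y i \<bullet> u i) \<le> (\<Sum>i\<in>UNIV. a * (r i * (norm (u i))\<^sup>2) + (norm (y i))\<^sup>2 / r i / (4 * a))"
    by (intro sum_mono young_inner a r)
  also have "\<dots> = a * ?K + (\<Sum>i\<in>UNIV. (norm (y i))\<^sup>2 / r i) / (4 * a)"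
    by (simp only: sum.distrib sum_distrib_left sum_divide_distrib)
  also have "(\<Sum>i\<in>UNIV. (norm (y i))\<^sup>2 / r i) \<le> (\<Sum>i\<in>UNIV. 2 * B\<^sup>2 / \<delta>\<^sup>2 * ((h i - r i * \<mu>i i)\<^sup>2 / r i) + 2 * B\<^sup>2 * r i)"
  proof (rule sum_mono)
    fix i
    let ?p = "((r i * \<mu>i i - h i) / \<theta>) *\<^sub>R gt'" and ?q = "r i *\<^sub>R k i"
    have "(norm (y i))\<^sup>2 \<le> 2 * (norm ?p)\<^sup>2 + 2 * (norm ?q)\<^sup>2"
    proof -
      have "(norm (?p - ?q))\<^sup>2 + (norm (?p + ?q))\<^sup>2 = 2 * (norm ?p)\<^sup>2 + 2 * (norm ?q)\<^sup>2"
        unfolding dot_square_norm[symmetric] inner_diff_left inner_diff_right inner_add_left inner_add_right by simp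
      moreover have "(norm (?p + ?q))\<^sup>2 \<ge> 0" by simp
      ultimately show ?thesis unfolding y_def by linarith
    qed
    moreover have "(norm ?p)\<^sup>2 \<le> (h i - r i * \<mu>i i)\<^sup>2 * (B\<^sup>2 / \<delta>\<^sup>2)"
    proof -
      have "(norm ?p)\<^sup>2 = (h i - r i * \<mu>i i)\<^sup>2 * ((norm gt')\<^sup>2 / \<theta>\<^sup>2)"
        by (simp add: power_mult_distrib power_divide power2_commute)
      also have "\<dots> \<le> (h i - r i * \<mu>i i)\<^sup>2 * (B\<^sup>2 / \<delta>\<^sup>2)"
        using bounds(1) pos B by (intro mult_left_mono frac_le power_mono) auto
      finally show ?thesis .
    qed
    moreover have "(norm ?q)\<^sup>2 \<le> (r i)\<^sup>2 * B\<^sup>2"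
      using bounds(2)[of i] B by (simp add: power_mult_distrib power_mono mult_left_mono)
    ultimately have "(norm (y i))\<^sup>2 \<le> 2 * ((h i - r i * \<mu>i i)\<^sup>2 * (B\<^sup>2 / \<delta>\<^sup>2)) + 2 * ((r i)\<^sup>2 * B\<^sup>2)" by linarith
    then have "(norm (y i))\<^sup>2 / r i \<le> (2 * ((h i - r i * \<mu>i i)\<^sup>2 * (B\<^sup>2 / \<delta>\<^sup>2)) + 2 * ((r i)\<^sup>2 * B\<^sup>2)) / r i"
      using r[of i] by (intro divide_right_mono) auto
    also have "\<dots> = 2 * B\<^sup>2 / \<delta>\<^sup>2 * ((h i - r i * \<mu>i i)\<^sup>2 / r i) + 2 * B\<^sup>2 * r i"
      using r[of i] by (simp add: add_divide_distrib power2_eq_square)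
    finally show "(norm (y i))\<^sup>2 / r i \<le> 2 * B\<^sup>2 / \<delta>\<^sup>2 * ((h i - r i * \<mu>i i)\<^sup>2 / r i) + 2 * B\<^sup>2 * r i" .
  qed
  also have "\<dots> = 2 * B\<^sup>2 / \<delta>\<^sup>2 * (\<Sum>i\<in>UNIV. (h i - r i * \<mu>i i)\<^sup>2 / r i) + 2 * B\<^sup>2 * (\<Sum>i\<in>UNIV. r i)"
    by (simp only: sum.distrib sum_distrib_left)
  also have "\<dots> \<le> 2 * B\<^sup>2 / \<delta>\<^sup>2 * E + 2 * B\<^sup>2 * M"
    using growth R(2) by (intro add_mono mult_left_mono) auto
  finally have "(\<Sum>i\<in>UNIV. y i \<bullet> u i) \<le> a * ?K + (2 * B\<^sup>2 / \<delta>\<^sup>2 * E + 2 * B\<^sup>2 * M) / (4 * a)"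
    using a by (simp add: divide_right_mono)
  also have "(2 * B\<^sup>2 / \<delta>\<^sup>2 * E + 2 * B\<^sup>2 * M) / (4 * a) = \<epsilon> * ((2 * B\<^sup>2 / \<delta>\<^sup>2 * E + 2 * B\<^sup>2 * M) / (4 * (\<delta>\<^sup>2 * \<mu>)))"
    unfolding a_def by simp
  finally have "(\<Sum>i\<in>UNIV. y i \<bullet> u i) \<le> a * ?K + \<epsilon> * ((2 * B\<^sup>2 / \<delta>\<^sup>2 * E + 2 * B\<^sup>2 * M) / (4 * (\<delta>\<^sup>2 * \<mu>)))" .
  moreover have "\<kappa> * ((inverse \<theta> *\<^sub>R gt' + \<theta>' *\<^sub>R n) \<bullet> gt) \<le> \<kappa> * (B\<^sup>2 / (4 * \<delta>))"
    using heat pos(6) by (rule mult_left_mono)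
  ultimately show ?thesis unfolding split using diss by simp
qed

section \<open>Gronwall's inequality\<close>

lemma gronwall:
  fixes f :: "real \<Rightarrow> real"
  assumes "0 \<le> C" "0 \<le> k" "0 \<le> f 0"
    and deriv: "\<And>t. t \<in> {0..T} \<Longrightarrow> (f has_vector_derivative f' t) (at t within {0..T})"
    and ineq: "\<And>t. t \<in> {0..T} \<Longrightarrow> f' t \<le> C * f t + k" and t: "0 < t" "t \<le> T"
  shows "f t \<le> exp (C * T) * (f 0 + k * T)"
proof -
  define g where "g s = exp (- C * s) * f s - k * s" for s
  define g' where "g' s = exp (- C * s) * (f' s - C * f s) - k" for s
  have g: "(g has_derivative (\<lambda>h. h * g' s)) (at s within {0..t})" if "0 \<le> s" "s \<le> t" for s
  proof -
    have "(f has_vector_derivative f' s) (at s within {0..t})"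
      by (rule has_vector_derivative_within_subset[OF deriv]) (use that t in auto)
    then have "(f has_real_derivative f' s) (at s within {0..t})"
      by (simp add: has_real_derivative_iff_has_vector_derivative)
    then have "(g has_real_derivative g' s) (at s within {0..t})"
      unfolding g_def[abs_def] g'_def by (auto intro!: derivative_eq_intros simp: algebra_simps)
    then show ?thesis by (simp add: has_field_derivative_def mult_commute_abs)
  qed
  obtain z where z: "z \<in> {0<..<t}" "g t - g 0 = (t - 0) * g' z"
    using mvt_simple[OF t(1), of g "\<lambda>s h. h * g' s"] g by auto
  have "exp (- C * z) * (f' z - C * f z) \<le> 1 * k"
  proof -
    have "exp (- C * z) * (f' z - C * f z) \<le> exp (- C * z) * k"
      using ineq[of z] z(1) t by (intro mult_left_mono) auto
    also have "\<dots> \<le> 1 * k"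
      using assms(1,2) z(1) by (intro mult_right_mono) auto
    finally show ?thesis .
  qed
  then have "(t - 0) * g' z \<le> 0" using t(1) by (intro mult_nonneg_nonpos) (auto simp: g'_def)
  then have "g t \<le> g 0" using z(2) by linarith
  then have "exp (- (C * t)) * f t \<le> f 0 + k * t" by (simp add: g_def)
  then have "exp (C * t) * (exp (- (C * t)) * f t) \<le> exp (C * t) * (f 0 + k * t)"
    by (rule mult_left_mono) simp
  moreover have "exp (C * t) * (exp (- (C * t)) * f t) = f t"
    by (simp add: exp_minus)
  ultimately have "f t \<le> exp (C * t) * (f 0 + k * t)" by simp
  also have "\<dots> \<le> exp (C * T) * (f 0 + k * T)"
    using assms(1-3) t by (intro mult_mono add_left_mono iffD2[OF exp_le_cancel_iff]) (auto intro: mult_left_mono)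
  finally show ?thesis .
qed

sublocale stable_thermodynamics \<subseteq> fluid_thermodynamics \<psi>
  by unfold_locales

section \<open>Production of the relative energy\<close>

context fluid_thermodynamics
begin

text \<open>The production terms that are present without diffusion; \<open>D'\<close> is the derivative of the limit flow
  along its own particle paths, \<open>B\<close> its space derivative in the direction of the velocity difference.\<close>

definition transport_production ::
    "'n unknown \<Rightarrow> 'n unknown \<Rightarrow> 'n unknown \<Rightarrow> 'n unknown \<Rightarrow> real^3 \<Rightarrow> real \<Rightarrow> real" where
  "transport_production w w' D' B g' d' =
      - total_mass (dens w) * ((vel w - vel w') \<bullet> vel B)
      + (total_mass (dens w) - total_mass (dens w')) / total_mass (dens w') * ((vel w - vel w') \<bullet> g')
      - (\<Sum>i\<in>UNIV. d\<mu> i (state_of w') (state_of B) * (dens w $ i - dens w' $ i))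
      - temp B * (rho_eta \<psi> (state_of w) - rho_eta \<psi> (state_of w'))
      - (pressure \<psi> (state_of w) - pressure \<psi> (state_of w')) * d'
      - (\<Sum>i\<in>UNIV. d\<mu> i (state_of w') (state_of D') * (dens w $ i - dens w' $ i))
      - temp D' * (rho_eta \<psi> (state_of w) - rho_eta \<psi> (state_of w'))"

text \<open>The last three terms are rewritten with \<open>first_order_cancellation\<close>, which leaves \<open>- d'\<close> times the Taylor remainder of the
pressure and \<open>- temp D'\<close> times that of the entropy.\<close>

lemma transport_production_bound:
  fixes w w' :: "'n unknown" and L :: real
  defines "h \<equiv> state_of w - state_of w'" and "u \<equiv> vel w - vel w'" and "\<omega>' \<equiv> state_of w'"
  assumes P: "\<omega>' \<in> phase_space"
    and mass': "\<And>i. dens D' $ i = - dens w' $ i * d'" and ent': "d\<eta> \<omega>' (state_of D') = - rho_eta \<psi> \<omega>' * d'"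
    and rho: "0 \<le> total_mass (dens w)" "total_mass (dens w) \<le> M" "0 < \<delta>" "\<delta> \<le> total_mass (dens w')"
    and B: "0 \<le> B" "norm (vel b) \<le> B * norm u" "\<bar>temp b\<bar> \<le> B * norm u" "\<And>i. \<bar>d\<mu> i \<omega>' (state_of b)\<bar> \<le> B * norm u"
      "norm g' \<le> B" "\<bar>d'\<bar> \<le> B" "\<bar>temp D'\<bar> \<le> B"
    and L: "0 \<le> L" "\<bar>pressure \<psi> (state_of w) - pressure \<psi> \<omega>' - der (pressure \<psi>) \<omega>' h\<bar> \<le> L * (norm h)\<^sup>2"
      "\<bar>rho_eta \<psi> (state_of w) - rho_eta \<psi> \<omega>' - d\<eta> \<omega>' h\<bar> \<le> L * (norm h)\<^sup>2"
      "\<bar>rho_eta \<psi> (state_of w) - rho_eta \<psi> \<omega>'\<bar> \<le> L * norm h"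
  shows "transport_production w w' D' b g' d'
    \<le> (M * B + real CARD('n) * B / \<delta> + real CARD('n) * B + 3 * B * L) * ((norm u)\<^sup>2 + (norm h)\<^sup>2)"
proof -
  define n where "n = real CARD('n)"
  have hi: "dens w $ i - dens w' $ i = fst h $ i" for i by (simp add: h_def)
  have hb: "\<bar>fst h $ i\<bar> \<le> norm h" for i
    using component_le_norm_cart[of "fst h" i] norm_fst_le[of "fst h" "snd h"] by simp
  have \<delta>M: "0 \<le> M" using rho by linarith
  define N where "N = (norm u)\<^sup>2 + (norm h)\<^sup>2"
  have N: "N \<ge> 0" "(norm u)\<^sup>2 \<le> N" "(norm h)\<^sup>2 \<le> N" by (auto simp: N_def)
  have uh: "norm u * norm h \<le> N"
  proof -
    have "2 * norm u * norm h \<le> (norm u)\<^sup>2 + (norm h)\<^sup>2" by (rule sum_squares_bound)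
    then show ?thesis using N(1) unfolding N_def by linarith
  qed
  have 1: "- total_mass (dens w) * (u \<bullet> vel b) \<le> M * B * N"
  proof -
    have "- (u \<bullet> vel b) \<le> norm u * (B * norm u)"
      using Cauchy_Schwarz_ineq2[of u "vel b"] mult_left_mono[OF B(2), of "norm u"] by auto
    then have "total_mass (dens w) * (- (u \<bullet> vel b)) \<le> total_mass (dens w) * (norm u * (B * norm u))"
      using rho(1) by (rule mult_left_mono)
    also have "\<dots> \<le> M * (norm u * (B * norm u))" using rho(2) B(1) by (intro mult_right_mono) auto
    also have "\<dots> = M * B * (norm u)\<^sup>2" by (simp add: power2_eq_square)
    also have "\<dots> \<le> M * B * N" using N(2) \<delta>M B(1) by (intro mult_left_mono) auto
    finally show ?thesis by simp
  qed
  have 2: "(total_mass (dens w) - total_mass (dens w')) / total_mass (dens w') * (u \<bullet> g') \<le> n * B / \<delta> * N"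
  proof -
    have "\<bar>total_mass (dens w) - total_mass (dens w')\<bar> = \<bar>\<Sum>i\<in>UNIV. fst h $ i\<bar>"
      by (simp add: total_mass_def sum_subtractf hi[symmetric])
    also have "\<dots> \<le> (\<Sum>i\<in>(UNIV::'n set). norm h)" unfolding real_norm_def[symmetric] using hb by (intro sum_norm_le) auto
    also have "\<dots> = n * norm h" by (simp add: n_def)
    finally have "\<bar>(total_mass (dens w) - total_mass (dens w')) / total_mass (dens w')\<bar> \<le> n * norm h / \<delta>"
      unfolding abs_divide using rho by (intro frac_le) auto
    moreover have "\<bar>u \<bullet> g'\<bar> \<le> norm u * B"
      using Cauchy_Schwarz_ineq2[of u g'] mult_left_mono[OF B(5), of "norm u"] by auto
    ultimately have "\<bar>(total_mass (dens w) - total_mass (dens w')) / total_mass (dens w')\<bar> * \<bar>u \<bullet> g'\<bar> \<le> (n * norm h / \<delta>) * (norm u * B)"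
      using rho(3) by (intro mult_mono) (auto simp: n_def)
    also have "\<dots> = n * B / \<delta> * (norm u * norm h)" by simp
    also have "\<dots> \<le> n * B / \<delta> * N" using uh B(1) rho(3) by (intro mult_left_mono) (auto simp: n_def)
    finally show ?thesis unfolding abs_mult[symmetric] by linarith
  qed
  have 3: "- (\<Sum>i\<in>UNIV. d\<mu> i \<omega>' (state_of b) * fst h $ i) \<le> n * B * N"
  proof -
    have "\<bar>\<Sum>i\<in>UNIV. d\<mu> i \<omega>' (state_of b) * fst h $ i\<bar> \<le> (\<Sum>i\<in>(UNIV::'n set). (B * norm u) * norm h)"
      unfolding real_norm_def[symmetric] using B(1,4) hb
      by (intro sum_norm_le) (auto simp: abs_mult intro!: mult_mono)
    also have "\<dots> = n * B * (norm u * norm h)" by (simp add: n_def)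
    also have "\<dots> \<le> n * B * N" using uh B(1) by (intro mult_left_mono) (auto simp: n_def)
    finally show ?thesis by linarith
  qed
  have 4: "- (temp b * (rho_eta \<psi> (state_of w) - rho_eta \<psi> \<omega>')) \<le> B * L * N"
  proof -
    have "\<bar>temp b * (rho_eta \<psi> (state_of w) - rho_eta \<psi> \<omega>')\<bar> \<le> (B * norm u) * (L * norm h)"
      unfolding abs_mult using B(1,3) L(4) by (intro mult_mono) auto
    also have "\<dots> = B * L * (norm u * norm h)" by simp
    also have "\<dots> \<le> B * L * N" using uh B(1) L(1) by (intro mult_left_mono) auto
    finally show ?thesis by linarith
  qed
  have p': "der (pressure \<psi>) \<omega>' h
      = (\<Sum>i\<in>UNIV. fst \<omega>' $ i * d\<mu> i \<omega>' h) + rho_eta \<psi> \<omega>' * snd h"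
    by (simp only: frechet_derivative_at[OF pressure_derivative[OF P], symmetric])
  have "(\<Sum>i\<in>UNIV. d\<mu> i \<omega>' (state_of D') * fst h $ i)
    = - d' * der (pressure \<psi>) \<omega>' h - temp D' * d\<eta> \<omega>' h"
    unfolding p'
    using first_order_cancellation[OF P, of "state_of D'" d' h] mass' ent' by (simp add: \<omega>'_def)
  then have "- (pressure \<psi> (state_of w) - pressure \<psi> \<omega>') * d' - (\<Sum>i\<in>UNIV. d\<mu> i \<omega>' (state_of D') * fst h $ i)
      - temp D' * (rho_eta \<psi> (state_of w) - rho_eta \<psi> \<omega>')
    = - (d' * (pressure \<psi> (state_of w) - pressure \<psi> \<omega>' - der (pressure \<psi>) \<omega>' h))
      - temp D' * (rho_eta \<psi> (state_of w) - rho_eta \<psi> \<omega>' - d\<eta> \<omega>' h)"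
    by (simp add: algebra_simps)
  also have "\<dots> \<le> B * (L * (norm h)\<^sup>2) + B * (L * (norm h)\<^sup>2)"
  proof -
    have "\<bar>d' * (pressure \<psi> (state_of w) - pressure \<psi> \<omega>' - der (pressure \<psi>) \<omega>' h)\<bar> \<le> B * (L * (norm h)\<^sup>2)"
      unfolding abs_mult using B(1,6) L(2) by (intro mult_mono) auto
    moreover have "\<bar>temp D' * (rho_eta \<psi> (state_of w) - rho_eta \<psi> \<omega>' - d\<eta> \<omega>' h)\<bar> \<le> B * (L * (norm h)\<^sup>2)"
      unfolding abs_mult using B(1,7) L(3) by (intro mult_mono) auto
    ultimately show ?thesis by linarith
  qed
  also have "\<dots> = 2 * B * L * (norm h)\<^sup>2" by simp
  also have "\<dots> \<le> 2 * B * L * N" using N(3) B(1) L(1) by (intro mult_left_mono) auto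
  finally have 5: "- (pressure \<psi> (state_of w) - pressure \<psi> \<omega>') * d' - (\<Sum>i\<in>UNIV. d\<mu> i \<omega>' (state_of D') * fst h $ i)
      - temp D' * (rho_eta \<psi> (state_of w) - rho_eta \<psi> \<omega>') \<le> 2 * B * L * N" .
  have "transport_production w w' D' b g' d' \<le> M * B * N + n * B / \<delta> * N + n * B * N + B * L * N + 2 * B * L * N"
    using 1 2 3 4 5 unfolding transport_production_def \<omega>'_def[symmetric] u_def[symmetric] hi by linarith
  also have "\<dots> = (M * B + n * B / \<delta> + n * B + 3 * B * L) * N" by (simp add: algebra_simps)
  finally show ?thesis by (simp add: N_def n_def)
qed

text \<open>The total flux of the relative energy: transport, work of the pressure difference, and the diffusive fluxes with the
weights \<open>1 - \<theta>'/\<theta>\<close> and \<open>\<mu>'\<^sub>i - \<theta>' \<mu>\<^sub>i/\<theta>\<close> with which their divergences enter the balance of the relative energy.\<close>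

definition rel_flux :: "(real^3 \<Rightarrow> 'n unknown) \<Rightarrow> (real^3 \<Rightarrow> 'n unknown) \<Rightarrow>
    ('n \<Rightarrow> real^3 \<Rightarrow> real^3) \<Rightarrow> (real^3 \<Rightarrow> real^3) \<Rightarrow> real^3 \<Rightarrow> real^3" where
  "rel_flux W V J q x = rel_I \<psi> (W x) (V x) *\<^sub>R vel (W x)
     + (pressure \<psi> (state_of (W x)) - pressure \<psi> (state_of (V x))) *\<^sub>R (vel (W x) - vel (V x))
     - (1 - temp (V x) / temp (W x)) *\<^sub>R q x
     - (\<Sum>i\<in>UNIV. (chem_pot \<psi> (state_of (V x)) $ i - temp (V x) * (chem_pot \<psi> (state_of (W x)) $ i / temp (W x))) *\<^sub>R J i x)"

lemma unknown_derivatives: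
  assumes W: "(W has_derivative A) (at x)" and P: "state_of (W x) \<in> phase_space"
  shows "((\<lambda>x. vel (W x)) has_derivative (\<lambda>h. vel (A h))) (at x)"
    and "((\<lambda>x. temp (W x)) has_derivative (\<lambda>h. temp (A h))) (at x)"
    and "((\<lambda>x. pressure \<psi> (state_of (W x))) has_derivative (\<lambda>h. der (pressure \<psi>) (state_of (W x)) (state_of (A h)))) (at x)"
    and "((\<lambda>x. chem_pot \<psi> (state_of (W x)) $ i) has_derivative (\<lambda>h. d\<mu> i (state_of (W x)) (state_of (A h)))) (at x)"
proof -
  show "((\<lambda>x. vel (W x)) has_derivative (\<lambda>h. vel (A h))) (at x)"
    "((\<lambda>x. temp (W x)) has_derivative (\<lambda>h. temp (A h))) (at x)"
    by (rule bounded_linear.has_derivative[OF bounded_linear_vel W] bounded_linear.has_derivative[OF bounded_linear_temp W])+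
  have S: "((\<lambda>x. state_of (W x)) has_derivative (\<lambda>h. state_of (A h))) (at x)"
    by (rule bounded_linear.has_derivative[OF bounded_linear_state_of W])
  show "((\<lambda>x. pressure \<psi> (state_of (W x))) has_derivative (\<lambda>h. der (pressure \<psi>) (state_of (W x)) (state_of (A h)))) (at x)"
    by (rule has_derivative_compose[OF S Ck_on_has_derivative[OF pressure_C1[unfolded One_nat_def] P]])
  show "((\<lambda>x. chem_pot \<psi> (state_of (W x)) $ i) has_derivative (\<lambda>h. d\<mu> i (state_of (W x)) (state_of (A h)))) (at x)"
    by (rule has_derivative_compose[OF S chem_pot_derivative[OF P]])
qed

lemma diver_rel_flux:
  assumes W: "(W has_derivative A) (at x)" and V: "(V has_derivative A') (at x)"
    and P: "state_of (W x) \<in> phase_space" "state_of (V x) \<in> phase_space"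
    and J: "\<And>i. J i differentiable (at x)" and q: "q differentiable (at x)"
  shows "diver (rel_flux W V J q) x
    = rel_I \<psi> (W x) (V x) * diver (\<lambda>x. vel (W x)) x + rel_I_deriv (W x) (V x) (A (vel (W x))) (A' (vel (W x)))
      + (pressure \<psi> (state_of (W x)) - pressure \<psi> (state_of (V x))) * (diver (\<lambda>x. vel (W x)) x - diver (\<lambda>x. vel (V x)) x)
      + (grad (\<lambda>x. pressure \<psi> (state_of (W x))) x - grad (\<lambda>x. pressure \<psi> (state_of (V x))) x) \<bullet> (vel (W x) - vel (V x))
      - (1 - temp (V x) / temp (W x)) * diver q x
      + (inverse (temp (W x)) *\<^sub>R grad (\<lambda>x. temp (V x)) x + temp (V x) *\<^sub>R grad (\<lambda>x. 1 / temp (W x)) x) \<bullet> q x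
      - (\<Sum>i\<in>UNIV. (chem_pot \<psi> (state_of (V x)) $ i - temp (V x) * (chem_pot \<psi> (state_of (W x)) $ i / temp (W x))) * diver (J i) x)
      - (\<Sum>i\<in>UNIV. (grad (\<lambda>x. chem_pot \<psi> (state_of (V x)) $ i) x
          - (chem_pot \<psi> (state_of (W x)) $ i / temp (W x)) *\<^sub>R grad (\<lambda>x. temp (V x)) x
          - temp (V x) *\<^sub>R grad (\<lambda>x. chem_pot \<psi> (state_of (W x)) $ i / temp (W x)) x) \<bullet> J i x)"
proof -
  note dW = unknown_derivatives[OF W P(1)] and dV = unknown_derivatives[OF V P(2)]
  have \<theta>: "temp (W x) \<noteq> 0" using P(1) by (auto simp: mem_phase_space)
  have grads: "((\<lambda>x. f x) has_derivative (\<lambda>h. grad f x \<bullet> h)) (at x)" if "(f has_derivative f') (at x)" for f f'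
    using that grad_eq[OF that] by simp
  have inv: "((\<lambda>x. 1 / temp (W x)) has_derivative (\<lambda>h. grad (\<lambda>x. 1 / temp (W x)) x \<bullet> h)) (at x)"
    by (rule grads[OF has_derivative_divide[OF has_derivative_const dW(2) \<theta>]])
  have mu_th: "((\<lambda>x. chem_pot \<psi> (state_of (W x)) $ i / temp (W x)) has_derivative
      (\<lambda>h. grad (\<lambda>x. chem_pot \<psi> (state_of (W x)) $ i / temp (W x)) x \<bullet> h)) (at x)" for i
    by (rule grads[OF has_derivative_divide[OF dW(4) dW(2) \<theta>]])
  have lam: "((\<lambda>x. 1 - temp (V x) / temp (W x)) has_derivative
      (\<lambda>h. - ((inverse (temp (W x)) *\<^sub>R grad (\<lambda>x. temp (V x)) x + temp (V x) *\<^sub>R grad (\<lambda>x. 1 / temp (W x)) x) \<bullet> h))) (at x)"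
  proof -
    have "((\<lambda>x. 1 - temp (V x) * (1 / temp (W x))) has_derivative
      (\<lambda>h. 0 - (temp (V x) * (grad (\<lambda>x. 1 / temp (W x)) x \<bullet> h) + (grad (\<lambda>x. temp (V x)) x \<bullet> h) * (1 / temp (W x))))) (at x)"
      by (intro has_derivative_diff has_derivative_const has_derivative_mult grads[OF dV(2)] inv)
    then show ?thesis by (simp add: inner_add_left divide_inverse mult.commute add.commute)
  qed
  have lami: "((\<lambda>x. chem_pot \<psi> (state_of (V x)) $ i - temp (V x) * (chem_pot \<psi> (state_of (W x)) $ i / temp (W x))) has_derivative
      (\<lambda>h. (grad (\<lambda>x. chem_pot \<psi> (state_of (V x)) $ i) x
          - (chem_pot \<psi> (state_of (W x)) $ i / temp (W x)) *\<^sub>R grad (\<lambda>x. temp (V x)) x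
          - temp (V x) *\<^sub>R grad (\<lambda>x. chem_pot \<psi> (state_of (W x)) $ i / temp (W x)) x) \<bullet> h)) (at x)" for i
  proof -
    have "((\<lambda>x. chem_pot \<psi> (state_of (V x)) $ i - temp (V x) * (chem_pot \<psi> (state_of (W x)) $ i / temp (W x))) has_derivative
      (\<lambda>h. grad (\<lambda>x. chem_pot \<psi> (state_of (V x)) $ i) x \<bullet> h
        - (temp (V x) * (grad (\<lambda>x. chem_pot \<psi> (state_of (W x)) $ i / temp (W x)) x \<bullet> h)
          + (grad (\<lambda>x. temp (V x)) x \<bullet> h) * (chem_pot \<psi> (state_of (W x)) $ i / temp (W x))))) (at x)"
      by (intro has_derivative_diff has_derivative_mult grads[OF dV(2)] grads[OF dV(4)] mu_th)
    then show ?thesis by (rule has_derivative_eq_rhs) (simp add: fun_eq_iff inner_diff_left)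
  qed
  have I: "((\<lambda>x. rel_I \<psi> (W x) (V x)) has_derivative (\<lambda>h. rel_I_deriv (W x) (V x) (A h) (A' h))) (at x)"
    using has_derivative_compose[OF has_derivative_Pair[OF W V] rel_I_derivative[OF P]] by simp
  have pp: "((\<lambda>x. pressure \<psi> (state_of (W x)) - pressure \<psi> (state_of (V x))) has_derivative
      (\<lambda>h. (grad (\<lambda>x. pressure \<psi> (state_of (W x))) x - grad (\<lambda>x. pressure \<psi> (state_of (V x))) x) \<bullet> h)) (at x)"
    unfolding inner_diff_left by (intro has_derivative_diff grads[OF dW(3)] grads[OF dV(3)])
  have v: "(\<lambda>x. vel (W x)) differentiable (at x)" "(\<lambda>x. vel (V x)) differentiable (at x)"
    using dW(1) dV(1) by (auto simp: differentiable_def)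
  have dv: "diver (\<lambda>x. vel (W x) - vel (V x)) x = diver (\<lambda>x. vel (W x)) x - diver (\<lambda>x. vel (V x)) x"
    by (rule diver_diff[OF v])
  let ?F1 = "\<lambda>x. rel_I \<psi> (W x) (V x) *\<^sub>R vel (W x)"
  let ?F2 = "\<lambda>x. (pressure \<psi> (state_of (W x)) - pressure \<psi> (state_of (V x))) *\<^sub>R (vel (W x) - vel (V x))"
  let ?F3 = "\<lambda>x. (1 - temp (V x) / temp (W x)) *\<^sub>R q x"
  let ?F4 = "\<lambda>i x. (chem_pot \<psi> (state_of (V x)) $ i - temp (V x) * (chem_pot \<psi> (state_of (W x)) $ i / temp (W x))) *\<^sub>R J i x"
  have F: "?F1 differentiable (at x)" "?F2 differentiable (at x)" "?F3 differentiable (at x)" "?F4 i differentiable (at x)" for i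
    by (rule differentiable_scaleR[OF differentiableI[OF I] v(1)]
        differentiable_scaleR[OF differentiableI[OF pp] differentiable_diff[OF v]]
        differentiable_scaleR[OF differentiableI[OF lam] q]
        differentiable_scaleR[OF differentiableI[OF lami] J])+
  have F4: "(\<lambda>x. \<Sum>i\<in>UNIV. ?F4 i x) differentiable (at x)"
    by (intro differentiable_sum F(4) finite ballI)
  have "diver (rel_flux W V J q) x = diver (\<lambda>x. ?F1 x + ?F2 x - ?F3 x) x - diver (\<lambda>x. \<Sum>i\<in>UNIV. ?F4 i x) x"
    unfolding rel_flux_def[abs_def]
    by (rule diver_diff[OF differentiable_diff[OF differentiable_add[OF F(1,2)] F(3)] F4])
  also have "diver (\<lambda>x. ?F1 x + ?F2 x - ?F3 x) x = diver (\<lambda>x. ?F1 x + ?F2 x) x - diver ?F3 x"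
    by (rule diver_diff[OF differentiable_add[OF F(1,2)] F(3)])
  also have "diver (\<lambda>x. ?F1 x + ?F2 x) x = diver ?F1 x + diver ?F2 x"
    by (rule diver_add[OF F(1,2)])
  also have "diver (\<lambda>x. \<Sum>i\<in>UNIV. ?F4 i x) x = (\<Sum>i\<in>UNIV. diver (?F4 i) x)"
    by (rule diver_sum[OF F(4)])
  also have "diver ?F1 x = rel_I \<psi> (W x) (V x) * diver (\<lambda>x. vel (W x)) x + rel_I_deriv (W x) (V x) (A (vel (W x))) (A' (vel (W x)))"
    by (rule diver_scaleR[OF I v(1)])
  also have "diver ?F2 x = (pressure \<psi> (state_of (W x)) - pressure \<psi> (state_of (V x))) * (diver (\<lambda>x. vel (W x)) x - diver (\<lambda>x. vel (V x)) x)
      + (grad (\<lambda>x. pressure \<psi> (state_of (W x))) x - grad (\<lambda>x. pressure \<psi> (state_of (V x))) x) \<bullet> (vel (W x) - vel (V x))"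
    unfolding dv[symmetric] by (rule diver_scaleR[OF pp differentiable_diff[OF v]])
  also have "diver ?F3 x = (1 - temp (V x) / temp (W x)) * diver q x
      + - ((inverse (temp (W x)) *\<^sub>R grad (\<lambda>x. temp (V x)) x + temp (V x) *\<^sub>R grad (\<lambda>x. 1 / temp (W x)) x) \<bullet> q x)"
    by (rule diver_scaleR[OF lam q])
  also have "(\<lambda>i. diver (?F4 i) x) = (\<lambda>i. (chem_pot \<psi> (state_of (V x)) $ i - temp (V x) * (chem_pot \<psi> (state_of (W x)) $ i / temp (W x))) * diver (J i) x
      + (grad (\<lambda>x. chem_pot \<psi> (state_of (V x)) $ i) x
          - (chem_pot \<psi> (state_of (W x)) $ i / temp (W x)) *\<^sub>R grad (\<lambda>x. temp (V x)) x
          - temp (V x) *\<^sub>R grad (\<lambda>x. chem_pot \<psi> (state_of (W x)) $ i / temp (W x)) x) \<bullet> J i x)"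
    by (intro ext diver_scaleR lami J)
  finally show ?thesis by (simp only: sum.distrib diff_diff_eq minus_add_distrib diff_conv_add_uminus add.assoc minus_minus)
qed

lemma linear_rel_I_deriv:
  assumes "state_of w \<in> phase_space" "state_of w' \<in> phase_space"
  shows "rel_I_deriv w w' (a + c) (a' + c') = rel_I_deriv w w' a a' + rel_I_deriv w w' c c'"
  using linear_add[OF has_derivative_linear[OF rel_I_derivative[OF assms]], of "(a, a')" "(c, c')"] by simp

text \<open>Both flows in the form of \<open>primitive_form\<close>, inserted into \<open>relative_energy_identity\<close>.  The sources there are the
divergences of \<open>q\<close> and \<open>- J i\<close>; with the diffusive part of the flux they combine to the fluxes tested with the gradients
of their weights.\<close>

lemma relative_energy_production:
  fixes W V :: "'n flow" and J :: "'n \<Rightarrow> real^3 \<Rightarrow> real^3" and q :: "real^3 \<Rightarrow> real^3"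
  assumes P: "state_of (W t x) \<in> phase_space" "state_of (V t x) \<in> phase_space"
    and nb: "at t within I \<noteq> bot" "at t within I' \<noteq> bot"
    and a: "((\<lambda>s. W s x) has_vector_derivative a) (at t within I)"
    and a': "((\<lambda>s. V s x) has_vector_derivative a') (at t within I')"
    and A: "(W t has_derivative A) (at x)" and A': "(V t has_derivative A') (at x)"
    and J: "\<And>i. J i differentiable (at x)" "(\<Sum>i\<in>UNIV. diver (J i) x) = 0" and q: "q differentiable (at x)"
    and W: "\<And>i. dt I (\<lambda>t x. dens (W t x) $ i) t x
             + diver (\<lambda>x. dens (W t x) $ i *\<^sub>R vel (W t x)) x = - diver (J i) x"
        "dt I (\<lambda>t x. momentum (W t x)) t x + tensor_diver (\<lambda>x. momentum_flux \<psi> (W t x)) x = 0"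
        "dt I (\<lambda>t x. energy \<psi> (W t x)) t x + diver (\<lambda>x. energy_flux \<psi> (W t x)) x = diver q x"
    and V: "\<And>i. dt I' (\<lambda>t x. dens (V t x) $ i) t x
             + diver (\<lambda>x. dens (V t x) $ i *\<^sub>R vel (V t x)) x = 0"
        "dt I' (\<lambda>t x. momentum (V t x)) t x + tensor_diver (\<lambda>x. momentum_flux \<psi> (V t x)) x = 0"
        "dt I' (\<lambda>t x. energy \<psi> (V t x)) t x + diver (\<lambda>x. energy_flux \<psi> (V t x)) x = 0"
  defines "w \<equiv> W t x" and "w' \<equiv> V t x"
  defines "D' \<equiv> a' + A' (vel w')" and "b \<equiv> A' (vel w - vel w')"
    and "g' \<equiv> grad (\<lambda>x. pressure \<psi> (state_of (V t x))) x" and "d' \<equiv> diver (\<lambda>x. vel (V t x)) x"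
  shows "rel_I_deriv w w' a a' + diver (rel_flux (W t) (V t) J q) x
    = transport_production w w' D' b g' d'
      + (inverse (temp w) *\<^sub>R grad (\<lambda>x. temp (V t x)) x + temp w' *\<^sub>R grad (\<lambda>x. 1 / temp (W t x)) x) \<bullet> q x
      - (\<Sum>i\<in>UNIV. (grad (\<lambda>x. chem_pot \<psi> (state_of (V t x)) $ i) x
          - (chem_pot \<psi> (state_of w) $ i / temp w) *\<^sub>R grad (\<lambda>x. temp (V t x)) x
          - temp w' *\<^sub>R grad (\<lambda>x. chem_pot \<psi> (state_of (W t x)) $ i / temp (W t x)) x) \<bullet> J i x)"
    and "dens D' $ i = - dens w' $ i * d'" and "d\<eta> (state_of w') (state_of D') = - rho_eta \<psi> (state_of w') * d'"
proof -
  have s: "(\<Sum>i\<in>UNIV. - diver (J i) x) = 0" using J(2) by (simp add: sum_negf)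
  note pW = primitive_form[OF P(1) nb(1) a A W(1) s W(2,3), folded w_def]
  note pV = primitive_form[OF P(2) nb(2) a' A' V(1) sum.neutral_const V(2,3), folded w'_def]
  have pos: "0 < temp w" "0 < temp w'" using P by (auto simp: mem_phase_space w_def w'_def)
  have r: "0 < total_mass (dens w')"
    using P(2) unfolding total_mass_def w'_def by (intro sum_pos) (auto simp: mem_phase_space)
  show "dens D' $ i = - dens w' $ i * d'" using pV(1)[of i] by (simp add: D'_def d'_def)
  have "temp w' * d\<eta> (state_of w') (state_of D') = temp w' * (- rho_eta \<psi> (state_of w') * d')"
    using pV(4) by (simp add: D'_def d'_def)
  then show "d\<eta> (state_of w') (state_of D') = - rho_eta \<psi> (state_of w') * d'"
    using pos(2) by (simp only: mult_cancel_left) simp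
  have A'lin: "a' + A' (vel w) = D' + b"
    unfolding D'_def b_def using linear_diff[OF has_derivative_linear[OF A']] by simp
  have lin: "d\<mu> i (state_of w') (state_of (D' + b)) = d\<mu> i (state_of w') (state_of D') + d\<mu> i (state_of w') (state_of b)" for i
    using linear_add[OF linear_d\<mu>[OF P(2)]] by (simp add: w'_def)
  have conv: "(\<Sum>i\<in>UNIV. (chem_pot \<psi> (state_of w') $ i - temp w' * chem_pot \<psi> (state_of w) $ i / temp w) * - diver (J i) x)
    = - (\<Sum>i\<in>UNIV. (chem_pot \<psi> (state_of w') $ i - temp w' * (chem_pot \<psi> (state_of w) $ i / temp w)) * diver (J i) x)"
    by (simp add: sum_negf)
  note id = relative_energy_identity[OF pos(1) r pW pV(3)[folded D'_def g'_def] lin, of d', folded transport_production_def]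
  note div = diver_rel_flux[of "W t" A x "V t" A' J q, OF A A' P J(1) q, folded w_def w'_def g'_def d'_def]
  have lin2: "rel_I_deriv w w' (a + A (vel w)) (D' + b) = rel_I_deriv w w' a a' + rel_I_deriv w w' (A (vel w)) (A' (vel w))"
    unfolding A'lin[symmetric] by (rule linear_rel_I_deriv) (use P in \<open>auto simp: w_def w'_def\<close>)
  have combine: "r + dv = tp + lq - T"
    if "r + ra + I + P + U = tp + qd * l - (- S)" "dv = I + ra + P + U - l * qd + lq - S - T"
    for r ra I P U tp qd l lq S T dv :: real
    using that by (simp add: algebra_simps)
  show "rel_I_deriv w w' a a' + diver (rel_flux (W t) (V t) J q) x
    = transport_production w w' D' b g' d'
      + (inverse (temp w) *\<^sub>R grad (\<lambda>x. temp (V t x)) x + temp w' *\<^sub>R grad (\<lambda>x. 1 / temp (W t x)) x) \<bullet> q x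
      - (\<Sum>i\<in>UNIV. (grad (\<lambda>x. chem_pot \<psi> (state_of (V t x)) $ i) x
          - (chem_pot \<psi> (state_of w) $ i / temp w) *\<^sub>R grad (\<lambda>x. temp (V t x)) x
          - temp w' *\<^sub>R grad (\<lambda>x. chem_pot \<psi> (state_of (W t x)) $ i / temp (W t x)) x) \<bullet> J i x)"
    by (rule combine[OF id[unfolded lin2 conv] div])
qed

end

section \<open>Bounds for classical flows\<close>

lemma norm_components_le:
  "norm (vel a) \<le> norm a" "\<bar>temp a\<bar> \<le> norm a" "norm (state_of a) \<le> norm a"
proof -
  obtain r v \<theta> where a: "a = (r, v, \<theta>)" by (metis surj_pair)
  show "norm (vel a) \<le> norm a" "\<bar>temp a\<bar> \<le> norm a" "norm (state_of a) \<le> norm a"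
    by (auto simp: a vel_def temp_def state_of_def dens_def norm_Pair intro!: real_le_rsqrt)
qed

lemma grad_norm_le:
  assumes "(f has_derivative f') (at x)" "\<And>h. \<bar>f' h\<bar> \<le> C * norm h" "0 \<le> C"
  shows "norm (grad f x) \<le> C"
proof (cases "grad f x = 0")
  case False
  have "norm (grad f x) * norm (grad f x) = f' (grad f x)"
    using grad_eq[OF assms(1), of "grad f x"] by (simp add: dot_square_norm power2_eq_square)
  also have "\<dots> \<le> C * norm (grad f x)" using assms(2)[of "grad f x"] by simp
  finally show ?thesis using False by simp
qed (use assms(3) in simp)

lemma C1_space_time_bounds:
  fixes V :: "'n::finite flow"
  assumes "C1_space_time I V" "{0..T} \<subseteq> I"
  shows "\<exists>B\<ge>0. \<forall>t\<in>{0..T}. \<forall>x\<in>cell. norm (V t x) \<le> B \<and> norm (dt I V t x) \<le> B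
    \<and> (\<forall>h. norm (der (V t) x h) \<le> B * norm h)"
proof -
  let ?X = "{0..T} \<times> cell"
  have compact: "compact ?X" by (intro compact_Times compact_Icc compact_cbox)
  have sub: "?X \<subseteq> I \<times> UNIV" using assms(2) by auto
  have cont: "continuous_on ?X (\<lambda>(t, x). V t x)" "continuous_on ?X (\<lambda>(t, x). dt I V t x)"
    "continuous_on ?X (\<lambda>(t, x). der (V t) x h)" for h
    using assms(1) unfolding C1_space_time_def C1_space_def by (auto intro: continuous_on_subset[OF _ sub])
  have bounded: "\<exists>C\<ge>0. \<forall>z\<in>?X. norm (f z) \<le> C" if "continuous_on ?X f" for f :: "real \<times> (real^3) \<Rightarrow> 'n unknown"
  proof -
    have "bounded (f ` ?X)" by (rule compact_imp_bounded[OF compact_continuous_image[OF that compact]])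
    then obtain C where "\<forall>z\<in>?X. norm (f z) \<le> C" unfolding bounded_iff by blast
    then show ?thesis by (intro exI[of _ "max C 0"]) (auto simp: le_max_iff_disj)
  qed
  obtain C1 where C1: "C1 \<ge> 0" "\<And>t x. t \<in> {0..T} \<Longrightarrow> x \<in> cell \<Longrightarrow> norm (V t x) \<le> C1"
    using bounded[OF cont(1)] by fastforce
  obtain C2 where C2: "C2 \<ge> 0" "\<And>t x. t \<in> {0..T} \<Longrightarrow> x \<in> cell \<Longrightarrow> norm (dt I V t x) \<le> C2"
    using bounded[OF cont(2)] by fastforce
  have "\<forall>b. \<exists>C\<ge>0. \<forall>t\<in>{0..T}. \<forall>x\<in>cell. norm (der (V t) x b) \<le> C"
    using bounded[OF cont(3)] by fastforce
  then obtain C3 where C3: "\<And>b. C3 b \<ge> 0"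
    "\<And>b t x. t \<in> {0..T} \<Longrightarrow> x \<in> cell \<Longrightarrow> norm (der (V t) x b) \<le> C3 b" by metis
  define B where "B = C1 + C2 + (\<Sum>b\<in>Basis. C3 b)"
  have s: "0 \<le> (\<Sum>b\<in>Basis. C3 b)" using C3(1) by (intro sum_nonneg)
  have "norm (der (V t) x h) \<le> B * norm h" if t: "t \<in> {0..T}" "x \<in> cell" for t x h
  proof -
    have d: "V t differentiable (at x)" using assms t unfolding C1_space_time_def C1_space_def by auto
    have "norm (der (V t) x h) \<le> (\<Sum>b\<in>Basis. norm h * C3 b)"
      unfolding frechet_derivative_basis_sum[OF d, of h] using C3 t
      by (intro sum_norm_le) (auto intro!: mult_mono Basis_le_norm)
    also have "\<dots> = norm h * (\<Sum>b\<in>Basis. C3 b)" by (simp add: sum_distrib_left)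
    also have "\<dots> \<le> norm h * B" using C1(1) C2(1) by (intro mult_left_mono) (auto simp: B_def)
    finally show ?thesis by (simp add: mult.commute)
  qed
  moreover have "norm (V t x) \<le> B" "norm (dt I V t x) \<le> B" if "t \<in> {0..T}" "x \<in> cell" for t x
    using C1(1) C1(2)[OF that] C2(1) C2(2)[OF that] s by (auto simp: B_def)
  moreover have "B \<ge> 0" using C1(1) C2(1) s by (simp add: B_def)
  ultimately show ?thesis by blast
qed

text \<open>One-sided derivatives at the end points of the time interval are unique.\<close>

lemma at_within_Icc_neq_bot:
  fixes t T :: real
  assumes "0 < T" "t \<in> {0..T}" "{0..T} \<subseteq> I"
  shows "at t within I \<noteq> bot"
proof -
  have "{0..T} \<noteq> {t}" using assms(1) by (metis atLeastAtMost_singleton_iff less_irrefl)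
  then have "t islimpt {0..T}" using assms(2) connected_imp_perfect[of "{0..T}" t] by auto
  then have "t islimpt I" using assms(3) islimpt_subset by blast
  then show ?thesis by (simp add: trivial_limit_within)
qed

lemma frechet_derivative_periodic:
  fixes f :: "'a::real_normed_vector \<Rightarrow> 'b::real_normed_vector"
  assumes "\<And>x. f (x + a) = f x" "f differentiable (at (x + a))"
  shows "der f (x + a) = der f x"
proof -
  have "(f has_derivative der f (x + a)) (at (x + a))"
    using assms(2) by (simp add: frechet_derivative_works)
  moreover have "((\<lambda>y. y + a) has_derivative (\<lambda>h. h)) (at x)"
    by (auto intro!: derivative_eq_intros)
  ultimately have "((\<lambda>y. f (y + a)) has_derivative der f (x + a)) (at x)"
    by (rule has_derivative_compose[rotated])
  then show ?thesis unfolding assms(1) by (rule frechet_derivative_at)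
qed

section \<open>Regularity of the relative energy and its flux\<close>

context fluid_thermodynamics
begin

lemma state_function_C1:
  fixes g :: "'n state \<Rightarrow> real"
  assumes "Ck_on 1 UNIV W" "\<And>x. state_of (W x) \<in> phase_space" "Ck_on 1 phase_space g"
  shows "Ck_on 1 UNIV (\<lambda>x. g (state_of (W x)))"
  by (rule Ck_on_1_compose[OF open_UNIV Ck_on_linear_image[OF open_UNIV assms(1) bounded_linear_state_of] assms(3)])
    (use assms(2) in auto)

lemma rel_flux_C1:
  fixes W V :: "real^3 \<Rightarrow> 'n unknown"
  assumes W: "Ck_on 1 UNIV W" "\<And>x. state_of (W x) \<in> phase_space"
    and V: "Ck_on 1 UNIV V" "\<And>x. state_of (V x) \<in> phase_space"
    and J: "\<And>i. Ck_on 1 UNIV (J i)" and q: "Ck_on 1 UNIV q"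
  shows "Ck_on 1 UNIV (rel_flux W V J q)"
proof -
  note c = Ck_on_linear_image[OF open_UNIV _ bounded_linear_vel] Ck_on_linear_image[OF open_UNIV _ bounded_linear_temp]
    Ck_on_linear_image[OF open_UNIV _ bounded_linear_compose[OF bounded_linear_vec_nth bounded_linear_dens]]
    Ck_on_linear_image[OF open_UNIV _ bounded_linear_compose[OF bounded_linear_vec_nth bounded_linear_vel]]
    Ck_on_linear_image[OF open_UNIV _ bounded_linear_compose[OF bounded_linear_total_mass bounded_linear_dens]]
  note th = state_function_C1[OF W] state_function_C1[OF V]
  note ops = Ck_on_add[OF open_UNIV] Ck_on_diff[OF open_UNIV] Ck_on_mult[OF open_UNIV] Ck_on_sum[OF open_UNIV]
  have \<theta>: "temp (W x) \<noteq> 0" for x using W(2)[of x] by (auto simp: mem_phase_space)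
  have J1: "Ck_on 1 UNIV (\<lambda>x. rel_J \<psi> (state_of (W x)) (state_of (V x)))"
    unfolding rel_J_def unknown_linear
    by (intro ops th c W(1) V(1) rho_e_C1 rho_eta_C1 chem_pot_C1)
  have "Ck_on 1 UNIV (\<lambda>x. total_mass (dens (W x)) * (\<Sum>i\<in>UNIV. (vel (W x) $ i - vel (V x) $ i) * (vel (W x) $ i - vel (V x) $ i)))"
    by (intro ops c W(1) V(1))
  then have "Ck_on 1 UNIV (\<lambda>x. total_mass (dens (W x)) * (norm (vel (W x) - vel (V x)))\<^sup>2)"
    by (simp only: dot_square_norm[symmetric] inner_vec_def inner_real_def vector_minus_component)
  then have "Ck_on 1 UNIV (\<lambda>x. total_mass (dens (W x)) * (norm (vel (W x) - vel (V x)))\<^sup>2 / 2)"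
    by (rule Ck_on_linear_image[OF open_UNIV _ bounded_linear_divide])
  then have I: "Ck_on 1 UNIV (\<lambda>x. rel_I \<psi> (W x) (V x))"
    unfolding rel_I_def by (intro ops J1)
  show ?thesis
    unfolding rel_flux_def[abs_def]
    by (intro ops Ck_on_scaleR[OF open_UNIV] I th c W(1) V(1) pressure_C1 chem_pot_C1 J q
        Ck_on_1_divide[OF open_UNIV] Ck_on_const \<theta>)
qed

lemma rel_flux_periodic:
  assumes "torus_periodic W" "torus_periodic V" "\<And>i. torus_periodic (J i)" "torus_periodic q"
  shows "torus_periodic (rel_flux W V J q)"
  using assms unfolding torus_periodic_def rel_flux_def by simp

lemma rel_I_deriv_continuous:
  fixes w w' a a' :: "'z::topological_space \<Rightarrow> 'n unknown"
  assumes "continuous_on Z w" "continuous_on Z w'" "continuous_on Z a" "continuous_on Z a'"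
    "\<And>z. z \<in> Z \<Longrightarrow> state_of (w z) \<in> phase_space" "\<And>z. z \<in> Z \<Longrightarrow> state_of (w' z) \<in> phase_space"
  shows "continuous_on Z (\<lambda>z. rel_I_deriv (w z) (w' z) (a z) (a' z))"
    and "continuous_on Z (\<lambda>z. rel_I \<psi> (w z) (w' z))"
proof -
  note lin = bounded_linear.continuous_on[OF bounded_linear_dens] bounded_linear.continuous_on[OF bounded_linear_vel]
    bounded_linear.continuous_on[OF bounded_linear_temp] bounded_linear.continuous_on[OF bounded_linear_state_of]
    bounded_linear.continuous_on[OF bounded_linear_total_mass]
  have st: "continuous_on Z (\<lambda>z. g (state_of (w z)))" "continuous_on Z (\<lambda>z. g (state_of (w' z)))"
    if "Ck_on 1 phase_space g" for g :: "'n state \<Rightarrow> real"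
    using assms(5,6) by (auto intro!: continuous_on_compose2[OF Ck_on_continuous[OF that]] lin assms(1,2))
  have mu: "continuous_on Z (\<lambda>z. d\<mu> i (state_of (w' z)) (state_of (a' z)))" for i
    by (rule continuous_on_frechet_derivative_apply[OF chem_pot_C1]) (use assms in \<open>auto intro!: lin\<close>)
  have eta: "continuous_on Z (\<lambda>z. d\<eta> (state_of (w z)) (state_of (a z)))"
    by (rule continuous_on_frechet_derivative_apply[OF rho_eta_C1]) (use assms in \<open>auto intro!: lin\<close>)
  show "continuous_on Z (\<lambda>z. rel_I_deriv (w z) (w' z) (a z) (a' z))"
    unfolding rel_I_deriv_def
    by (intro continuous_intros lin assms st chem_pot_C1 rho_eta_C1 mu eta) auto
  show "continuous_on Z (\<lambda>z. rel_I \<psi> (w z) (w' z))"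
    unfolding rel_I_def rel_J_def unknown_linear
    by (intro continuous_intros lin assms st chem_pot_C1 rho_eta_C1 rho_e_C1) auto
qed

lemma torus_integral_rel_I_derivative:
  fixes W V :: "'n flow"
  assumes W: "C1_space_time {0..T} W" "\<And>t x. t \<in> {0..T} \<Longrightarrow> state_of (W t x) \<in> phase_space"
    and V: "C1_space_time I V" "{0..T} \<subseteq> I" "\<And>t x. t \<in> {0..T} \<Longrightarrow> state_of (V t x) \<in> phase_space"
    and t: "t \<in> {0..T}"
  shows "((\<lambda>t. torus_integral (\<lambda>x. rel_I \<psi> (W t x) (V t x))) has_vector_derivative
     torus_integral (\<lambda>x. rel_I_deriv (W t x) (V t x) (dt {0..T} W t x) (dt I V t x))) (at t within {0..T})"
  unfolding torus_integral_def
proof (rule leibniz_rule_vector_derivative)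
  have sub: "{0..T} \<times> cell \<subseteq> {0..T} \<times> UNIV" "{0..T} \<times> cell \<subseteq> I \<times> UNIV" using V(2) by auto
  have c: "continuous_on ({0..T} \<times> cell) (\<lambda>z. W (fst z) (snd z))" "continuous_on ({0..T} \<times> cell) (\<lambda>z. V (fst z) (snd z))"
    "continuous_on ({0..T} \<times> cell) (\<lambda>z. dt {0..T} W (fst z) (snd z))" "continuous_on ({0..T} \<times> cell) (\<lambda>z. dt I V (fst z) (snd z))"
    using W(1) V(1) sub unfolding C1_space_time_def C1_space_def case_prod_beta'
    by (blast intro: continuous_on_subset)+
  have "continuous_on ({0..T} \<times> cell) (\<lambda>z. rel_I_deriv (W (fst z) (snd z)) (V (fst z) (snd z))
      (dt {0..T} W (fst z) (snd z)) (dt I V (fst z) (snd z)))"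
    by (rule rel_I_deriv_continuous(1)[OF c]) (use W(2) V(3) in auto)
  then show "continuous_on ({0..T} \<times> cell) (\<lambda>(t, x). rel_I_deriv (W t x) (V t x) (dt {0..T} W t x) (dt I V t x))"
    by (simp add: case_prod_beta')
  have I: "continuous_on ({0..T} \<times> cell) (\<lambda>z. rel_I \<psi> (W (fst z) (snd z)) (V (fst z) (snd z)))"
    by (rule rel_I_deriv_continuous(2)[OF c]) (use W(2) V(3) in auto)
  show "(\<lambda>x. rel_I \<psi> (W s x) (V s x)) integrable_on cell" if "s \<in> {0..T}" for s
  proof (intro integrable_continuous)
    have P: "continuous_on cell (\<lambda>x. (s, x))" by (rule continuous_on_Pair[OF continuous_on_const continuous_on_id])
    have "(\<lambda>x. (s, x)) ` cell \<subseteq> {0..T} \<times> cell" using that by auto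
    from continuous_on_compose2[OF I P this] show "continuous_on cell (\<lambda>x. rel_I \<psi> (W s x) (V s x))"
      by simp
  qed
  fix s x assume s: "s \<in> {0..T}" and "x \<in> cell"
  have a: "((\<lambda>s. W s x) has_vector_derivative dt {0..T} W s x) (at s within {0..T})"
    unfolding dt_def vector_derivative_works[symmetric] using W(1) s by (simp add: C1_space_time_def)
  have "((\<lambda>s. V s x) has_vector_derivative dt I V s x) (at s within I)"
    unfolding dt_def vector_derivative_works[symmetric] using V(1,2) s by (auto simp: C1_space_time_def)
  then have a': "((\<lambda>s. V s x) has_vector_derivative dt I V s x) (at s within {0..T})"
    by (rule has_vector_derivative_within_subset[OF _ V(2)])
  have "((\<lambda>s. (W s x, V s x)) has_vector_derivative (dt {0..T} W s x, dt I V s x)) (at s within {0..T})"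
    using has_derivative_Pair[OF a[unfolded has_vector_derivative_def] a'[unfolded has_vector_derivative_def]]
    by (simp add: has_vector_derivative_def)
  from has_vector_derivative_compose[OF this rel_I_derivative[OF W(2)[OF s] V(3)[OF s]]]
  show "((\<lambda>s. rel_I \<psi> (W s x) (V s x)) has_vector_derivative
      rel_I_deriv (W s x) (V s x) (dt {0..T} W s x) (dt I V s x)) (at s within {0..T})"
    by simp
qed (use t in auto)

end

section \<open>The relative energy estimate\<close>

lemma C1_space_Ck_on:
  assumes "C1_space I f" "t \<in> I" shows "Ck_on 1 UNIV (f t)"
  unfolding Ck_on_1_iff
proof (intro conjI ballI allI)
  show "f t differentiable (at x)" for x using assms by (simp add: C1_space_def)
  fix h
  have "continuous_on (I \<times> UNIV) (\<lambda>z. der (f (fst z)) (snd z) h)"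
    using assms(1) by (simp add: C1_space_def case_prod_beta')
  moreover have "continuous_on UNIV (\<lambda>x::real^3. (t, x))"
    by (rule continuous_on_Pair[OF continuous_on_const continuous_on_id])
  moreover have "(\<lambda>x::real^3. (t, x)) ` UNIV \<subseteq> I \<times> UNIV" using assms(2) by auto
  ultimately have "continuous_on UNIV (\<lambda>x. der (f (fst (t, x))) (snd (t, x)) h)"
    by (rule continuous_on_compose2)
  then show "continuous_on UNIV (\<lambda>x. der (f t) x h)" by simp
qed

lemma diver_const: "diver (\<lambda>x. c) x = 0"
  by (simp add: diver_def)

lemma grad_inverse:
  assumes "(f has_derivative f') (at x)" "f x \<noteq> 0"
  shows "grad (\<lambda>x. 1 / f x) x = - grad f x /\<^sub>R (f x)\<^sup>2"
proof -
  have "((\<lambda>x. 1 / f x) has_derivative (\<lambda>h. - (f' h) / (f x)\<^sup>2)) (at x)"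
    using has_derivative_divide[OF has_derivative_const[of 1] assms]
    by (simp add: power2_eq_square divide_inverse mult_ac)
  then have "grad (\<lambda>x. 1 / f x) x \<bullet> h = - (f' h) / (f x)\<^sup>2" for h by (rule grad_eq)
  then have "grad (\<lambda>x. 1 / f x) x \<bullet> h = (- grad f x /\<^sub>R (f x)\<^sup>2) \<bullet> h" for h
    using grad_eq[OF assms(1), of h] by (simp add: divide_inverse mult.commute)
  then show ?thesis by (subst vector_eq_rdot[symmetric]) simp
qed

text \<open>The limit flow \<open>V\<close> lives on a time interval \<open>I\<close> that may be larger than \<open>[0, T]\<close>; time derivatives of \<open>V\<close> are taken
within \<open>I\<close>, those of the diffusive flows within \<open>[0, T]\<close>.\<close>

locale diffusion_limit = stable_thermodynamics \<psi> for \<psi> :: "'n::finite state \<Rightarrow> real" +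
  fixes e p :: "'n state \<Rightarrow> real^'n"
    and b :: "'n \<Rightarrow> 'n \<Rightarrow> real \<Rightarrow> real \<Rightarrow> real \<Rightarrow> real"
    and \<U> :: "'n state set" and V :: "'n flow" and I :: "real set"
    and T \<delta> M \<alpha> \<mu> :: real
  assumes U_phase: "\<U> \<subseteq> phase_space" and U_compact: "compact (closure \<U>)"
    and psi_C3: "Ck_near 3 (closure \<U>) \<psi>"
    and b_sym: "\<And>r \<theta> i j. (r, \<theta>) \<in> phase_space \<Longrightarrow> i \<noteq> j \<Longrightarrow>
           b i j (r $ i) (r $ j) \<theta> = b j i (r $ j) (r $ i) \<theta>"
    and b_ge: "\<And>r \<theta> i j. (r, \<theta>) \<in> \<U> \<Longrightarrow> i \<noteq> j \<Longrightarrow> \<mu> \<le> b i j (r $ i) (r $ j) \<theta>"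
    and pos: "0 < \<mu>" "0 < \<alpha>" "0 < \<delta>" "0 < T"
    and growth: "\<And>\<omega>. \<omega> \<in> \<U> \<Longrightarrow>
           (\<Sum>j\<in>UNIV. \<bar>(enthalpy e p \<omega> j - fst \<omega> $ j * chem_pot \<psi> \<omega> $ j) / sqrt (fst \<omega> $ j)\<bar>\<^sup>2)
             \<le> \<alpha> * (rho_e \<psi> \<omega> + 1)"
    and euler: "euler_solution \<psi> I V" "{0..T} \<subseteq> I"
    and V_state: "\<And>t x. t \<in> {0..T} \<Longrightarrow> state_of (V t x) \<in> \<U> \<and> bounded_state \<delta> M (state_of (V t x))"
begin

definition admissible :: "real \<Rightarrow> ('n state \<Rightarrow> real) \<Rightarrow> 'n flow \<Rightarrow> bool" where
  "admissible \<epsilon> \<kappa> W \<longleftrightarrow> 0 < \<epsilon> \<and> (\<forall>\<omega>\<in>\<U>. 0 \<le> \<kappa> \<omega> \<and> \<kappa> \<omega> \<le> M) \<and>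
     diffusive_solution \<psi> e p b \<epsilon> \<kappa> {0..T} W \<and>
     (\<forall>t\<in>{0..T}. \<forall>x. state_of (W t x) \<in> \<U> \<and> bounded_state \<delta> M (state_of (W t x)))"

definition limit_states :: "'n state set" where
  "limit_states = (\<lambda>(t, x). state_of (V t x)) ` ({0..T} \<times> cell)"

lemma V_C1: "C1_space_time I V" "C1_space I V"
  using euler(1) by (auto simp: euler_solution_def C1_space_time_def)

lemma V_derivative: "t \<in> {0..T} \<Longrightarrow> (V t has_derivative der (V t) x) (at x)"
  using V_C1(2) euler(2) by (auto simp: C1_space_def frechet_derivative_works[symmetric])

lemma V_phase: "t \<in> {0..T} \<Longrightarrow> state_of (V t x) \<in> phase_space"
  using V_state U_phase by blast

lemma limit_states: "compact limit_states" "limit_states \<subseteq> \<U>" "limit_states \<subseteq> phase_space"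
proof -
  have "continuous_on ({0..T} \<times> cell) (\<lambda>z. V (fst z) (snd z))"
    using V_C1(2) euler(2) unfolding C1_space_def case_prod_beta' by (blast intro: continuous_on_subset)
  then have "continuous_on ({0..T} \<times> cell) (\<lambda>z. state_of (V (fst z) (snd z)))"
    by (rule bounded_linear.continuous_on[OF bounded_linear_state_of])
  then show "compact limit_states" unfolding limit_states_def case_prod_beta'
    by (rule compact_continuous_image) (intro compact_Times compact_Icc compact_cbox)
  show "limit_states \<subseteq> \<U>" using V_state by (auto simp: limit_states_def)
  then show "limit_states \<subseteq> phase_space" using U_phase by blast
qed

text \<open>All coefficients built from the limit flow are continuous on the compact set \<open>[0, T] \<times> cell\<close>.\<close>

lemma limit_flow_bounds:
  obtains B where "0 \<le> B"
    and "\<And>t x u. t \<in> {0..T} \<Longrightarrow> x \<in> cell \<Longrightarrow> norm (vel (der (V t) x u)) \<le> B * norm u"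
    and "\<And>t x u. t \<in> {0..T} \<Longrightarrow> x \<in> cell \<Longrightarrow> \<bar>temp (der (V t) x u)\<bar> \<le> B * norm u"
    and "\<And>t x u i. t \<in> {0..T} \<Longrightarrow> x \<in> cell \<Longrightarrow>
      \<bar>d\<mu> i (state_of (V t x)) (state_of (der (V t) x u))\<bar> \<le> B * norm u"
    and "\<And>t x. t \<in> {0..T} \<Longrightarrow> x \<in> cell \<Longrightarrow> norm (grad (\<lambda>x. pressure \<psi> (state_of (V t x))) x) \<le> B"
    and "\<And>t x. t \<in> {0..T} \<Longrightarrow> x \<in> cell \<Longrightarrow> \<bar>diver (\<lambda>x. vel (V t x)) x\<bar> \<le> B"
    and "\<And>t x. t \<in> {0..T} \<Longrightarrow> x \<in> cell \<Longrightarrow>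
      \<bar>temp (dt I V t x + der (V t) x (vel (V t x)))\<bar> \<le> B"
    and "\<And>t x. t \<in> {0..T} \<Longrightarrow> x \<in> cell \<Longrightarrow> norm (grad (\<lambda>x. temp (V t x)) x) \<le> B"
    and "\<And>t x i. t \<in> {0..T} \<Longrightarrow> x \<in> cell \<Longrightarrow> norm (grad (\<lambda>x. chem_pot \<psi> (state_of (V t x)) $ i) x) \<le> B"
proof -
  obtain B0 where B0: "B0 \<ge> 0" "\<And>t x. t \<in> {0..T} \<Longrightarrow> x \<in> cell \<Longrightarrow> norm (V t x) \<le> B0"
    "\<And>t x. t \<in> {0..T} \<Longrightarrow> x \<in> cell \<Longrightarrow> norm (dt I V t x) \<le> B0"
    "\<And>t x h. t \<in> {0..T} \<Longrightarrow> x \<in> cell \<Longrightarrow> norm (der (V t) x h) \<le> B0 * norm h"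
    using C1_space_time_bounds[OF V_C1(1) euler(2)] by blast
  obtain Np where Np: "Np \<ge> 0" "\<And>\<omega> h. \<omega> \<in> limit_states \<Longrightarrow> norm (der (pressure \<psi>) \<omega> h) \<le> Np * norm h"
    using derivative_bound_on_compact[OF pressure_C1 limit_states(1,3)] by blast
  have "\<forall>i. \<exists>C\<ge>0. \<forall>\<omega>\<in>limit_states. \<forall>h. norm (d\<mu> i \<omega> h) \<le> C * norm h"
    using derivative_bound_on_compact[OF chem_pot_C1 limit_states(1,3)] by blast
  then obtain Nm where Nm: "\<And>i. Nm i \<ge> 0" "\<And>i \<omega> h. \<omega> \<in> limit_states \<Longrightarrow> norm (d\<mu> i \<omega> h) \<le> Nm i * norm h" by metis
  define N where "N = Np + (\<Sum>i\<in>UNIV. Nm i)"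
  have "Nm i \<le> (\<Sum>i\<in>UNIV. Nm i)" for i using Nm(1) by (intro member_le_sum) auto
  then have N: "N \<ge> 0" "Np \<le> N" "Nm i \<le> N" for i
    using Np(1) Nm(1) by (auto simp: N_def intro: add_nonneg_nonneg sum_nonneg add_increasing)
  define B where "B = 3 * B0 + N * B0 + B0 * B0"
  have B: "B \<ge> 0" "B0 \<le> B" "N * B0 \<le> B" "3 * B0 \<le> B" "B0 + B0 * B0 \<le> B"
    using B0(1) N(1) by (auto simp: B_def)
  have st: "norm (state_of (der (V t) x u)) \<le> B0 * norm u" if "t \<in> {0..T}" "x \<in> cell" for t x u
    by (rule order_trans[OF norm_components_le(3) B0(4)[OF that]])
  have K: "state_of (V t x) \<in> limit_states" if "t \<in> {0..T}" "x \<in> cell" for t x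
    using that by (auto simp: limit_states_def)
  have up: "y \<le> B * norm u" if "y \<le> C * norm u" "C \<le> B" for y C and u :: "real^3"
    using that by (meson mult_right_mono norm_ge_zero order_trans)
  have v: "norm (vel (der (V t) x u)) \<le> B0 * norm u" if "t \<in> {0..T}" "x \<in> cell" for t x u
    by (rule order_trans[OF norm_components_le(1) B0(4)[OF that]])
  have th: "\<bar>temp (der (V t) x u)\<bar> \<le> B * norm u" if "t \<in> {0..T}" "x \<in> cell" for t x u
    by (rule up[OF order_trans[OF norm_components_le(2) B0(4)[OF that]] B(2)])
  have mu: "\<bar>d\<mu> i (state_of (V t x)) (state_of (der (V t) x u))\<bar> \<le> B * norm u"
    if t: "t \<in> {0..T}" "x \<in> cell" for t x u i
  proof (rule up[OF _ B(3)])
    have "\<bar>d\<mu> i (state_of (V t x)) (state_of (der (V t) x u))\<bar> \<le> N * (B0 * norm u)"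
      using Nm(2)[OF K[OF t], of i] st[OF t] N by (smt (verit, best) mult_mono norm_ge_zero real_norm_def)
    then show "\<bar>d\<mu> i (state_of (V t x)) (state_of (der (V t) x u))\<bar> \<le> N * B0 * norm u" by (simp add: mult.assoc)
  qed
  have pr: "\<bar>der (pressure \<psi>) (state_of (V t x)) (state_of (der (V t) x u))\<bar> \<le> B * norm u"
    if t: "t \<in> {0..T}" "x \<in> cell" for t x u
  proof (rule up[OF _ B(3)])
    have "\<bar>der (pressure \<psi>) (state_of (V t x)) (state_of (der (V t) x u))\<bar> \<le> N * (B0 * norm u)"
      using Np(2)[OF K[OF t]] st[OF t] N by (smt (verit, best) mult_mono norm_ge_zero real_norm_def)
    then show "\<bar>der (pressure \<psi>) (state_of (V t x)) (state_of (der (V t) x u))\<bar> \<le> N * B0 * norm u"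
      by (simp add: mult.assoc)
  qed
  note d = unknown_derivatives[OF V_derivative V_phase]
  have dv: "\<bar>diver (\<lambda>x. vel (V t x)) x\<bar> \<le> B" if t: "t \<in> {0..T}" "x \<in> cell" for t x
  proof -
    have "diver (\<lambda>x. vel (V t x)) x = (\<Sum>j\<in>UNIV. vel (der (V t) x (axis j 1)) $ j)"
      unfolding diver_def frechet_derivative_at[OF d(1)[OF t(1) t(1)], symmetric] ..
    also have "norm \<dots> \<le> (\<Sum>j\<in>(UNIV::3 set). B0)"
    proof (rule sum_norm_le)
      fix j :: 3
      have "norm (vel (der (V t) x (axis j 1)) $ j) \<le> norm (vel (der (V t) x (axis j 1)))"
        by (rule component_le_norm_cart[folded real_norm_def])
      also have "\<dots> \<le> B0" using v[OF t, of "axis j 1"] by (simp add: norm_axis_1)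
      finally show "norm (vel (der (V t) x (axis j 1)) $ j) \<le> B0" .
    qed
    finally show ?thesis using B(4) by simp
  qed
  have D: "\<bar>temp (dt I V t x + der (V t) x (vel (V t x)))\<bar> \<le> B" if t: "t \<in> {0..T}" "x \<in> cell" for t x
  proof -
    have "\<bar>temp (dt I V t x + der (V t) x (vel (V t x)))\<bar> \<le> norm (dt I V t x + der (V t) x (vel (V t x)))"
      by (rule norm_components_le)
    also have "\<dots> \<le> B0 + B0 * norm (vel (V t x))"
      by (rule norm_triangle_mono[OF B0(3)[OF t] B0(4)[OF t]])
    also have "norm (vel (V t x)) \<le> B0" by (rule order_trans[OF norm_components_le(1) B0(2)[OF t]])
    finally show ?thesis using B(5) B0(1) by (simp add: mult_left_mono)
  qed
  show thesis
  proof (rule that[OF B(1)])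
    show "norm (vel (der (V t) x u)) \<le> B * norm u" if "t \<in> {0..T}" "x \<in> cell" for t x u
      by (rule up[OF v[OF that] B(2)])
    show "norm (grad (\<lambda>x. pressure \<psi> (state_of (V t x))) x) \<le> B" if t: "t \<in> {0..T}" "x \<in> cell" for t x
      by (rule grad_norm_le[OF d(3)[OF t(1) t(1)] pr[OF t] B(1)])
    show "norm (grad (\<lambda>x. temp (V t x)) x) \<le> B" if t: "t \<in> {0..T}" "x \<in> cell" for t x
      by (rule grad_norm_le[OF d(2)[OF t(1) t(1)] th[OF t] B(1)])
    show "norm (grad (\<lambda>x. chem_pot \<psi> (state_of (V t x)) $ i) x) \<le> B" if t: "t \<in> {0..T}" "x \<in> cell" for t x i
      by (rule grad_norm_le[OF d(4)[OF t(1) t(1)] mu[OF t] B(1)])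
  qed (fact th mu dv D)+
qed

text \<open>The third derivatives of \<open>\<psi>\<close> enter here: pressure and entropy are of class \<open>C\<^sup>2\<close> near the closure of \<open>\<U>\<close>.\<close>

lemma constitutive_bounds:
  obtains L E where "0 \<le> L" "0 \<le> E"
    and "\<And>\<omega> \<omega>'. \<omega>' \<in> limit_states \<Longrightarrow> \<omega> \<in> \<U> \<Longrightarrow>
      \<bar>pressure \<psi> \<omega> - pressure \<psi> \<omega>' - der (pressure \<psi>) \<omega>' (\<omega> - \<omega>')\<bar> \<le> L * (norm (\<omega> - \<omega>'))\<^sup>2"
    and "\<And>\<omega> \<omega>'. \<omega>' \<in> limit_states \<Longrightarrow> \<omega> \<in> \<U> \<Longrightarrow>
      \<bar>rho_eta \<psi> \<omega> - rho_eta \<psi> \<omega>' - d\<eta> \<omega>' (\<omega> - \<omega>')\<bar> \<le> L * (norm (\<omega> - \<omega>'))\<^sup>2"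
    and "\<And>\<omega> \<omega>'. \<omega>' \<in> limit_states \<Longrightarrow> \<omega> \<in> \<U> \<Longrightarrow> \<bar>rho_eta \<psi> \<omega> - rho_eta \<psi> \<omega>'\<bar> \<le> L * norm (\<omega> - \<omega>')"
    and "\<And>\<omega>. \<omega> \<in> \<U> \<Longrightarrow> rho_e \<psi> \<omega> \<le> E"
proof -
  obtain S where S: "open S" "closure \<U> \<subseteq> S" "Ck_on 3 S \<psi>" using psi_C3 by (auto simp: Ck_near_def)
  interpret S: thermodynamics \<psi> S
    by unfold_locales (use S(1) Ck_on_antimono[OF S(3), of 2] in auto)
  have "Ck_on (Suc 2) S (rho_psi \<psi>)" using rho_psi_Ck[OF S(1,3)] by (simp only: eval_nat_numeral)
  note C = S.pressure_Ck[OF this] S.rho_eta_Ck[OF this] S.rho_e_Ck[OF this]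
  have US: "\<U> \<subseteq> S" using S(2) closure_subset by blast
  have bd: "bounded (g ` \<U>)" if "Ck_on 2 S g" for g :: "'n state \<Rightarrow> real"
  proof -
    have "bounded (g ` closure \<U>)"
      by (rule compact_imp_bounded[OF compact_continuous_image[OF continuous_on_subset[OF Ck_on_continuous[OF that] S(2)] U_compact]])
    then show ?thesis by (rule bounded_subset) (use closure_subset in auto)
  qed
  have "bounded \<U>" using compact_imp_bounded[OF U_compact] closure_subset bounded_subset by blast
  note Q = quadratic_remainder[OF S(1) _ limit_states(1) order_trans[OF limit_states(2) US] this bd]
  obtain L1 where L1: "L1 \<ge> 0" "\<forall>y\<in>limit_states. \<forall>x\<in>\<U>.
      \<bar>pressure \<psi> x - pressure \<psi> y - der (pressure \<psi>) y (x - y)\<bar> \<le> L1 * (norm (x - y))\<^sup>2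
      \<and> \<bar>pressure \<psi> x - pressure \<psi> y\<bar> \<le> L1 * norm (x - y)"
    using Q[OF C(1) C(1)] by blast
  obtain L2 where L2: "L2 \<ge> 0" "\<forall>y\<in>limit_states. \<forall>x\<in>\<U>.
      \<bar>rho_eta \<psi> x - rho_eta \<psi> y - d\<eta> y (x - y)\<bar> \<le> L2 * (norm (x - y))\<^sup>2
      \<and> \<bar>rho_eta \<psi> x - rho_eta \<psi> y\<bar> \<le> L2 * norm (x - y)"
    using Q[OF C(2) C(2)] by blast
  obtain E where E: "\<And>\<omega>. \<omega> \<in> \<U> \<Longrightarrow> \<bar>rho_e \<psi> \<omega>\<bar> \<le> E" using bd[OF C(3)] unfolding bounded_iff by auto
  have up: "y \<le> (L1 + L2) * z" if "y \<le> L1 * z \<or> y \<le> L2 * z" "0 \<le> z" for y z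
    using that L1(1) L2(1) by (smt (verit) mult_right_mono)
  show thesis
  proof (rule that[of "L1 + L2" "\<bar>E\<bar>"])
    fix \<omega> \<omega>' assume w: "\<omega>' \<in> limit_states" "\<omega> \<in> \<U>"
    show "\<bar>pressure \<psi> \<omega> - pressure \<psi> \<omega>' - der (pressure \<psi>) \<omega>' (\<omega> - \<omega>')\<bar> \<le> (L1 + L2) * (norm (\<omega> - \<omega>'))\<^sup>2"
      using L1(2) w by (intro up) auto
    show "\<bar>rho_eta \<psi> \<omega> - rho_eta \<psi> \<omega>' - d\<eta> \<omega>' (\<omega> - \<omega>')\<bar> \<le> (L1 + L2) * (norm (\<omega> - \<omega>'))\<^sup>2"
      "\<bar>rho_eta \<psi> \<omega> - rho_eta \<psi> \<omega>'\<bar> \<le> (L1 + L2) * norm (\<omega> - \<omega>')"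
      using L2(2) w by (intro up; auto)+
  qed (use L1(1) L2(1) E in force)+
qed

lemma rel_I_lower_bound:
  obtains c where "0 < c" and "\<And>t x w. t \<in> {0..T} \<Longrightarrow> x \<in> cell \<Longrightarrow> bounded_state \<delta> M (state_of w) \<Longrightarrow>
    c * ((norm (vel w - vel (V t x)))\<^sup>2 + (norm (state_of w - state_of (V t x)))\<^sup>2) \<le> rel_I \<psi> w (V t x)"
proof -
  obtain c where c: "c > 0" "\<forall>\<omega>'\<in>limit_states. \<forall>\<omega>. bounded_state \<delta> M \<omega> \<longrightarrow> c * (norm (\<omega> - \<omega>'))\<^sup>2 \<le> rel_J \<psi> \<omega> \<omega>'"
    using rel_J_coercive[OF limit_states(1,3) pos(3)] by blast
  show thesis
  proof (rule that[of "min c (\<delta> / 2)"])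
    show "0 < min c (\<delta> / 2)" using c(1) pos(3) by simp
    fix t x and w :: "'n unknown"
    assume t: "t \<in> {0..T}" "x \<in> cell" and w: "bounded_state \<delta> M (state_of w)"
    have "\<delta> \<le> total_mass (dens w)" using w by (simp add: bounded_state_def)
    then have "\<delta> / 2 * (norm (vel w - vel (V t x)))\<^sup>2 \<le> total_mass (dens w) / 2 * (norm (vel w - vel (V t x)))\<^sup>2"
      by (intro mult_right_mono) auto
    moreover have "c * (norm (state_of w - state_of (V t x)))\<^sup>2 \<le> rel_J \<psi> (state_of w) (state_of (V t x))"
    proof -
      have "state_of (V t x) \<in> limit_states" using t by (auto simp: limit_states_def)
      then show ?thesis using c(2) w by blast
    qed
    moreover have "min c (\<delta> / 2) * (norm (vel w - vel (V t x)))\<^sup>2 \<le> \<delta> / 2 * (norm (vel w - vel (V t x)))\<^sup>2"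
      "min c (\<delta> / 2) * (norm (state_of w - state_of (V t x)))\<^sup>2 \<le> c * (norm (state_of w - state_of (V t x)))\<^sup>2"
      by (intro mult_right_mono; simp)+
    ultimately show "min c (\<delta> / 2) * ((norm (vel w - vel (V t x)))\<^sup>2 + (norm (state_of w - state_of (V t x)))\<^sup>2) \<le> rel_I \<psi> w (V t x)"
      unfolding rel_I_def distrib_left by (simp only: times_divide_eq_left)
  qed
qed

text \<open>The diffusive mass fluxes \<open>J\<close> and the heat flux \<open>q\<close> of a solution at a fixed time: these, rather than the
diffusion velocities, are the differentiable fields whose divergences enter the balance laws.\<close>

lemma diffusive_flow_production:
  assumes W: "admissible \<epsilon> \<kappa> W" and t: "t \<in> {0..T}"
  obtains J q where "\<And>i. Ck_on 1 UNIV (J i)" "Ck_on 1 UNIV q" "\<And>i. torus_periodic (J i)" "torus_periodic q"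
    and "\<And>x i. dt {0..T} (\<lambda>t x. dens (W t x) $ i) t x
             + diver (\<lambda>x. dens (W t x) $ i *\<^sub>R vel (W t x)) x = - diver (J i) x"
    and "\<And>x. dt {0..T} (\<lambda>t x. momentum (W t x)) t x + tensor_diver (\<lambda>x. momentum_flux \<psi> (W t x)) x = 0"
    and "\<And>x. dt {0..T} (\<lambda>t x. energy \<psi> (W t x)) t x + diver (\<lambda>x. energy_flux \<psi> (W t x)) x = diver q x"
    and "\<And>x. (\<Sum>i\<in>UNIV. diver (J i) x) = 0"
    and "\<And>x. \<exists>u. diffusion_velocities \<psi> e p b \<epsilon> (W t) x u \<and> (\<forall>i. J i x = dens (W t x) $ i *\<^sub>R u i) \<and>
      q x = \<kappa> (state_of (W t x)) *\<^sub>R grad (\<lambda>y. temp (W t y)) x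
              - (\<Sum>i\<in>UNIV. enthalpy e p (state_of (W t x)) i *\<^sub>R u i)"
proof -
  obtain u where
    flux: "\<And>i. C1_space {0..T} (\<lambda>t x. dens (W t x) $ i *\<^sub>R u i t x)"
      "C1_space {0..T} (\<lambda>t x. \<kappa> (state_of (W t x)) *\<^sub>R grad (\<lambda>y. temp (W t y)) x
              - (\<Sum>i\<in>UNIV. enthalpy e p (state_of (W t x)) i *\<^sub>R u i t x))"
    and per: "\<And>i. torus_periodic (u i t)"
    and law: "\<And>x. diffusion_velocities \<psi> e p b \<epsilon> (W t) x (\<lambda>i. u i t x)"
    and mass: "\<And>x i. dt {0..T} (\<lambda>t x. dens (W t x) $ i) t x
             + diver (\<lambda>x. dens (W t x) $ i *\<^sub>R vel (W t x)) x = - diver (\<lambda>x. dens (W t x) $ i *\<^sub>R u i t x) x"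
    and mom: "\<And>x. dt {0..T} (\<lambda>t x. momentum (W t x)) t x + tensor_diver (\<lambda>x. momentum_flux \<psi> (W t x)) x = 0"
    and ener: "\<And>x. dt {0..T} (\<lambda>t x. energy \<psi> (W t x)) t x + diver (\<lambda>x. energy_flux \<psi> (W t x)) x
       = diver (\<lambda>x. \<kappa> (state_of (W t x)) *\<^sub>R grad (\<lambda>y. temp (W t y)) x
              - (\<Sum>i\<in>UNIV. enthalpy e p (state_of (W t x)) i *\<^sub>R u i t x)) x"
    and Wper: "torus_periodic (W t)" and WC: "C1_space {0..T} W"
    using W t unfolding admissible_def diffusive_solution_def Let_def C1_space_time_def by blast
  define J where "J i x = dens (W t x) $ i *\<^sub>R u i t x" for i x
  define q where "q x = \<kappa> (state_of (W t x)) *\<^sub>R grad (\<lambda>y. temp (W t y)) x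
              - (\<Sum>i\<in>UNIV. enthalpy e p (state_of (W t x)) i *\<^sub>R u i t x)" for x
  have JC: "Ck_on 1 UNIV (J i)" for i
    using C1_space_Ck_on[OF flux(1)[of i] t] by (simp only: J_def[abs_def])
  have temp_d: "(\<lambda>y. temp (W t y)) differentiable (at x)" for x
  proof -
    have "(W t has_derivative der (W t) x) (at x)"
      using WC t by (auto simp: C1_space_def frechet_derivative_works[symmetric])
    then show ?thesis using bounded_linear.has_derivative[OF bounded_linear_temp] differentiableI by blast
  qed
  have gper: "grad (\<lambda>y. temp (W t y)) (x + axis i (2 * pi)) = grad (\<lambda>y. temp (W t y)) x" for x i
    unfolding grad_def using Wper
    by (subst frechet_derivative_periodic[OF _ temp_d]) (auto simp: torus_periodic_def)
  have "(\<Sum>i\<in>UNIV. diver (J i) x) = 0" for x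
  proof -
    have "(\<Sum>i\<in>UNIV. J i y) = 0" for y
      using law[of y] by (simp add: diffusion_velocities_def Let_def J_def)
    then have "diver (\<lambda>x. \<Sum>i\<in>UNIV. J i x) x = 0" by (simp add: diver_const)
    moreover have "diver (\<lambda>x. \<Sum>i\<in>UNIV. J i x) x = (\<Sum>i\<in>UNIV. diver (J i) x)"
      using JC by (intro diver_sum) (simp add: Ck_on_1_iff)
    ultimately show ?thesis by simp
  qed
  then show thesis
  proof (intro that[of J q])
    show "Ck_on 1 UNIV q" using C1_space_Ck_on[OF flux(2) t] by (simp only: q_def[abs_def])
    show "torus_periodic (J i)" for i
      using per[of i] Wper by (simp add: torus_periodic_def J_def)
    show "torus_periodic q"
      using per Wper gper by (simp add: torus_periodic_def q_def)
    show "\<exists>u. diffusion_velocities \<psi> e p b \<epsilon> (W t) x u \<and> (\<forall>i. J i x = dens (W t x) $ i *\<^sub>R u i) \<and>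
      q x = \<kappa> (state_of (W t x)) *\<^sub>R grad (\<lambda>y. temp (W t y)) x
              - (\<Sum>i\<in>UNIV. enthalpy e p (state_of (W t x)) i *\<^sub>R u i)" for x
      using law[of x] by (intro exI[of _ "\<lambda>i. u i t x"]) (simp add: J_def q_def)
  qed (use JC mass mom ener in \<open>simp_all add: J_def[abs_def] q_def[abs_def]\<close>)
qed

text \<open>The local form of the estimate.  The constants are chosen before \<open>\<epsilon>\<close>, \<open>\<kappa>\<close> and the
diffusive flow, and hence are uniform in them.\<close>

lemma relative_energy_inequality:
  obtains C C1 C2 where "0 \<le> C" "0 \<le> C1" "0 \<le> C2"
    and "\<And>\<epsilon> \<kappa> W t. admissible \<epsilon> \<kappa> W \<Longrightarrow> t \<in> {0..T} \<Longrightarrow>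
      \<exists>G. Ck_on 1 UNIV G \<and> torus_periodic G \<and>
        (\<forall>x\<in>cell. rel_I_deriv (W t x) (V t x) (dt {0..T} W t x) (dt I V t x) + diver G x
          \<le> C * rel_I \<psi> (W t x) (V t x) + sup_norm_on \<U> \<kappa> * C1 + \<epsilon> * C2)"
proof -
  obtain B where B: "0 \<le> B"
    "\<And>t x u. t \<in> {0..T} \<Longrightarrow> x \<in> cell \<Longrightarrow> norm (vel (der (V t) x u)) \<le> B * norm u"
    "\<And>t x u. t \<in> {0..T} \<Longrightarrow> x \<in> cell \<Longrightarrow> \<bar>temp (der (V t) x u)\<bar> \<le> B * norm u"
    "\<And>t x u i. t \<in> {0..T} \<Longrightarrow> x \<in> cell \<Longrightarrow>
      \<bar>d\<mu> i (state_of (V t x)) (state_of (der (V t) x u))\<bar> \<le> B * norm u"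
    "\<And>t x. t \<in> {0..T} \<Longrightarrow> x \<in> cell \<Longrightarrow> norm (grad (\<lambda>x. pressure \<psi> (state_of (V t x))) x) \<le> B"
    "\<And>t x. t \<in> {0..T} \<Longrightarrow> x \<in> cell \<Longrightarrow> \<bar>diver (\<lambda>x. vel (V t x)) x\<bar> \<le> B"
    "\<And>t x. t \<in> {0..T} \<Longrightarrow> x \<in> cell \<Longrightarrow>
      \<bar>temp (dt I V t x + der (V t) x (vel (V t x)))\<bar> \<le> B"
    "\<And>t x. t \<in> {0..T} \<Longrightarrow> x \<in> cell \<Longrightarrow> norm (grad (\<lambda>x. temp (V t x)) x) \<le> B"
    "\<And>t x i. t \<in> {0..T} \<Longrightarrow> x \<in> cell \<Longrightarrow> norm (grad (\<lambda>x. chem_pot \<psi> (state_of (V t x)) $ i) x) \<le> B"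
    proof (rule limit_flow_bounds, goal_cases)
      case (1 B)
      show ?case by (rule 1(1)[OF 1(2-)])
    qed
  obtain L E where LE: "0 \<le> L" "0 \<le> E"
    "\<And>\<omega> \<omega>'. \<omega>' \<in> limit_states \<Longrightarrow> \<omega> \<in> \<U> \<Longrightarrow>
      \<bar>pressure \<psi> \<omega> - pressure \<psi> \<omega>' - der (pressure \<psi>) \<omega>' (\<omega> - \<omega>')\<bar> \<le> L * (norm (\<omega> - \<omega>'))\<^sup>2"
    "\<And>\<omega> \<omega>'. \<omega>' \<in> limit_states \<Longrightarrow> \<omega> \<in> \<U> \<Longrightarrow>
      \<bar>rho_eta \<psi> \<omega> - rho_eta \<psi> \<omega>' - d\<eta> \<omega>' (\<omega> - \<omega>')\<bar> \<le> L * (norm (\<omega> - \<omega>'))\<^sup>2"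
    "\<And>\<omega> \<omega>'. \<omega>' \<in> limit_states \<Longrightarrow> \<omega> \<in> \<U> \<Longrightarrow> \<bar>rho_eta \<psi> \<omega> - rho_eta \<psi> \<omega>'\<bar> \<le> L * norm (\<omega> - \<omega>')"
    "\<And>\<omega>. \<omega> \<in> \<U> \<Longrightarrow> rho_e \<psi> \<omega> \<le> E"
    proof (rule constitutive_bounds, goal_cases)
      case (1 L E)
      show ?case by (rule 1(1)[OF 1(2-)])
    qed
  obtain c where c: "0 < c" "\<And>t x w. t \<in> {0..T} \<Longrightarrow> x \<in> cell \<Longrightarrow> bounded_state \<delta> M (state_of w) \<Longrightarrow>
    c * ((norm (vel w - vel (V t x)))\<^sup>2 + (norm (state_of w - state_of (V t x)))\<^sup>2) \<le> rel_I \<psi> w (V t x)"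
    proof (rule rel_I_lower_bound, goal_cases)
      case (1 c)
      show ?case by (rule 1(1)[OF 1(2-)])
    qed
  have M: "M \<ge> 0" using V_state[of 0 0] pos(3,4) by (simp add: bounded_state_def)
  define A where "A = M * B + real CARD('n) * B / \<delta> + real CARD('n) * B + 3 * B * L"
  have A: "A \<ge> 0" using M B(1) LE(1) pos(3) by (simp add: A_def)
  define C1 where "C1 = B\<^sup>2 / (4 * \<delta>)"
  define C2 where "C2 = (2 * B\<^sup>2 / \<delta>\<^sup>2 * (\<alpha> * (E + 1)) + 2 * B\<^sup>2 * M) / (4 * (\<delta>\<^sup>2 * \<mu>))"
  show thesis
  proof (rule that[of "A / c" C1 C2])
    show "0 \<le> A / c" "0 \<le> C1" "0 \<le> C2"
      using A c(1) pos M LE(2) by (auto simp: C1_def C2_def)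
    fix \<epsilon> \<kappa> W t assume W: "admissible \<epsilon> \<kappa> W" and t: "t \<in> {0..T}"
    have WC: "C1_space_time {0..T} W" "C1_space {0..T} W" "torus_periodic (W t)"
      using W t by (auto simp: admissible_def diffusive_solution_def C1_space_time_def)
    have WU: "state_of (W t x) \<in> \<U>" "bounded_state \<delta> M (state_of (W t x))" for x
      using W t by (auto simp: admissible_def)
    have WP: "state_of (W t x) \<in> phase_space" for x using WU U_phase by blast
    have \<epsilon>: "0 < \<epsilon>" and \<kappa>: "0 \<le> \<kappa> \<omega>" "\<kappa> \<omega> \<le> M" if "\<omega> \<in> \<U>" for \<omega>
      using W that by (auto simp: admissible_def)
    have sup: "\<kappa> \<omega> \<le> sup_norm_on \<U> \<kappa>" if "\<omega> \<in> \<U>" for \<omega>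
    proof -
      have "bdd_above ((\<lambda>\<omega>. \<bar>\<kappa> \<omega>\<bar>) ` \<U>)" using \<kappa> by (intro bdd_aboveI[of _ M]) auto
      then have "\<bar>\<kappa> \<omega>\<bar> \<le> sup_norm_on \<U> \<kappa>" unfolding sup_norm_on_def by (rule cSUP_upper[OF that])
      then show ?thesis by simp
    qed
    obtain J q where JC: "\<And>i. Ck_on 1 UNIV (J i)" and qC: "Ck_on 1 UNIV q"
      and per: "\<And>i. torus_periodic (J i)" "torus_periodic q"
      and Weq: "\<And>x i. dt {0..T} (\<lambda>t x. dens (W t x) $ i) t x
             + diver (\<lambda>x. dens (W t x) $ i *\<^sub>R vel (W t x)) x = - diver (J i) x"
        "\<And>x. dt {0..T} (\<lambda>t x. momentum (W t x)) t x + tensor_diver (\<lambda>x. momentum_flux \<psi> (W t x)) x = 0"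
        "\<And>x. dt {0..T} (\<lambda>t x. energy \<psi> (W t x)) t x + diver (\<lambda>x. energy_flux \<psi> (W t x)) x = diver q x"
      and J0: "\<And>x. (\<Sum>i\<in>UNIV. diver (J i) x) = 0"
      and u: "\<And>x. \<exists>u. diffusion_velocities \<psi> e p b \<epsilon> (W t) x u \<and> (\<forall>i. J i x = dens (W t x) $ i *\<^sub>R u i) \<and>
        q x = \<kappa> (state_of (W t x)) *\<^sub>R grad (\<lambda>y. temp (W t y)) x
              - (\<Sum>i\<in>UNIV. enthalpy e p (state_of (W t x)) i *\<^sub>R u i)"
      proof (rule diffusive_flow_production[OF W t], goal_cases)
      case (1 J q)
      show ?case by (rule 1(1)[OF 1(2-)])
    qed
    have Veq: "dt I (\<lambda>t x. dens (V t x) $ i) t x + diver (\<lambda>x. dens (V t x) $ i *\<^sub>R vel (V t x)) x = 0"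
        "dt I (\<lambda>t x. momentum (V t x)) t x + tensor_diver (\<lambda>x. momentum_flux \<psi> (V t x)) x = 0"
        "dt I (\<lambda>t x. energy \<psi> (V t x)) t x + diver (\<lambda>x. energy_flux \<psi> (V t x)) x = 0" for x i
      using euler t by (auto simp: euler_solution_def)
    have Vper: "torus_periodic (V t)" using euler t by (auto simp: euler_solution_def)
    show "\<exists>G. Ck_on 1 UNIV G \<and> torus_periodic G \<and>
        (\<forall>x\<in>cell. rel_I_deriv (W t x) (V t x) (dt {0..T} W t x) (dt I V t x) + diver G x
          \<le> A / c * rel_I \<psi> (W t x) (V t x) + sup_norm_on \<U> \<kappa> * C1 + \<epsilon> * C2)"
    proof (intro exI[of _ "rel_flux (W t) (V t) J q"] conjI ballI)
      show "Ck_on 1 UNIV (rel_flux (W t) (V t) J q)"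
        using euler(2) t by (intro rel_flux_C1 C1_space_Ck_on[OF WC(2)] C1_space_Ck_on[OF V_C1(2)] JC qC WP V_phase) auto
      show "torus_periodic (rel_flux (W t) (V t) J q)" by (intro rel_flux_periodic WC Vper per)
      fix x assume x: "x \<in> cell"
      let ?w = "W t x" and ?w' = "V t x"
      let ?A = "der (W t) x" and ?A' = "der (V t) x"
      let ?h = "state_of ?w - state_of ?w'" and ?u = "vel ?w - vel ?w'"
      have WA: "(W t has_derivative ?A) (at x)"
        using WC(2) t by (auto simp: C1_space_def frechet_derivative_works[symmetric])
      have a: "((\<lambda>s. W s x) has_vector_derivative dt {0..T} W t x) (at t within {0..T})"
        unfolding dt_def vector_derivative_works[symmetric] using WC(1) t by (simp add: C1_space_time_def)
      have a': "((\<lambda>s. V s x) has_vector_derivative dt I V t x) (at t within I)"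
        unfolding dt_def vector_derivative_works[symmetric] using V_C1(1) euler(2) t by (auto simp: C1_space_time_def)
      have nb: "at t within {0..T} \<noteq> bot" "at t within I \<noteq> bot"
        by (rule at_within_Icc_neq_bot[OF pos(4) t order_refl] at_within_Icc_neq_bot[OF pos(4) t euler(2)])+
      have Jd: "J i differentiable (at x)" "q differentiable (at x)" for i
        using JC[of i] qC by (simp_all add: Ck_on_1_iff)
      note production = relative_energy_production[where W=W and V=V, OF WP V_phase[OF t] nb a a' WA V_derivative[OF t] Jd(1) J0 Jd(2) Weq Veq]
      have \<omega>': "state_of ?w' \<in> limit_states" using t x by (auto simp: limit_states_def)
      have bW: "\<delta> \<le> total_mass (dens ?w)" "total_mass (dens ?w) \<le> M" "\<delta> \<le> temp ?w"
        using WU(2)[of x] by (auto simp: bounded_state_def)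
      have bV: "\<delta> \<le> total_mass (dens ?w')" "\<delta> \<le> temp ?w'"
        using V_state[OF t, of x] by (auto simp: bounded_state_def)
      have "transport_production ?w ?w' (dt I V t x + ?A' (vel ?w')) (?A' ?u)
          (grad (\<lambda>x. pressure \<psi> (state_of (V t x))) x) (diver (\<lambda>x. vel (V t x)) x)
        \<le> A * ((norm ?u)\<^sup>2 + (norm ?h)\<^sup>2)"
        unfolding A_def
        by (rule transport_production_bound[OF V_phase[OF t] production(2,3) _ bW(2) pos(3) bV(1) B(1)
              B(2)[OF t x] B(3)[OF t x] B(4)[OF t x] B(5)[OF t x] B(6)[OF t x] B(7)[OF t x] LE(1)
              LE(3)[OF \<omega>' WU(1)] LE(4)[OF \<omega>' WU(1)] LE(5)[OF \<omega>' WU(1)]])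
          (use bW(1) pos(3) in simp)
      also have "\<dots> \<le> A * (rel_I \<psi> ?w ?w' / c)"
        using c(2)[OF t x WU(2)] c(1) A by (intro mult_left_mono) (simp_all add: field_simps)
      finally have transport: "transport_production ?w ?w' (dt I V t x + ?A' (vel ?w')) (?A' ?u)
          (grad (\<lambda>x. pressure \<psi> (state_of (V t x))) x) (diver (\<lambda>x. vel (V t x)) x)
        \<le> A / c * rel_I \<psi> ?w ?w'" by simp
      obtain u where u: "diffusion_velocities \<psi> e p b \<epsilon> (W t) x u" "\<And>i. J i x = dens ?w $ i *\<^sub>R u i"
        "q x = \<kappa> (state_of ?w) *\<^sub>R grad (\<lambda>y. temp (W t y)) x
              - (\<Sum>i\<in>UNIV. enthalpy e p (state_of ?w) i *\<^sub>R u i)" using u[of x] by blast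
      have r: "0 < dens ?w $ i" "0 < temp ?w" for i using WP[of x] by (auto simp: mem_phase_space)
      have st: "state_of ?w = (dens ?w, temp ?w)" by (simp add: state_of_def)
      have law: "- (\<Sum>j\<in>UNIV - {i}. (b i j (dens ?w $ i) (dens ?w $ j) (temp ?w) * temp ?w * dens ?w $ i * dens ?w $ j) *\<^sub>R (u i - u j))
          = \<epsilon> *\<^sub>R (- (dens ?w $ i / total_mass (dens ?w)) *\<^sub>R grad (\<lambda>y. pressure \<psi> (state_of (W t y))) x
              + (dens ?w $ i * temp ?w) *\<^sub>R grad (\<lambda>y. chem_pot \<psi> (state_of (W t y)) $ i / temp (W t y)) x
              - (temp ?w * enthalpy e p (state_of ?w) i) *\<^sub>R grad (\<lambda>y. 1 / temp (W t y)) x)"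
        "(\<Sum>i\<in>UNIV. dens ?w $ i *\<^sub>R u i) = 0" for i
        using u(1) unfolding diffusion_velocities_def Let_def by blast+
      have dissipation: "(\<Sum>i\<in>UNIV. (dens ?w $ i *\<^sub>R grad (\<lambda>y. chem_pot \<psi> (state_of (W t y)) $ i / temp (W t y)) x
            - enthalpy e p (state_of ?w) i *\<^sub>R grad (\<lambda>y. 1 / temp (W t y)) x) \<bullet> u i)
          \<le> - (\<mu> * (\<Sum>i\<in>UNIV. dens ?w $ i) / \<epsilon>) * (\<Sum>i\<in>UNIV. dens ?w $ i * (norm (u i))\<^sup>2)"
      proof (rule diffusion_dissipation[OF r(1) _ _ law(2) \<epsilon>[OF WU(1)] r(2) law(1)])
        fix i j :: 'n assume ij: "i \<noteq> j"
        show "b i j (dens ?w $ i) (dens ?w $ j) (temp ?w) = b j i (dens ?w $ j) (dens ?w $ i) (temp ?w)"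
          by (rule b_sym[OF WP[of x, unfolded st] ij])
        show "\<mu> \<le> b i j (dens ?w $ i) (dens ?w $ j) (temp ?w)"
          by (rule b_ge[OF WU(1)[of x, unfolded st] ij])
      qed
      have growth': "(\<Sum>i\<in>UNIV. (enthalpy e p (state_of ?w) i - dens ?w $ i * chem_pot \<psi> (state_of ?w) $ i)\<^sup>2 / dens ?w $ i) \<le> \<alpha> * (E + 1)"
      proof -
        have "(\<Sum>i\<in>UNIV. (enthalpy e p (state_of ?w) i - dens ?w $ i * chem_pot \<psi> (state_of ?w) $ i)\<^sup>2 / dens ?w $ i)
          = (\<Sum>j\<in>UNIV. \<bar>(enthalpy e p (state_of ?w) j - fst (state_of ?w) $ j * chem_pot \<psi> (state_of ?w) $ j) / sqrt (fst (state_of ?w) $ j)\<bar>\<^sup>2)"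
          using r(1) by (intro sum.cong refl) (simp add: power_divide less_imp_le)
        also have "\<dots> \<le> \<alpha> * (rho_e \<psi> (state_of ?w) + 1)" by (rule growth[OF WU(1)])
        also have "\<dots> \<le> \<alpha> * (E + 1)" using LE(6)[OF WU(1)] pos(2) by (intro mult_left_mono) auto
        finally show ?thesis .
      qed
      note dW = unknown_derivatives[OF WA WP]
      have n: "grad (\<lambda>y. 1 / temp (W t y)) x = - grad (\<lambda>y. temp (W t y)) x /\<^sub>R (temp ?w)\<^sup>2"
        using grad_inverse[OF dW(2)] r(2) by simp
      have "(inverse (temp ?w) *\<^sub>R grad (\<lambda>x. temp (V t x)) x + temp ?w' *\<^sub>R grad (\<lambda>x. 1 / temp (W t x)) x) \<bullet> q x
        - (\<Sum>i\<in>UNIV. (grad (\<lambda>x. chem_pot \<psi> (state_of (V t x)) $ i) x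
          - (chem_pot \<psi> (state_of ?w) $ i / temp ?w) *\<^sub>R grad (\<lambda>x. temp (V t x)) x
          - temp ?w' *\<^sub>R grad (\<lambda>x. chem_pot \<psi> (state_of (W t x)) $ i / temp (W t x)) x) \<bullet> J i x)
        \<le> \<kappa> (state_of ?w) * C1 + \<epsilon> * C2"
        unfolding C1_def C2_def u(2,3)
        by (rule diffusive_production_bound[OF r(1) bW(1)[unfolded total_mass_def] bW(2)[unfolded total_mass_def]
              dissipation \<epsilon>[OF WU(1)] pos(1,3) bW(3) bV(2) \<kappa>(1)[OF WU(1)] n B(8)[OF t x] B(9)[OF t x] growth'])
      moreover have "\<kappa> (state_of ?w) * C1 \<le> sup_norm_on \<U> \<kappa> * C1"
        using sup[OF WU(1)] pos(3) by (intro mult_right_mono) (auto simp: C1_def)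
      ultimately show "rel_I_deriv ?w ?w' (dt {0..T} W t x) (dt I V t x) + diver (rel_flux (W t) (V t) J q) x
          \<le> A / c * rel_I \<psi> ?w ?w' + sup_norm_on \<U> \<kappa> * C1 + \<epsilon> * C2"
        using production(1) transport by linarith
    qed
  qed
qed

lemma torus_integral_rel_I_nonneg:
  assumes "admissible \<epsilon> \<kappa> W" "t \<in> {0..T}"
  shows "0 \<le> torus_integral (\<lambda>x. rel_I \<psi> (W t x) (V t x))"
proof -
  obtain c where c: "0 < c" "\<And>t x w. t \<in> {0..T} \<Longrightarrow> x \<in> cell \<Longrightarrow> bounded_state \<delta> M (state_of w) \<Longrightarrow>
    c * ((norm (vel w - vel (V t x)))\<^sup>2 + (norm (state_of w - state_of (V t x)))\<^sup>2) \<le> rel_I \<psi> w (V t x)"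
  proof (rule rel_I_lower_bound, goal_cases)
    case (1 c)
    show ?case by (rule 1(1)[OF 1(2-)])
  qed
  have "0 \<le> rel_I \<psi> (W t x) (V t x)" if "x \<in> cell" for x
  proof -
    have "bounded_state \<delta> M (state_of (W t x))" using assms by (simp add: admissible_def)
    moreover have "0 \<le> c * ((norm (vel (W t x) - vel (V t x)))\<^sup>2 + (norm (state_of (W t x) - state_of (V t x)))\<^sup>2)"
      using c(1) by simp
    ultimately show ?thesis using c(2)[OF assms(2) that] order_trans by blast
  qed
  then show ?thesis 
    unfolding torus_integral_def by (cases "(\<lambda>x. rel_I \<psi> (W t x) (V t x)) integrable_on cell")
      (auto intro: integral_nonneg simp: not_integrable_integral)
qed

theorem relative_energy_estimate:
  obtains c C1 C2 where "0 < c" "0 < C1" "0 < C2"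
    and "\<And>\<epsilon> \<kappa> W t. admissible \<epsilon> \<kappa> W \<Longrightarrow> t \<in> {0<..<T} \<Longrightarrow>
      torus_integral (\<lambda>x. rel_I \<psi> (W t x) (V t x))
        \<le> c * torus_integral (\<lambda>x. rel_I \<psi> (W 0 x) (V 0 x)) + sup_norm_on \<U> \<kappa> * C1 + \<epsilon> * C2"
proof -
  obtain C D1 D2 where D: "0 \<le> C" "0 \<le> D1" "0 \<le> D2" "\<And>\<epsilon> \<kappa> W t. admissible \<epsilon> \<kappa> W \<Longrightarrow> t \<in> {0..T} \<Longrightarrow>
      \<exists>G. Ck_on 1 UNIV G \<and> torus_periodic G \<and>
        (\<forall>x\<in>cell. rel_I_deriv (W t x) (V t x) (dt {0..T} W t x) (dt I V t x) + diver G x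
          \<le> C * rel_I \<psi> (W t x) (V t x) + sup_norm_on \<U> \<kappa> * D1 + \<epsilon> * D2)"
  proof (rule relative_energy_inequality, goal_cases)
    case (1 C D1 D2)
    show ?case by (rule 1(1)[OF 1(2-)])
  qed
  define m where "m = measure lborel cell"
  define a where "a = exp (C * T)"
  have m: "m \<ge> 0" by (simp add: m_def)
  have a: "a > 0" by (simp add: a_def)
  \<comment> \<open>The summands \<open>1\<close> make the constants positive.\<close>
  show thesis
  proof (rule that[of a "a * (D1 * m * T) + 1" "a * (D2 * m * T) + 1"])
    show "0 < a" "0 < a * (D1 * m * T) + 1" "0 < a * (D2 * m * T) + 1"
      using D(2,3) m a pos(4) by (simp_all add: add_nonneg_pos)
    fix \<epsilon> \<kappa> W t assume W: "admissible \<epsilon> \<kappa> W" and t: "t \<in> {0<..<T}"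
    have WC: "C1_space_time {0..T} W" using W by (simp add: admissible_def diffusive_solution_def)
    have WP: "state_of (W t x) \<in> phase_space" if "t \<in> {0..T}" for t x
      using W that U_phase by (auto simp: admissible_def)
    have \<epsilon>: "\<epsilon> > 0" using W by (simp add: admissible_def)
    define s where "s = sup_norm_on \<U> \<kappa>"
    have s: "s \<ge> 0"
    proof -
      have \<omega>: "state_of (V 0 0) \<in> \<U>" using V_state[of 0 0] pos(4) by simp
      have "bdd_above ((\<lambda>\<omega>. \<bar>\<kappa> \<omega>\<bar>) ` \<U>)" using W by (intro bdd_aboveI[of _ M]) (auto simp: admissible_def)
      then have "\<bar>\<kappa> (state_of (V 0 0))\<bar> \<le> s" unfolding s_def sup_norm_on_def by (rule cSUP_upper[OF \<omega>])
      then show ?thesis by linarith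
    qed
    define k where "k = (s * D1 + \<epsilon> * D2) * m"
    define \<Phi> where "\<Phi> t = torus_integral (\<lambda>x. rel_I \<psi> (W t x) (V t x))" for t
    define \<Phi>' where "\<Phi>' t = torus_integral (\<lambda>x. rel_I_deriv (W t x) (V t x) (dt {0..T} W t x) (dt I V t x))" for t
    have "\<Phi> t \<le> exp (C * T) * (\<Phi> 0 + k * T)"
    proof (rule gronwall[where f'=\<Phi>'])
      show "0 \<le> C" "0 \<le> k" using D s \<epsilon> m by (simp_all add: k_def)
      show "0 \<le> \<Phi> 0" unfolding \<Phi>_def by (rule torus_integral_rel_I_nonneg[OF W]) (use pos(4) in simp)
      show "0 < t" "t \<le> T" using t by auto
      fix t assume t: "t \<in> {0..T}"
      show "(\<Phi> has_vector_derivative \<Phi>' t) (at t within {0..T})"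
        unfolding \<Phi>_def[abs_def] \<Phi>'_def
        by (rule torus_integral_rel_I_derivative[OF WC WP V_C1(1) euler(2) V_phase t])
      obtain G where G: "Ck_on 1 UNIV G" "torus_periodic G"
        "\<And>x. x \<in> cell \<Longrightarrow> rel_I_deriv (W t x) (V t x) (dt {0..T} W t x) (dt I V t x) + diver G x
          \<le> C * rel_I \<psi> (W t x) (V t x) + (s * D1 + \<epsilon> * D2)"
        using D(4)[OF W t] unfolding s_def add.assoc by blast
      have P: "continuous_on cell (\<lambda>x. (t, x))" "(\<lambda>x. (t, x)) ` cell \<subseteq> {0..T} \<times> UNIV" "(\<lambda>x. (t, x)) ` cell \<subseteq> I \<times> UNIV"
        using t euler(2) by (auto intro: continuous_on_Pair[OF continuous_on_const continuous_on_id])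
      have c: "continuous_on cell (\<lambda>x. W t x)" "continuous_on cell (\<lambda>x. V t x)"
        "continuous_on cell (\<lambda>x. dt {0..T} W t x)" "continuous_on cell (\<lambda>x. dt I V t x)"
        using WC V_C1(1) continuous_on_compose2[OF _ P(1,2), of "\<lambda>(t, x). W t x"]
          continuous_on_compose2[OF _ P(1,3), of "\<lambda>(t, x). V t x"]
          continuous_on_compose2[OF _ P(1,2), of "\<lambda>(t, x). dt {0..T} W t x"]
          continuous_on_compose2[OF _ P(1,3), of "\<lambda>(t, x). dt I V t x"]
        by (simp_all add: C1_space_time_def C1_space_def)
      note int = rel_I_deriv_continuous[OF c WP[OF t] V_phase[OF t], THEN integrable_continuous]
      have "continuous_on UNIV (diver G)"
        unfolding diver_def[abs_def] using G(1)
        by (intro continuous_on_sum bounded_linear.continuous_on[OF bounded_linear_vec_nth]) (auto simp: Ck_on_1_iff)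
      then have intG: "diver G integrable_on cell"
        by (intro integrable_continuous) (rule continuous_on_subset, auto)
      have "\<Phi>' t = \<Phi>' t + torus_integral (diver G)" by (simp add: torus_integral_diver[OF G(1,2)])
      also have "\<dots> = integral cell (\<lambda>x. rel_I_deriv (W t x) (V t x) (dt {0..T} W t x) (dt I V t x) + diver G x)"
        unfolding \<Phi>'_def torus_integral_def by (rule integral_add[OF int(1) intG, symmetric])
      also have "\<dots> \<le> integral cell (\<lambda>x. C * rel_I \<psi> (W t x) (V t x) + (s * D1 + \<epsilon> * D2))"
        by (intro integral_le integrable_add int(1) intG integrable_on_mult_right int(2) integrable_const G(3))
      also have "\<dots> = C * \<Phi> t + k"
        unfolding \<Phi>_def torus_integral_def
        by (subst integral_add[OF integrable_on_mult_right[OF int(2)] integrable_const])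
          (simp add: k_def m_def mult.commute)
      finally show "\<Phi>' t \<le> C * \<Phi> t + k" .
    qed
    also have "\<dots> = a * \<Phi> 0 + s * (a * (D1 * m * T)) + \<epsilon> * (a * (D2 * m * T))"
      unfolding a_def[symmetric] k_def by (simp add: algebra_simps)
    also have "\<dots> \<le> a * \<Phi> 0 + s * (a * (D1 * m * T) + 1) + \<epsilon> * (a * (D2 * m * T) + 1)"
      using s \<epsilon> by (simp add: distrib_left)
    finally show "torus_integral (\<lambda>x. rel_I \<psi> (W t x) (V t x))
        \<le> a * torus_integral (\<lambda>x. rel_I \<psi> (W 0 x) (V 0 x)) + sup_norm_on \<U> \<kappa> * (a * (D1 * m * T) + 1)
          + \<epsilon> * (a * (D2 * m * T) + 1)"
      unfolding \<Phi>_def s_def .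
  qed
qed

end

section \<open>The vanishing diffusion limit\<close>

lemma vanishing_params: "\<forall>\<^sub>F z in vanishing S A. z \<in> A"
  unfolding vanishing_def by (rule filter_leD[OF inf_le2]) (simp add: eventually_principal)

lemma vanishing_tendsto:
  "((\<lambda>(\<epsilon>, \<kappa>). \<epsilon>) \<longlongrightarrow> 0) (vanishing S A)" "((\<lambda>(\<epsilon>, \<kappa>). sup_norm_on S \<kappa>) \<longlongrightarrow> 0) (vanishing S A)"
proof -
  have "((\<lambda>(\<epsilon>, \<kappa>). (\<epsilon>, sup_norm_on S \<kappa>)) \<longlongrightarrow> (0, 0)) (vanishing S A)"
    unfolding vanishing_def by (rule filterlim_mono[OF filterlim_filtercomap order_refl inf_le1])
  from tendsto_fst[OF this] tendsto_snd[OF this]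
  show "((\<lambda>(\<epsilon>, \<kappa>). \<epsilon>) \<longlongrightarrow> 0) (vanishing S A)" "((\<lambda>(\<epsilon>, \<kappa>). sup_norm_on S \<kappa>) \<longlongrightarrow> 0) (vanishing S A)"
    by (simp_all add: case_prod_beta')
qed

theorem theorem3:
  fixes \<psi> :: "'n::finite state \<Rightarrow> real"
    and e p :: "'n state \<Rightarrow> real^'n"
    and b :: "'n \<Rightarrow> 'n \<Rightarrow> real \<Rightarrow> real \<Rightarrow> real \<Rightarrow> real"
    and \<U> :: "'n state set"
    and Ubar :: "'n flow"
    and Params :: "(real \<times> ('n state \<Rightarrow> real)) set"
    and U :: "real \<Rightarrow> ('n state \<Rightarrow> real) \<Rightarrow> 'n flow"
    and T \<delta> M \<alpha> \<mu> :: real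
    and Tstar :: ereal
  assumes "\<U> \<subseteq> phase_space" and "compact (closure \<U>)"
    and "Ck_on 2 phase_space \<psi>" and "Ck_near 3 (closure \<U>) \<psi>"
    and "convex_internal_energy \<psi>"
    and "\<And>\<omega>. \<omega> \<in> phase_space \<Longrightarrow> (\<Sum>i\<in>UNIV. fst \<omega> $ i * e \<omega> $ i) = rho_e \<psi> \<omega>"
    and "\<And>\<omega>. \<omega> \<in> phase_space \<Longrightarrow> (\<Sum>i\<in>UNIV. p \<omega> $ i) = pressure \<psi> \<omega>"
    and "\<And>r \<theta> i j. (r, \<theta>) \<in> phase_space \<Longrightarrow> i \<noteq> j \<Longrightarrow>
           b i j (r $ i) (r $ j) \<theta> = b j i (r $ j) (r $ i) \<theta> \<and> 0 < b i j (r $ i) (r $ j) \<theta>"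
    and "0 < \<mu>"
    and "\<And>r \<theta> i j. (r, \<theta>) \<in> \<U> \<Longrightarrow> i \<noteq> j \<Longrightarrow> \<mu> \<le> b i j (r $ i) (r $ j) \<theta>"
    and "0 < \<alpha>"
    and "\<And>\<omega>. \<omega> \<in> \<U> \<Longrightarrow>
           (\<Sum>j\<in>UNIV. \<bar>(enthalpy e p \<omega> j - fst \<omega> $ j * chem_pot \<psi> \<omega> $ j) / sqrt (fst \<omega> $ j)\<bar>\<^sup>2)
             \<le> \<alpha> * (rho_e \<psi> \<omega> + 1)"
    and "0 < \<delta>" and "0 < M" and "0 < T" and "ereal T < Tstar"
    and "maximal_euler_solution \<psi> Tstar Ubar" and "smooth (Ubar 0)"
    and "\<And>t x. t \<in> {0..T} \<Longrightarrow>
           state_of (Ubar t x) \<in> \<U> \<and> bounded_state \<delta> M (state_of (Ubar t x))"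
    and "\<And>\<epsilon> \<kappa>. (\<epsilon>, \<kappa>) \<in> Params \<Longrightarrow> 0 < \<epsilon>"
    and "\<And>\<epsilon> \<kappa> \<omega>. (\<epsilon>, \<kappa>) \<in> Params \<Longrightarrow> \<omega> \<in> \<U> \<Longrightarrow> 0 \<le> \<kappa> \<omega> \<and> \<kappa> \<omega> \<le> M"
    and "\<And>\<epsilon> \<kappa>. (\<epsilon>, \<kappa>) \<in> Params \<Longrightarrow>
           diffusive_solution \<psi> e p b \<epsilon> \<kappa> {0..T} (U \<epsilon> \<kappa>) \<and> smooth (U \<epsilon> \<kappa> 0)"
    and "\<And>\<epsilon> \<kappa> t x. (\<epsilon>, \<kappa>) \<in> Params \<Longrightarrow> t \<in> {0..T} \<Longrightarrow>
           state_of (U \<epsilon> \<kappa> t x) \<in> \<U> \<and> bounded_state \<delta> M (state_of (U \<epsilon> \<kappa> t x))"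
  shows "(\<exists>c>0. \<exists>C1>0. \<exists>C2>0. \<forall>(\<epsilon>, \<kappa>)\<in>Params. \<forall>t\<in>{0<..<T}.
            torus_integral (\<lambda>x. rel_I \<psi> (U \<epsilon> \<kappa> t x) (Ubar t x))
              \<le> c * torus_integral (\<lambda>x. rel_I \<psi> (U \<epsilon> \<kappa> 0 x) (Ubar 0 x))
                + sup_norm_on \<U> \<kappa> * C1 + \<epsilon> * C2)
       \<and> (((\<lambda>(\<epsilon>, \<kappa>). torus_integral (\<lambda>x. rel_I \<psi> (U \<epsilon> \<kappa> 0 x) (Ubar 0 x))) \<longlongrightarrow> 0) (vanishing \<U> Params)
           \<longrightarrow> ((\<lambda>(\<epsilon>, \<kappa>). SUP t\<in>{0<..<T}.
                    torus_integral (\<lambda>x. rel_I \<psi> (U \<epsilon> \<kappa> t x) (Ubar t x))) \<longlongrightarrow> 0) (vanishing \<U> Params))"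
proof -
  note assm = assms
  interpret diffusion_limit \<psi> e p b \<U> Ubar "times_below Tstar" T \<delta> M \<alpha> \<mu>
  proof unfold_locales
    show "open (phase_space :: 'n state set)" by (rule open_phase_space)
    show "euler_solution \<psi> (times_below Tstar) Ubar"
      using assm(17) by (simp add: maximal_euler_solution_def)
    show "{0..T} \<subseteq> times_below Tstar"
      using assm(16) by (auto simp: times_below_def intro: le_less_trans[of _ "ereal T"])
    show "b i j (r $ i) (r $ j) \<theta> = b j i (r $ j) (r $ i) \<theta>" if "(r, \<theta>) \<in> phase_space" "i \<noteq> j" for r \<theta> i j
      using assm(8)[OF that] by blast
  qed (fact assm)+
  have adm: "admissible \<epsilon> \<kappa> (U \<epsilon> \<kappa>)" if "(\<epsilon>, \<kappa>) \<in> Params" for \<epsilon> \<kappa>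
    unfolding admissible_def using assm(20)[OF that] assm(21)[OF that] assm(22)[OF that] assm(23)[OF that] by blast
  obtain c C1 C2 where C: "0 < c" "0 < C1" "0 < C2" and est: "\<And>\<epsilon> \<kappa> W t. admissible \<epsilon> \<kappa> W \<Longrightarrow> t \<in> {0<..<T} \<Longrightarrow>
      torus_integral (\<lambda>x. rel_I \<psi> (W t x) (Ubar t x))
        \<le> c * torus_integral (\<lambda>x. rel_I \<psi> (W 0 x) (Ubar 0 x)) + sup_norm_on \<U> \<kappa> * C1 + \<epsilon> * C2"
  proof (rule relative_energy_estimate, goal_cases)
    case (1 c C1 C2)
    show ?case by (rule 1(1)[OF 1(2-)])
  qed
  show ?thesis
  proof (intro conjI impI)
    show "\<exists>c>0. \<exists>C1>0. \<exists>C2>0. \<forall>(\<epsilon>, \<kappa>)\<in>Params. \<forall>t\<in>{0<..<T}.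
            torus_integral (\<lambda>x. rel_I \<psi> (U \<epsilon> \<kappa> t x) (Ubar t x))
              \<le> c * torus_integral (\<lambda>x. rel_I \<psi> (U \<epsilon> \<kappa> 0 x) (Ubar 0 x))
                + sup_norm_on \<U> \<kappa> * C1 + \<epsilon> * C2"
    proof (intro exI conjI ballI, safe)
      fix \<epsilon> \<kappa> t assume "(\<epsilon>, \<kappa>) \<in> Params" "t \<in> {0<..<T}"
      then show "torus_integral (\<lambda>x. rel_I \<psi> (U \<epsilon> \<kappa> t x) (Ubar t x))
              \<le> c * torus_integral (\<lambda>x. rel_I \<psi> (U \<epsilon> \<kappa> 0 x) (Ubar 0 x))
                + sup_norm_on \<U> \<kappa> * C1 + \<epsilon> * C2"
        by (intro est adm)
    qed (rule C)+
    assume init: "((\<lambda>(\<epsilon>, \<kappa>). torus_integral (\<lambda>x. rel_I \<psi> (U \<epsilon> \<kappa> 0 x) (Ubar 0 x))) \<longlongrightarrow> 0) (vanishing \<U> Params)"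
    let ?upper = "\<lambda>z. c * (case z of (\<epsilon>, \<kappa>) \<Rightarrow> torus_integral (\<lambda>x. rel_I \<psi> (U \<epsilon> \<kappa> 0 x) (Ubar 0 x)))
      + (case z of (\<epsilon>, \<kappa>) \<Rightarrow> sup_norm_on \<U> \<kappa>) * C1 + (case z of (\<epsilon>, \<kappa>) \<Rightarrow> \<epsilon>) * C2"
    let ?sup = "\<lambda>(\<epsilon>, \<kappa>). SUP t\<in>{0<..<T}. torus_integral (\<lambda>x. rel_I \<psi> (U \<epsilon> \<kappa> t x) (Ubar t x))"
    have upper: "(?upper \<longlongrightarrow> c * 0 + 0 * C1 + 0 * C2) (vanishing \<U> Params)"
      by (intro tendsto_intros init vanishing_tendsto)
    have bounds: "0 \<le> ?sup z \<and> ?sup z \<le> ?upper z" if "z \<in> Params" for z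
    proof -
      obtain \<epsilon> \<kappa> where z: "z = (\<epsilon>, \<kappa>)" by (cases z)
      note A = adm[OF that[unfolded z]]
      have T2: "T / 2 \<in> {0<..<T}" using pos(4) by simp
      have "?sup z \<le> ?upper z"
        unfolding z prod.case by (rule cSUP_least) (use T2 est[OF A] in auto)
      moreover have "0 \<le> ?sup z"
      proof -
        have "0 \<le> torus_integral (\<lambda>x. rel_I \<psi> (U \<epsilon> \<kappa> (T / 2) x) (Ubar (T / 2) x))"
          by (rule torus_integral_rel_I_nonneg[OF A]) (use pos(4) in simp)
        also have "\<dots> \<le> ?sup z"
          unfolding z prod.case
          by (rule cSUP_upper[OF T2]) (intro bdd_aboveI2[OF est[OF A]])
        finally show ?thesis .
      qed
      ultimately show ?thesis by blast
    qed
    have ev: "\<forall>\<^sub>F z in vanishing \<U> Params. 0 \<le> ?sup z \<and> ?sup z \<le> ?upper z"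
      by (rule eventually_mono[OF vanishing_params bounds])
    have "c * 0 + 0 * C1 + 0 * C2 = 0" by simp
    then have upper0: "(?upper \<longlongrightarrow> 0) (vanishing \<U> Params)" using upper by (simp only:)
    show "(?sup \<longlongrightarrow> 0) (vanishing \<U> Params)"
      by (rule tendsto_sandwich[OF eventually_mono[OF ev conjunct1] eventually_mono[OF ev conjunct2] tendsto_const upper0])
  qed
qed

end
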